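(* Let $n$ and $k$ be positive integers with $2\le k\le n-1$, let $\mathcal{G}_{n,k}$ denote the set of connected simple graphs of order $n$ with dissociation number $k$, and suppose $G\in\mathcal{G}_{n,k}$ satisfies $\rho(G)\le\rho(H)$ for every $H\in\mathcal{G}_{n,k}$. Then: (i) If $k=n-1$, then $G\cong S(r,\lfloor (n-1)/2\rfloor)$, where $r=0$ if $n$ is odd and $r=1$ if $n$ is even. (ii) If $k=n-2$ and $n\ge 10$, then $G\cong H(n)$. (iii) If $k=\lceil 2n/3\rceil$, then $G$ is a path. (iv) If $k=\lfloor 2n/3\rfloor$ and $n\not\equiv 0 \pmod 3$, then $G$ is a cycle. (v) If $k=2$, then $G$ is a balanced complete $\lceil n/2\rceil$-partite graph.
   Context: All graphs are finite and simple. A set $S$ of vertices of a graph $G$ is a dissociation set if $G[S]$ has maximum degree at most $1$; the dissociation number of $G$ is the maximum cardinality of a dissociation set. $\rho(G)$ is the largest eigenvalue of the adjacency matrix of $G$. Attaching a branch edge to a vertex $v$ means adding two new vertices $a,b$ and the edges $va$, $ab$; attaching a leaf to $v$ means adding a new vertex adjacent only to $v$. $S(r,t)$ is the tree consisting of a center vertex $c$ to which $r$ leaves and $t$ branch edges are attached (so it has $1+r+2t$ vertices). For even $n\ge 4$, $H(n)$ is the tree obtained from a path $abcd$ on four vertices by attaching $\lceil (n-4)/2\rceil$ branch edges to $a$ and $\lfloor (n-4)/2\rfloor$ branch edges to $d$. For odd $n\ge 5$, $H(n)$ is obtained from $H(n-1)$ by attaching one leaf to the end vertex $d$ (the end of the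 path $abcd$ carrying $\lfloor (n-5)/2\rfloor$ branch edges, i.e. the one of degree $\lfloor (n-5)/2\rfloor+1$). A complete $m$-partite graph of order $n$ is one whose vertex set is partitioned into $m$ parts $V_1,\dots,V_m$ with $uv$ an edge iff $u,v$ lie in different parts; it is balanced if $|V_i|\in\{\lceil n/m\rceil,\lfloor n/m\rfloor\}$ for all $i$.
   Formalization: H(n) is taken with ⌈(n-4)/4⌉ branch edges at a and ⌊(n-4)/4⌋ at d for even n (for odd n a leaf is added at d of H(n-1)), because ⌈(n-4)/2⌉ and ⌊(n-4)/2⌋ would give 2n-4 vertices instead of n, making (ii) false. *)

theory Defs
  imports
    "Graph_Theory.Graph_Theory"
    "Jordan_Normal_Form.Spectral_Radius"
    "HOL-Library.Disjoint_Sets"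
    "HOL-Library.Countable_Set"
begin

text \<open>
  A finite simple graph is a \<^locale>\<open>pair_graph\<close> of the AFP entry Graph_Theory: a finite,
  symmetric, loop-free digraph without parallel arcs, each edge \<open>uv\<close> being represented by the two
  arcs \<open>(u, v)\<close> and \<open>(v, u)\<close>.  The degree of a vertex is its out-degree.
\<close>

definition graph_iso :: "'a pair_pre_digraph \<Rightarrow> 'b pair_pre_digraph \<Rightarrow> bool" where
  "graph_iso G H \<longleftrightarrow> digraph_iso (with_proj G) (with_proj H)"


section \<open>Dissociation number and spectral radius\<close>

definition dissociation_set :: "'a pair_pre_digraph \<Rightarrow> 'a set \<Rightarrow> bool" where
  "dissociation_set G S \<longleftrightarrow>
     S \<subseteq> pverts G \<and> (\<forall>v\<in>S. out_degree (with_proj G \<restriction> S) v \<le> 1)"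

definition dissociation_number :: "'a pair_pre_digraph \<Rightarrow> nat" where
  "dissociation_number G = Max (card ` {S. dissociation_set G S})"

text \<open>
  For a finite vertex set, \<^term>\<open>from_nat_into (pverts G)\<close> enumerates the vertices bijectively on
  \<open>{..<card (pverts G)}\<close>.  The order of the enumeration is unspecified; the spectrum does not
  depend on it.
\<close>

definition adjacency_matrix :: "'a pair_pre_digraph \<Rightarrow> real mat" where
  "adjacency_matrix G = mat (card (pverts G)) (card (pverts G))
     (\<lambda>(i, j). if (from_nat_into (pverts G) i, from_nat_into (pverts G) j) \<in> parcs G
               then 1 else 0)"

definition rho :: "'a pair_pre_digraph \<Rightarrow> real" where
  "rho G = Max (spectrum (adjacency_matrix G))"

definition connected_graphs_with_dissociation_number ::
    "nat \<Rightarrow> nat \<Rightarrow> 'a pair_pre_digraph set" where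
  "connected_graphs_with_dissociation_number n k =
     {G. pair_graph G \<and> Digraph_Component.connected (with_proj G) \<and>
         card (pverts G) = n \<and> dissociation_number G = k}"


section \<open>Paths, cycles and complete multipartite graphs\<close>

definition path_graph :: "nat \<Rightarrow> nat pair_pre_digraph" where
  "path_graph n = \<lparr> pverts = {0..<n},
     parcs = {(i, j). i < n \<and> j < n \<and> (j = Suc i \<or> i = Suc j)} \<rparr>"

text \<open>Meaningful for \<open>n \<ge> 3\<close> only.\<close>

definition cycle_graph :: "nat \<Rightarrow> nat pair_pre_digraph" where
  "cycle_graph n = \<lparr> pverts = {0..<n},
     parcs = {(i, j). i < n \<and> j < n \<and> (j = Suc i mod n \<or> i = Suc j mod n)} \<rparr>"

definition is_path_graph :: "'a pair_pre_digraph \<Rightarrow> bool" where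
  "is_path_graph G \<longleftrightarrow> (\<exists>m\<ge>1. graph_iso G (path_graph m))"

definition is_cycle_graph :: "'a pair_pre_digraph \<Rightarrow> bool" where
  "is_cycle_graph G \<longleftrightarrow> (\<exists>m\<ge>3. graph_iso G (cycle_graph m))"

definition complete_multipartite :: "'a pair_pre_digraph \<Rightarrow> 'a set set \<Rightarrow> bool" where
  "complete_multipartite G P \<longleftrightarrow> partition_on (pverts G) P \<and>
     (\<forall>u\<in>pverts G. \<forall>v\<in>pverts G.
        (u, v) \<in> parcs G \<longleftrightarrow> \<not> (\<exists>X\<in>P. u \<in> X \<and> v \<in> X))"

definition balanced_complete_multipartite :: "nat \<Rightarrow> 'a pair_pre_digraph \<Rightarrow> bool" where
  "balanced_complete_multipartite m G \<longleftrightarrow>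
     (\<exists>P. complete_multipartite G P \<and> finite P \<and> card P = m \<and>
        (\<forall>X\<in>P. int (card X) \<in> {\<lceil>real (card (pverts G)) / real m\<rceil>,
                               \<lfloor>real (card (pverts G)) / real m\<rfloor>}))"


section \<open>The trees \<open>S(r, t)\<close> and \<open>H(n)\<close>\<close>

definition fresh_vertex :: "nat pair_pre_digraph \<Rightarrow> nat" where
  "fresh_vertex G = Suc (Max (pverts G))"

definition attach_leaf :: "nat \<Rightarrow> nat pair_pre_digraph \<Rightarrow> nat pair_pre_digraph" where
  "attach_leaf v G = (let a = fresh_vertex G in
     \<lparr> pverts = insert a (pverts G), parcs = parcs G \<union> {(v, a), (a, v)} \<rparr>)"

definition attach_branch_edge :: "nat \<Rightarrow> nat pair_pre_digraph \<Rightarrow> nat pair_pre_digraph" where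
  "attach_branch_edge v G = (let a = fresh_vertex G; b = Suc a in
     \<lparr> pverts = pverts G \<union> {a, b},
       parcs = parcs G \<union> {(v, a), (a, v), (a, b), (b, a)} \<rparr>)"

definition S_tree :: "nat \<Rightarrow> nat \<Rightarrow> nat pair_pre_digraph" where
  "S_tree r t =
     (attach_branch_edge 0 ^^ t) ((attach_leaf 0 ^^ r) \<lparr> pverts = {0}, parcs = {} \<rparr>)"

text \<open>
  The path \<open>abcd\<close> is \<^term>\<open>path_graph 4\<close>, so \<open>a = 0\<close> and \<open>d = 3\<close>.  For \<open>H(n)\<close> with \<open>n\<close> even to have
  order \<open>n\<close>, the \<open>(n - 4)/2\<close> branch edges have to be distributed over \<open>a\<close> and \<open>d\<close> together, that is,
  \<open>\<lceil>(n - 4)/4\<rceil>\<close> go to \<open>a\<close> and \<open>\<lfloor>(n - 4)/4\<rfloor>\<close> go to \<open>d\<close>.  (With \<open>\<lceil>(n - 4)/2\<rceil>\<close> and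
  \<open>\<lfloor>(n - 4)/2\<rfloor>\<close> instead, the tree would have \<open>2n - 4\<close> vertices.)
\<close>

definition H_tree_even :: "nat \<Rightarrow> nat pair_pre_digraph" where
  "H_tree_even n =
     (attach_branch_edge 3 ^^ nat \<lfloor>(real n - 4) / 4\<rfloor>)
       ((attach_branch_edge 0 ^^ nat \<lceil>(real n - 4) / 4\<rceil>) (path_graph 4))"

definition H_tree :: "nat \<Rightarrow> nat pair_pre_digraph" where
  "H_tree n = (if even n then H_tree_even n else attach_leaf 3 (H_tree_even (n - 1)))"

end

theory Submission
  imports Defs "HOL-Analysis.Function_Topology"
begin

text \<open>
  A connected graph has a positive vector \<open>y\<close> with \<open>A y = \<rho> y\<close>.  Pairing \<open>y\<close> with a nonnegative test
  vector \<open>h\<close> with \<open>A h \<ge> \<lambda> h\<close> gives \<open>\<rho> \<ge> \<lambda>\<close>, strictly if the inequality is strict somewhere; hence a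
  spanning copy of a connected graph \<open>H\<close> in \<open>G\<close> together with \<open>\<rho>(G) \<le> \<rho>(H)\<close> forces \<open>G \<cong> H\<close>.

  For \<open>k = 2\<close> the complement of \<open>G\<close> is a matching, and the test vector is the Perron vector of the
  balanced graph.  A graph in which every vertex set spans a vertex of degree at most 1 has a
  dissociation set of size at least \<open>2n/3\<close>, so a graph with \<open>k < 2n/3\<close> contains a subgraph of minimum
  degree 2, and the indicator of its vertex set shows \<open>\<rho> \<ge> 2\<close> with equality only for cycles.
  If \<open>\<rho>(G) \<le> \<rho>(P\<^sub>n) = 2 cos \<theta>\<close> with \<open>\<theta> = \<pi>/(n+1)\<close>, then a connected piece with \<open>m\<close> vertices hanging off
  \<open>v\<close> contributes at least \<open>f(m) y(v)\<close> to the neighbour sum of \<open>v\<close>, where \<open>f(m) = sin(m\<theta>)/sin((m+1)\<theta>)\<close>;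
  as \<open>f\<close> is strictly subadditive and \<open>f(n-1) = 2 cos \<theta>\<close>, no vertex has degree 3 or more.

  For \<open>k = n - 1\<close> and \<open>k = n - 2\<close>, delete one or two hub vertices such that the rest has maximum degree 1.
  With \<open>x = \<rho>\<^sup>2\<close> and \<open>\<sigma> = x/(x-1)\<close>, a hub \<open>u\<close> with \<open>r\<close> leaves and \<open>t\<close> branch edges satisfies
  \<open>(x - r - t \<sigma>) y(u) \<ge> \<rho> y(c)\<close> for each further neighbour \<open>c\<close>.  With one hub this gives
  \<open>r + t \<sigma> \<le> x\<close>.  With two hubs, multiplying the two inequalities bounds a product from below, its
  factors have a sum determined by the order of \<open>G\<close>, and AM-GM leaves only the parameters of \<open>H(n)\<close>.
\<close>

section \<open>Perron vectors of connected graphs\<close>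

text \<open>\<open>G\<close> is compared in each case with one explicit graph of the same order and
  dissociation number. The obstacle is that \<rho> of \<open>H(n)\<close> has no closed form; all
  that is known is an equation for the product of two hub factors \<open>x - r - t \<sigma>\<close>.
  A link between the hubs gives both inequalities a common weight \<open>\<beta>\<close>, so that
  the product is at least \<open>\<beta>\<^sup>2\<close>. The weight is \<open>\<rho>\<close> for
  adjacent hubs, 1 for a common leaf, \<open>\<sigma>\<close> for a common neighbour that carries a
  further vertex, and \<open>\<sigma> / \<rho>\<close> for a path through two vertices. The heavier
  links are impossible, and the last one leaves no room for other parameters. The sum of the factors
  is controlled because the order fixes \<open>r + 2 t\<close>: replacing a branch edge by two
  leaves lowers it by \<open>2 - \<sigma>\<close>, which is positive since \<open>x > 4\<close>
  means \<open>\<sigma> < 4 / 3\<close>. For the path, \<open>f(a) + f(b) = f(n - 1)\<close> when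
  \<open>a + b = n - 1\<close>, as at an inner vertex of the path; a contradiction therefore has to
  come from a third neighbour.\<close>

definition nsum :: "'a rel \<Rightarrow> ('a \<Rightarrow> real) \<Rightarrow> 'a \<Rightarrow> real" where
  "nsum E y v = (\<Sum>w\<in>E `` {v}. y w)"

locale sgraph =
  fixes V :: "'a set" and E :: "'a rel"
  assumes fin: "finite V"
    and sub: "E \<subseteq> V \<times> V"
    and symE: "(a, b) \<in> E \<Longrightarrow> (b, a) \<in> E"
    and irr: "(a, a) \<notin> E"
begin

lemma fin_nb [simp, intro]: "finite (E `` {v})"
  using fin sub by (auto intro: finite_subset)

lemma nb_sub: "E `` {v} \<subseteq> V"
  using sub by auto

lemma nsum_V: "nsum E y v = (\<Sum>w\<in>V. if (v, w) \<in> E then y w else 0)"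
proof -
  have "E `` {v} = {w \<in> V. (v, w) \<in> E}" using sub by auto
  then show ?thesis by (simp add: nsum_def sum.inter_filter[OF fin])
qed

text \<open>Self-adjointness of the adjacency operator, from the symmetry of \<open>E\<close>; it
  allows a test vector to be paired with an eigenvector.\<close>

lemma nsum_swap: "(\<Sum>v\<in>V. h v * nsum E y v) = (\<Sum>v\<in>V. nsum E h v * y v)"
proof -
  have "(\<Sum>v\<in>V. h v * nsum E y v) = (\<Sum>v\<in>V. \<Sum>w\<in>V. if (v, w) \<in> E then h v * y w else 0)"
    by (simp add: nsum_V sum_distrib_left if_distrib cong: if_cong)
  also have "\<dots> = (\<Sum>w\<in>V. \<Sum>v\<in>V. if (v, w) \<in> E then h v * y w else 0)"
    by (rule sum.swap)
  also have "\<dots> = (\<Sum>w\<in>V. \<Sum>v\<in>V. if (w, v) \<in> E then h v * y w else 0)"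
    by (intro sum.cong refl) (use symE in auto)
  also have "\<dots> = (\<Sum>w\<in>V. nsum E h w * y w)"
    by (simp add: nsum_V sum_distrib_right if_distribR if_distrib cong: if_cong)
  finally show ?thesis .
qed

lemma nsum_mono: "(\<And>w. w \<in> V \<Longrightarrow> y w \<le> z w) \<Longrightarrow> nsum E y v \<le> nsum E z v"
  unfolding nsum_def by (rule sum_mono) (use nb_sub in blast)

text \<open>First-order optimality, tested by perturbations at the single vertex \<open>z\<close>.
  As \<open>z\<close> has no loop, such a perturbation has no quadratic part in the form, so the
  defect \<open>d\<close> satisfies \<open>2 * e * d \<le> \<mu> * e\<^sup>2\<close> for every
  \<open>e\<close>, which forces \<open>d = 0\<close>.\<close>

lemma eigenvector_of_maximum:
  fixes x :: "'a \<Rightarrow> real"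
  assumes max: "\<And>f. (\<Sum>v\<in>V. f v * nsum E f v) \<le> \<mu> * (\<Sum>v\<in>V. (f v)\<^sup>2)"
    and x: "(\<Sum>v\<in>V. x v * nsum E x v) = \<mu>" "(\<Sum>v\<in>V. (x v)\<^sup>2) = 1"
    and z: "z \<in> V"
  shows "nsum E x z = \<mu> * x z"
proof -
  define d where "d = nsum E x z - \<mu> * x z"
  have *: "2 * e * d \<le> \<mu> * e\<^sup>2" for e
  proof -
    define g where "g = (\<lambda>v. if v = z then e else 0)"
    define f where "f = (\<lambda>v. x v + g v)"
    have gz: "(\<Sum>v\<in>V. h v * g v) = h z * e" for h :: "'a \<Rightarrow> real"
      unfolding g_def using z fin by (simp add: if_distrib cong: if_cong)
    have nf: "nsum E f v = nsum E x v + nsum E g v" for v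
      by (simp add: nsum_def f_def sum.distrib)
    have ng: "nsum E g z = 0"
      unfolding nsum_def g_def using irr by (auto intro!: sum.neutral)
    have "(\<Sum>v\<in>V. f v * nsum E f v)
        = (\<Sum>v\<in>V. x v * nsum E x v) + (\<Sum>v\<in>V. g v * nsum E x v)
          + (\<Sum>v\<in>V. x v * nsum E g v) + (\<Sum>v\<in>V. g v * nsum E g v)"
      unfolding nf by (simp add: f_def algebra_simps sum.distrib)
    also have "(\<Sum>v\<in>V. x v * nsum E g v) = (\<Sum>v\<in>V. nsum E x v * g v)"
      by (rule nsum_swap)
    also have "(\<Sum>v\<in>V. g v * nsum E g v) = (\<Sum>v\<in>V. nsum E g v * g v)"
      by (simp add: mult.commute)
    also have "(\<Sum>v\<in>V. g v * nsum E x v) = (\<Sum>v\<in>V. nsum E x v * g v)"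
      by (simp add: mult.commute)
    finally have q: "(\<Sum>v\<in>V. f v * nsum E f v) = \<mu> + 2 * e * nsum E x z"
      by (simp add: gz ng x)
    have "(\<Sum>v\<in>V. (f v)\<^sup>2) = (\<Sum>v\<in>V. (x v)\<^sup>2) + 2 * (\<Sum>v\<in>V. x v * g v) + (\<Sum>v\<in>V. g v * g v)"
      by (simp add: f_def power2_eq_square algebra_simps sum.distrib sum_distrib_left)
    also have "\<dots> = 1 + 2 * e * x z + e\<^sup>2"
      unfolding gz x by (simp add: g_def power2_eq_square)
    finally have "\<mu> + 2 * e * nsum E x z \<le> \<mu> * (1 + 2 * e * x z + e\<^sup>2)"
      using max[of f] q by simp
    then show ?thesis by (simp add: d_def algebra_simps)
  qed
  have "d = 0"
  proof (rule ccontr)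
    assume "d \<noteq> 0"
    \<comment> \<open>With \<open>c > \<mu>\<close> the choice \<open>e = d / c\<close> makes the
      linear term exceed the quadratic one; adding 1 keeps \<open>c\<close> positive when
      \<open>\<mu> = 0\<close>.\<close>
    define c where "c = \<bar>\<mu>\<bar> + 1"
    have c: "c > 0" "\<mu> < c" by (auto simp: c_def)
    have "2 * (d / c) * d \<le> \<mu> * (d / c)\<^sup>2" by (rule *)
    also have "\<dots> \<le> c * (d / c)\<^sup>2" using c by (intro mult_right_mono) auto
    also have "\<dots> = (d / c) * d" using c by (simp add: power2_eq_square)
    finally have "d * d / c \<le> 0" by simp
    moreover have "d * d / c > 0" using c \<open>d \<noteq> 0\<close> by (auto simp: zero_less_divide_iff zero_less_mult_iff)
    ultimately show False by simp
  qed
  then show ?thesis by (simp add: d_def)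
qed

text \<open>The form is maximised over the nonnegative part of the unit sphere, which is compact;
  the bound extends to all \<open>f\<close> because passing to normalised absolute values does not
  decrease the form.\<close>

lemma maximum_attained:
  assumes "V \<noteq> {}"
  obtains x \<mu> where "\<And>v. v \<in> V \<Longrightarrow> 0 \<le> x v" "(\<Sum>v\<in>V. x v * nsum E x v) = \<mu>" "(\<Sum>v\<in>V. (x v)\<^sup>2) = 1"
    "\<And>f. (\<Sum>v\<in>V. f v * nsum E f v) \<le> \<mu> * (\<Sum>v\<in>V. (f v)\<^sup>2)"
proof -
  define q where "q = (\<lambda>f. \<Sum>v\<in>V. f v * nsum E f v)"
  define K where "K = (PiE V (\<lambda>_. {0..1::real})) \<inter> {f. (\<Sum>v\<in>V. (f v)\<^sup>2) = 1}"
  \<comment> \<open>Coordinates outside \<open>V\<close> range over a singleton, so the extensional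
    functions on \<open>V\<close> become a Tychonoff product over the whole type.\<close>
  have "compactin (product_topology (\<lambda>_. euclidean) UNIV) (PiE UNIV (\<lambda>v. if v \<in> V then {0..1::real} else {undefined}))"
    by (subst compactin_PiE) auto
  moreover have "PiE UNIV (\<lambda>v. if v \<in> V then {0..1::real} else {undefined}) = PiE V (\<lambda>_. {0..1::real})"
    by (fastforce simp: PiE_def Pi_def extensional_def split: if_splits)
  ultimately have comp: "compact (PiE V (\<lambda>_. {0..1::real}))"
    using euclidean_product_topology[where 'a='a and 'b=real] compactin_euclidean_iff by metis
  have "continuous_on UNIV (\<lambda>f::'a\<Rightarrow>real. \<Sum>v\<in>V. (f v)\<^sup>2)"
    by (intro continuous_intros continuous_on_product_coordinates)
  then have "closed {f::'a\<Rightarrow>real. (\<Sum>v\<in>V. (f v)\<^sup>2) = 1}"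
    by (rule closed_Collect_eq) (intro continuous_intros)
  with comp have K: "compact K" unfolding K_def by (rule compact_Int_closed)
  have contq: "continuous_on K q" unfolding q_def nsum_def
    by (intro continuous_intros continuous_on_subset[OF continuous_on_product_coordinates]) auto
  obtain a where a: "a \<in> V" using assms by auto
  have "(\<lambda>v\<in>V. if v = a then 1 else 0) \<in> K"
    using a fin by (auto simp: K_def if_distrib[of "\<lambda>t. t\<^sup>2"] cong: if_cong)
  then have "K \<noteq> {}" by auto
  from continuous_attains_sup[OF K this contq]
  obtain x where xK: "x \<in> K" and xm: "\<And>y. y \<in> K \<Longrightarrow> q y \<le> q x" by auto
  have x: "\<And>v. v \<in> V \<Longrightarrow> 0 \<le> x v" "(\<Sum>v\<in>V. (x v)\<^sup>2) = 1"
    using xK by (auto simp: K_def)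
  have "q f \<le> q x * (\<Sum>v\<in>V. (f v)\<^sup>2)" for f
  proof -
    define s where "s = (\<Sum>v\<in>V. (f v)\<^sup>2)"
    show ?thesis
    proof (cases "s = 0")
      case True
      then have "\<And>v. v \<in> V \<Longrightarrow> f v = 0" using fin by (simp add: s_def sum_nonneg_eq_0_iff)
      then have "q f = 0" by (simp add: q_def)
      then show ?thesis using True s_def by simp
    next
      case False
      then have s: "s > 0" by (simp add: s_def sum_nonneg less_le)
      define c where "c = 1 / sqrt s"
      have c: "c > 0" "c\<^sup>2 * s = 1" using s by (auto simp: c_def power_divide)
      define g where "g = (\<lambda>v\<in>V. c * \<bar>f v\<bar>)"
      have sg: "(\<Sum>v\<in>V. (g v)\<^sup>2) = 1"
        using c by (simp add: g_def power_mult_distrib s_def flip: sum_distrib_left)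
      have "g v \<le> 1" if "v \<in> V" for v
      proof -
        have "(g v)\<^sup>2 \<le> (\<Sum>v\<in>V. (g v)\<^sup>2)" by (rule member_le_sum) (use that fin in auto)
        then have "(g v)\<^sup>2 \<le> 1\<^sup>2" by (simp add: sg)
        then show ?thesis by (rule power2_le_imp_le) simp
      qed
      then have gK: "g \<in> K" using sg c by (auto simp: K_def g_def)
      have "c\<^sup>2 * q f \<le> q g"
      proof -
        have "c\<^sup>2 * q f = (\<Sum>v\<in>V. \<Sum>w\<in>E``{v}. (c * f v) * (c * f w))"
          by (simp add: q_def nsum_def sum_distrib_left power2_eq_square mult_ac)
        also have "\<dots> \<le> (\<Sum>v\<in>V. \<Sum>w\<in>E``{v}. g v * g w)"
        proof (intro sum_mono)
          fix v w assume "v \<in> V" "w \<in> E `` {v}"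
          then have "v \<in> V" "w \<in> V" using sub by auto
          moreover have "f v * f w \<le> \<bar>f v\<bar> * \<bar>f w\<bar>" by (metis abs_ge_self abs_mult)
          then have "c * c * (f v * f w) \<le> c * c * (\<bar>f v\<bar> * \<bar>f w\<bar>)"
            using c by (intro mult_left_mono) auto
          ultimately show "(c * f v) * (c * f w) \<le> g v * g w"
            by (simp add: g_def mult_ac)
        qed
        also have "\<dots> = q g" by (simp add: q_def nsum_def sum_distrib_left)
        finally show ?thesis .
      qed
      also have "\<dots> \<le> q x" using xm gK by simp
      also have "\<dots> = q x * (c\<^sup>2 * s)" using c by simp
      finally have "c\<^sup>2 * q f \<le> c\<^sup>2 * (q x * s)" by (simp add: mult_ac)
      then show ?thesis using c by (simp add: s_def)
    qed
  qed
  then show thesis using that[of x "q x"] x by (simp add: q_def)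
qed

end

text \<open>Connectedness in terms of cuts, which avoids manipulating walks.\<close>

definition cut_connected :: "'a set \<Rightarrow> 'a rel \<Rightarrow> bool" where
  "cut_connected V E \<longleftrightarrow> V \<noteq> {} \<and> (\<forall>U\<subseteq>V. U \<noteq> {} \<and> E `` U \<subseteq> U \<longrightarrow> U = V)"

locale cgraph = sgraph +
  assumes conn: "cut_connected V E"
begin

lemma V_ne: "V \<noteq> {}" using conn by (simp add: cut_connected_def)


lemma closed_eq: "U \<subseteq> V \<Longrightarrow> U \<noteq> {} \<Longrightarrow> (\<And>v w. v \<in> U \<Longrightarrow> (v, w) \<in> E \<Longrightarrow> w \<in> U) \<Longrightarrow> U = V"
  using conn unfolding cut_connected_def by blast

text \<open>The support of the nonnegative maximiser is closed under adjacency: a vertex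
  \<open>w\<close> next to the support has neighbour sum \<open>\<mu> * x w > 0\<close>.
  Connectedness then makes every entry positive.\<close>

lemma perron:
  obtains y \<mu> where "\<And>v. v \<in> V \<Longrightarrow> 0 < y v" "\<And>v. v \<in> V \<Longrightarrow> nsum E y v = \<mu> * y v"
proof (rule maximum_attained[OF V_ne])
  fix x :: "'a \<Rightarrow> real" and \<mu>
  assume x: "\<And>v. v \<in> V \<Longrightarrow> 0 \<le> x v" "(\<Sum>v\<in>V. x v * nsum E x v) = \<mu>" "(\<Sum>v\<in>V. (x v)\<^sup>2) = 1"
    "\<And>f. (\<Sum>v\<in>V. f v * nsum E f v) \<le> \<mu> * (\<Sum>v\<in>V. (f v)\<^sup>2)"
  have ev: "nsum E x z = \<mu> * x z" if "z \<in> V" for z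
    using eigenvector_of_maximum[OF x(4) x(2) x(3) that] .
  have "{v \<in> V. 0 < x v} = V"
  proof (rule closed_eq)
    show "{v \<in> V. 0 < x v} \<noteq> {}"
    proof
      assume "{v \<in> V. 0 < x v} = {}"
      then have "\<And>v. v \<in> V \<Longrightarrow> x v = 0" using x(1) by (simp add: less_le)
      then show False using x(3) by simp
    qed
    fix v w assume v: "v \<in> {v \<in> V. 0 < x v}" and vw: "(v, w) \<in> E"
    have w: "w \<in> V" using vw sub by auto
    have "x v \<le> nsum E x w" unfolding nsum_def
      by (rule member_le_sum) (use vw symE x(1) sub in auto)
    then have "0 < \<mu> * x w" using v ev[OF w] by auto
    then have "x w \<noteq> 0" by auto
    then show "w \<in> {v \<in> V. 0 < x v}" using x(1)[OF w] w by auto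
  qed auto
  then show thesis using that[of x \<mu>] ev by blast
qed

end


section \<open>Graphs, spectral radius and dissociation number\<close>

lemma pair_graph_iff_sgraph: "pair_graph G \<longleftrightarrow> sgraph (pverts G) (parcs G)"
proof
  assume "pair_graph G"
  then interpret pair_graph G .
  show "sgraph (pverts G) (parcs G)"
    by unfold_locales (auto intro: in_arcsD1 in_arcsD2 arcs_symmetric dest: no_loops')
next
  assume "sgraph (pverts G) (parcs G)"
  then interpret sgraph "pverts G" "parcs G" .
  have "finite (parcs G)" using fin sub by (meson finite_SigmaI finite_subset)
  then show "pair_graph G"
    using fin sub symE irr
    by unfold_locales (auto simp: symmetric_def sym_def)
qed

lemma (in sgraph) cut_connected_iff:
  "cut_connected V E \<longleftrightarrow> V \<noteq> {} \<and> (\<forall>u\<in>V. \<forall>v\<in>V. (u, v) \<in> E\<^sup>*)"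
proof (intro iffI conjI ballI)
  fix u v assume c: "cut_connected V E" and uv: "u \<in> V" "v \<in> V"
  have "E\<^sup>* `` {u} \<subseteq> V"
  proof -
    have "(u, w) \<in> E\<^sup>* \<Longrightarrow> w \<in> V" for w by (induction rule: rtrancl_induct) (use uv sub in auto)
    then show ?thesis by auto
  qed
  moreover have "E `` (E\<^sup>* `` {u}) \<subseteq> E\<^sup>* `` {u}" by auto
  ultimately have "E\<^sup>* `` {u} = V" using c unfolding cut_connected_def by blast
  then show "(u, v) \<in> E\<^sup>*" using uv by auto
next
  assume r: "V \<noteq> {} \<and> (\<forall>u\<in>V. \<forall>v\<in>V. (u, v) \<in> E\<^sup>*)"
  show "cut_connected V E" unfolding cut_connected_def
  proof (intro conjI allI impI; (elim conjE)?)
    fix U assume U: "U \<subseteq> V" "U \<noteq> {}" "E `` U \<subseteq> U"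
    then obtain u where u: "u \<in> U" by auto
    have "(u, v) \<in> E\<^sup>* \<Longrightarrow> v \<in> U" for v by (induction rule: rtrancl_induct) (use u U in auto)
    then show "U = V" using r U u by blast
  qed (use r in simp)
qed (auto simp: cut_connected_def)

text \<open>The criterion for the explicit graphs: \<open>d\<close> acts as a height, and descending
  edges lead every vertex to \<open>r\<close>.\<close>

lemma (in sgraph) cut_connectedI:
  fixes d :: "'a \<Rightarrow> nat"
  assumes r: "r \<in> V" and d: "\<And>v. v \<in> V \<Longrightarrow> v \<noteq> r \<Longrightarrow> \<exists>w. (v, w) \<in> E \<and> d w < d v"
  shows "cut_connected V E"
proof -
  have *: "(v, r) \<in> E\<^sup>*" if "v \<in> V" for v
    using that
  proof (induction "d v" arbitrary: v rule: less_induct)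
    case less
    show ?case
    proof (cases "v = r")
      case False
      then obtain w where w: "(v, w) \<in> E" "d w < d v" using d less.prems by blast
      then have "w \<in> V" using sub by auto
      then show ?thesis using less.hyps w by (meson converse_rtrancl_into_rtrancl)
    qed simp
  qed
  have "sym E" using symE by (auto simp: sym_def)
  then have "sym (E\<^sup>*)" by (rule sym_rtrancl)
  then have "(u, v) \<in> E\<^sup>*" if "u \<in> V" "v \<in> V" for u v
    using * that by (meson rtrancl_trans symD)
  then show ?thesis using r by (auto simp: cut_connected_iff)
qed

lemma connected_iff_cut_connected:
  assumes "pair_graph G"
  shows "Digraph_Component.connected (with_proj G) \<longleftrightarrow> cut_connected (pverts G) (parcs G)"
proof -
  interpret sgraph "pverts G" "parcs G" using assms by (simp add: pair_graph_iff_sgraph)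
  interpret G: pair_graph G by fact
  \<comment> \<open>Connectedness of digraphs is strong connectedness of the symmetric closure,
    which changes nothing here.\<close>
  have m: "mk_symmetric (with_proj G) = G"
    by (rule pair_pre_digraph.equality) (use symE in \<open>auto simp: mk_symmetric_def\<close>)
  have "u \<rightarrow>\<^sup>*\<^bsub>with_proj G\<^esub> v \<longleftrightarrow> (u, v) \<in> (parcs G)\<^sup>*" if "u \<in> pverts G" for u v
  proof -
    have 1: "u \<rightarrow>\<^sup>*\<^bsub>with_proj G\<^esub> v \<Longrightarrow> (u, v) \<in> (parcs G)\<^sup>*"
      unfolding reachable_def by (simp add: rtrancl_on_rtranclI)
    have 2: "(u, v) \<in> (parcs G)\<^sup>* \<Longrightarrow> u \<rightarrow>\<^sup>*\<^bsub>with_proj G\<^esub> v"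
      by (induction rule: rtrancl_induct) (use that in \<open>auto intro: G.reachable_adj_trans\<close>)
    show ?thesis using 1 2 by blast
  qed
  then show ?thesis
    by (auto simp: connected_def strongly_connected_def m cut_connected_iff)
qed

lemma graph_isoI:
  assumes G: "pair_graph G" and f: "bij_betw f (pverts G) (pverts H)"
    and a: "map_prod f f ` parcs G = parcs H"
  shows "graph_iso G H"
proof -
  interpret pair_graph G by fact
  have i: "inj_on f (pverts G)" using f by (rule bij_betw_imp_inj_on)
  define h where "h = \<lparr> iso_verts = f, iso_arcs = map_prod f f, iso_head = (snd :: 'b \<times> 'b \<Rightarrow> 'b), iso_tail = fst \<rparr>"
  have "inj_on (map_prod f f) (parcs G)"
  proof -
    have "parcs G \<subseteq> pverts G \<times> pverts G" by (auto dest: in_arcsD1 in_arcsD2)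
    then show ?thesis using map_prod_inj_on[OF i i] inj_on_subset by blast
  qed
  then have "pre_digraph.digraph_isomorphism (with_proj G) h"
    using i wf_digraph_axioms by (auto simp: pre_digraph.digraph_isomorphism_def h_def)
  moreover have "with_proj H = app_iso h (with_proj G)"
    using f a by (simp add: with_proj_def app_iso_def h_def bij_betw_def)
  ultimately show ?thesis by (auto simp: graph_iso_def digraph_iso_def)
qed

lemma graph_isoI_inv:
  assumes G: "pair_graph G" and H: "pair_graph H" and f: "bij_betw f (pverts H) (pverts G)"
    and a: "\<And>i j. i \<in> pverts H \<Longrightarrow> j \<in> pverts H \<Longrightarrow> (i, j) \<in> parcs H \<longleftrightarrow> (f i, f j) \<in> parcs G"
  shows "graph_iso G H"
proof -
  interpret G: sgraph "pverts G" "parcs G" using G by (simp add: pair_graph_iff_sgraph)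
  interpret H: sgraph "pverts H" "parcs H" using H by (simp add: pair_graph_iff_sgraph)
  define g where "g = the_inv_into (pverts H) f"
  have inj: "inj_on f (pverts H)" using f by (rule bij_betw_imp_inj_on)
  have gf: "g (f i) = i" if "i \<in> pverts H" for i using inj that by (simp add: g_def the_inv_into_f_f)
  have g: "bij_betw g (pverts G) (pverts H)" unfolding g_def by (rule bij_betw_the_inv_into[OF f])
  have gV: "g v \<in> pverts H" if "v \<in> pverts G" for v using g that by (auto simp: bij_betw_def)
  have fg: "f (g v) = v" if "v \<in> pverts G" for v
    using f that unfolding g_def by (metis bij_betw_def f_the_inv_into_f)
  show ?thesis
  proof (rule graph_isoI[OF G g])
    show "map_prod g g ` parcs G = parcs H"
    proof (intro equalityI subsetI)
      fix e assume "e \<in> map_prod g g ` parcs G"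
      then obtain u v where uv: "(u, v) \<in> parcs G" "e = (g u, g v)" by auto
      then have "u \<in> pverts G" "v \<in> pverts G" using G.sub by auto
      then show "e \<in> parcs H" using uv a[of "g u" "g v"] fg gV by simp
    next
      fix e assume e: "e \<in> parcs H"
      obtain i j where ij: "e = (i, j)" by (cases e)
      then have V: "i \<in> pverts H" "j \<in> pverts H" using e H.sub by auto
      then have "e = map_prod g g (f i, f j)" by (simp add: ij gf)
      moreover have "(f i, f j) \<in> parcs G" using a V e ij by simp
      ultimately show "e \<in> map_prod g g ` parcs G" by (rule image_eqI)
    qed
  qed
qed

lemma dissociation_set_iff:
  assumes "pair_graph G"
  shows "dissociation_set G S \<longleftrightarrow> S \<subseteq> pverts G \<and> (\<forall>v\<in>S. card (parcs G `` {v} \<inter> S) \<le> 1)"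
proof -
  interpret pair_graph G by fact
  have "out_degree (with_proj G \<restriction> S) v = card (parcs G `` {v} \<inter> S)" if "v \<in> S" for v
  proof -
    have "out_arcs (with_proj G \<restriction> S) v = Pair v ` (parcs G `` {v} \<inter> S)"
      using that by (auto simp: out_arcs_def)
    then show ?thesis by (simp add: out_degree_def card_image inj_on_def)
  qed
  then show ?thesis by (simp add: dissociation_set_def cong: conj_cong)
qed

text \<open>Turns vectors indexed by the enumeration of the vertices into functions on the vertices,
  so that the enumeration need not be mentioned again.\<close>

lemma eigenvalue_adjacency_iff:
  assumes G: "pair_graph G"
  shows "eigenvalue (adjacency_matrix G) l \<longleftrightarrow>
    (\<exists>z. (\<exists>v\<in>pverts G. z v \<noteq> 0) \<and> (\<forall>v\<in>pverts G. nsum (parcs G) z v = l * z v))"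
proof -
  interpret sgraph "pverts G" "parcs G" using G by (simp add: pair_graph_iff_sgraph)
  define V n \<phi> where "V = pverts G" and "n = card V" and "\<phi> = from_nat_into V"
  have bij: "bij_betw \<phi> {..<n} V"
    using bij_betw_from_nat_into_finite[of V] fin by (simp add: V_def n_def \<phi>_def)
  then have bij0: "bij_betw \<phi> {0..<n} V" by (simp add: atLeast0LessThan)
  have in_V: "\<phi> i \<in> V" if "i < n" for i using bij that by (auto simp: bij_betw_def)
  have surj: "\<exists>i<n. v = \<phi> i" if "v \<in> V" for v
  proof -
    have "v \<in> \<phi> ` {..<n}" using that bij by (simp add: bij_betw_def)
    then show ?thesis by auto
  qed
  have A: "adjacency_matrix G \<in> carrier_mat n n"
    by (simp add: adjacency_matrix_def V_def n_def)
  have prod: "(adjacency_matrix G *\<^sub>v x) $ i = nsum (parcs G) z (\<phi> i)"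
    if "i < n" and x: "x \<in> carrier_vec n" "\<And>j. j < n \<Longrightarrow> x $ j = z (\<phi> j)" for i x z
  proof -
    have "(adjacency_matrix G *\<^sub>v x) $ i = (\<Sum>j\<in>{0..<n}. if (\<phi> i, \<phi> j) \<in> parcs G then z (\<phi> j) else 0)"
    proof -
      have "(adjacency_matrix G *\<^sub>v x) $ i = (\<Sum>j\<in>{0..<n}. adjacency_matrix G $$ (i, j) * x $ j)"
        using that A by (simp add: scalar_prod_def row_def)
      also have "\<dots> = (\<Sum>j\<in>{0..<n}. if (\<phi> i, \<phi> j) \<in> parcs G then z (\<phi> j) else 0)"
        using that by (intro sum.cong) (auto simp: adjacency_matrix_def V_def n_def \<phi>_def)
      finally show ?thesis .
    qed
    also have "\<dots> = (\<Sum>w\<in>V. if (\<phi> i, w) \<in> parcs G then z w else 0)"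
      by (rule sum.reindex_bij_betw[OF bij0])
    finally show ?thesis by (simp add: nsum_V V_def)
  qed
  show ?thesis
  proof
    assume "eigenvalue (adjacency_matrix G) l"
    then obtain x where x: "x \<in> carrier_vec n" "x \<noteq> 0\<^sub>v n" "adjacency_matrix G *\<^sub>v x = l \<cdot>\<^sub>v x"
      using A unfolding eigenvalue_def eigenvector_def by (metis carrier_matD(1))
    define z where "z = (\<lambda>v. x $ (the_inv_into {..<n} \<phi> v))"
    have z: "z (\<phi> i) = x $ i" if "i < n" for i
      using that bij by (simp add: z_def the_inv_into_f_f bij_betw_def)
    have "nsum (parcs G) z v = l * z v" if v: "v \<in> V" for v
    proof -
      obtain i where i: "i < n" "v = \<phi> i" using surj[OF v] by blast
      have "nsum (parcs G) z v = (adjacency_matrix G *\<^sub>v x) $ i"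
        using prod[of i x z] i x(1) z by simp
      then show ?thesis using x i z by simp
    qed
    moreover have "\<exists>v\<in>V. z v \<noteq> 0"
    proof -
      have "\<not> (\<forall>i<n. x $ i = 0)"
      proof
        assume "\<forall>i<n. x $ i = 0"
        then have "x = 0\<^sub>v n" using x(1) by (intro eq_vecI) auto
        then show False using x(2) by simp
      qed
      then obtain i where "i < n" "x $ i \<noteq> 0" by blast
      then have "\<phi> i \<in> V" "z (\<phi> i) \<noteq> 0" using z in_V by auto
      then show ?thesis by blast
    qed
    ultimately show "\<exists>z. (\<exists>v\<in>pverts G. z v \<noteq> 0) \<and> (\<forall>v\<in>pverts G. nsum (parcs G) z v = l * z v)"
      unfolding V_def by blast
  next
    assume "\<exists>z. (\<exists>v\<in>pverts G. z v \<noteq> 0) \<and> (\<forall>v\<in>pverts G. nsum (parcs G) z v = l * z v)"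
    then obtain z v where z: "v \<in> V" "z v \<noteq> 0" "\<And>v. v \<in> V \<Longrightarrow> nsum (parcs G) z v = l * z v"
      unfolding V_def by blast
    define x where "x = vec n (\<lambda>i. z (\<phi> i))"
    have x: "x \<in> carrier_vec n" by (simp add: x_def)
    obtain i where "i < n" "v = \<phi> i" using surj[OF z(1)] by blast
    then have "x $ i \<noteq> 0" "i < n" using z(2) by (auto simp: x_def)
    then have "x \<noteq> 0\<^sub>v n" by auto
    moreover have "adjacency_matrix G *\<^sub>v x = l \<cdot>\<^sub>v x"
    proof (rule eq_vecI)
      fix j assume "j < dim_vec (l \<cdot>\<^sub>v x)"
      then have "j < n" by (simp add: x_def)
      then show "(adjacency_matrix G *\<^sub>v x) $ j = (l \<cdot>\<^sub>v x) $ j"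
        using prod[of j x z] in_V z(3) by (simp add: x_def)
    qed (use A in \<open>simp add: x_def\<close>)
    ultimately have "eigenvector (adjacency_matrix G) x l"
      using x A by (simp add: eigenvector_def)
    then show "eigenvalue (adjacency_matrix G) l" unfolding eigenvalue_def by blast
  qed
qed

text \<open>For an eigenvector \<open>z\<close> of another eigenvalue \<open>e\<close>, look at a
  vertex \<open>v\<close> that maximises \<open>\<bar>z v\<bar> / y v\<close>. There the neighbour
  sum of \<open>\<bar>z\<bar>\<close> is at most that of \<open>M * y\<close>, hence
  \<open>e \<le> l\<close>.\<close>

lemma rho_eq:
  assumes G: "pair_graph G" and ne: "pverts G \<noteq> {}"
    and y: "\<And>v. v \<in> pverts G \<Longrightarrow> 0 < y v" "\<And>v. v \<in> pverts G \<Longrightarrow> nsum (parcs G) y v = l * y v"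
  shows "rho G = l"
proof -
  interpret sgraph "pverts G" "parcs G" using G by (simp add: pair_graph_iff_sgraph)
  have fs: "finite (spectrum (adjacency_matrix G))"
    by (rule card_finite_spectrum(1)) (auto simp: adjacency_matrix_def)
  have "l \<in> spectrum (adjacency_matrix G)"
    unfolding spectrum_def mem_Collect_eq eigenvalue_adjacency_iff[OF G]
    using y ne by (metis all_not_in_conv less_irrefl)
  moreover have "e \<le> l" if e: "e \<in> spectrum (adjacency_matrix G)" for e
  proof -
    obtain z v0 where z: "v0 \<in> pverts G" "z v0 \<noteq> 0" "\<And>v. v \<in> pverts G \<Longrightarrow> nsum (parcs G) z v = e * z v"
      using e unfolding spectrum_def mem_Collect_eq eigenvalue_adjacency_iff[OF G] by blast
    define M where "M = Max ((\<lambda>v. \<bar>z v\<bar> / y v) ` pverts G)"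
    have "M \<in> (\<lambda>v. \<bar>z v\<bar> / y v) ` pverts G" unfolding M_def using fin ne by (intro Max_in) auto
    then obtain v where v: "v \<in> pverts G" "M = \<bar>z v\<bar> / y v" by auto
    have M: "\<bar>z w\<bar> \<le> M * y w" if "w \<in> pverts G" for w
    proof -
      have "\<bar>z w\<bar> / y w \<le> M" unfolding M_def using fin that by (intro Max_ge) auto
      then show ?thesis using y(1)[OF that] by (simp add: divide_le_eq)
    qed
    have "0 < \<bar>z v0\<bar>" using z by simp
    also have "\<dots> \<le> M * y v0" using M z by simp
    finally have "M > 0" using y(1)[OF z(1)] by (simp add: zero_less_mult_iff)
    have vM: "\<bar>z v\<bar> = M * y v" using v y(1)[OF v(1)] by simp
    have "e * \<bar>z v\<bar> \<le> \<bar>e * z v\<bar>" by (simp add: abs_mult mult_right_mono)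
    also have "\<dots> = \<bar>nsum (parcs G) z v\<bar>" using z v by simp
    also have "\<dots> \<le> nsum (parcs G) (\<lambda>w. \<bar>z w\<bar>) v" by (simp add: nsum_def sum_abs)
    also have "\<dots> \<le> nsum (parcs G) (\<lambda>w. M * y w) v" using M by (rule nsum_mono)
    also have "\<dots> = l * \<bar>z v\<bar>" using y(2)[OF v(1)] vM by (simp add: nsum_def flip: sum_distrib_left)
    finally show "e \<le> l" using vM \<open>M > 0\<close> y(1)[OF v(1)] by simp
  qed
  ultimately show ?thesis unfolding rho_def using fs by (intro Max_eqI) auto
qed

section \<open>Comparing spectral radii of connected graphs\<close>

locale conn_graph =
  fixes G :: "'a pair_pre_digraph"
  assumes pg: "pair_graph G" and cc: "cut_connected (pverts G) (parcs G)"

sublocale conn_graph \<subseteq> cgraph "pverts G" "parcs G"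
  using pg cc by (simp add: pair_graph_iff_sgraph cgraph_def cgraph_axioms_def)

context conn_graph
begin

lemma perron_rho:
  obtains y where "\<And>v. v \<in> pverts G \<Longrightarrow> 0 < y v" "\<And>v. v \<in> pverts G \<Longrightarrow> nsum (parcs G) y v = rho G * y v"
proof (rule perron)
  fix y \<mu> assume y: "\<And>v. v \<in> pverts G \<Longrightarrow> 0 < y v" "\<And>v. v \<in> pverts G \<Longrightarrow> nsum (parcs G) y v = \<mu> * y v"
  then have "rho G = \<mu>" using rho_eq[OF pg V_ne] by blast
  then show thesis using that y by blast
qed

lemma rho_lower_test:
  assumes h: "\<And>v. v \<in> pverts G \<Longrightarrow> 0 \<le> h v" "\<And>v. v \<in> pverts G \<Longrightarrow> l * h v \<le> nsum (parcs G) h v"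
    and u: "u \<in> pverts G" "0 < h u"
  shows "l \<le> rho G" and "v \<in> pverts G \<Longrightarrow> l * h v < nsum (parcs G) h v \<Longrightarrow> l < rho G"
proof -
  obtain y where y: "\<And>v. v \<in> pverts G \<Longrightarrow> 0 < y v" "\<And>v. v \<in> pverts G \<Longrightarrow> nsum (parcs G) y v = rho G * y v"
    by (rule perron_rho) blast
  define S where "S = (\<Sum>v\<in>pverts G. h v * y v)"
  have "0 < h u * y u" using u y by simp
  also have "\<dots> \<le> S" unfolding S_def using u h y fin by (intro member_le_sum) (auto simp: less_imp_le)
  finally have S: "S > 0" .
  have eq: "rho G * S = (\<Sum>v\<in>pverts G. nsum (parcs G) h v * y v)"
  proof -
    have "rho G * S = (\<Sum>v\<in>pverts G. h v * nsum (parcs G) y v)"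
      unfolding S_def sum_distrib_left by (intro sum.cong refl) (simp add: y)
    then show ?thesis by (simp add: nsum_swap)
  qed
  have le: "l * h v * y v \<le> nsum (parcs G) h v * y v" if "v \<in> pverts G" for v
    using h y that by (intro mult_right_mono) (auto simp: less_imp_le)
  have lS: "l * S = (\<Sum>v\<in>pverts G. l * h v * y v)" by (simp add: S_def sum_distrib_left mult.assoc)
  have "l * S \<le> rho G * S" unfolding eq lS using le by (rule sum_mono)
  then show "l \<le> rho G" using S by simp
  assume "v \<in> pverts G" "l * h v < nsum (parcs G) h v"
  then have "l * S < rho G * S" unfolding eq lS using le fin y by (intro sum_strict_mono_ex1) auto
  then show "l < rho G" using S by simp
qed

end

lemma spanning_copy_iso:
  assumes G: "conn_graph G" and H: "conn_graph H"
    and f: "bij_betw f (pverts H) (pverts G)"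
    and a: "\<And>i j. (i, j) \<in> parcs H \<Longrightarrow> (f i, f j) \<in> parcs G"
    and le: "rho G \<le> rho H"
  shows "graph_iso G H"
proof -
  interpret G: conn_graph G by fact
  interpret H: conn_graph H by fact
  obtain y where y: "\<And>v. v \<in> pverts H \<Longrightarrow> 0 < y v" "\<And>v. v \<in> pverts H \<Longrightarrow> nsum (parcs H) y v = rho H * y v"
    by (rule H.perron_rho) blast
  define g where "g = the_inv_into (pverts H) f"
  have inj: "inj_on f (pverts H)" using f by (rule bij_betw_imp_inj_on)
  have gf: "g (f i) = i" if "i \<in> pverts H" for i using inj that by (simp add: g_def the_inv_into_f_f)
  have g: "bij_betw g (pverts G) (pverts H)" unfolding g_def by (rule bij_betw_the_inv_into[OF f])
  have fg: "f (g v) = v" if "v \<in> pverts G" for v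
    using f that unfolding g_def by (metis bij_betw_def f_the_inv_into_f)
  \<comment> \<open>The Perron vector of \<open>H\<close>, transported to \<open>G\<close> as a test
    vector: an arc of \<open>G\<close> outside the copy adds a positive term to a neighbour
    sum.\<close>
  define h where "h = y \<circ> g"
  have hpos: "0 < h v" if "v \<in> pverts G" for v
    using y(1) g that by (auto simp: h_def bij_betw_def)
  have img: "nsum (parcs H) y i = (\<Sum>w\<in>f ` (parcs H `` {i}). h w)" for i
  proof -
    have "inj_on f (parcs H `` {i})" using inj H.nb_sub by (rule inj_on_subset)
    then show ?thesis unfolding nsum_def h_def using H.nb_sub
      by (subst sum.reindex) (auto simp: gf subset_iff intro!: sum.cong)
  qed
  have sub: "f ` (parcs H `` {i}) \<subseteq> parcs G `` {f i}" for i using a by auto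
  have ge: "rho H * h v \<le> nsum (parcs G) h v" if "v \<in> pverts G" for v
  proof -
    have gv: "g v \<in> pverts H" using g that by (auto simp: bij_betw_def)
    have "rho H * h v = nsum (parcs H) y (g v)" using y(2)[OF gv] by (simp add: h_def)
    also have "\<dots> \<le> (\<Sum>w\<in>parcs G `` {v}. h w)"
      unfolding img using sub[of "g v"] hpos G.nb_sub fg[OF that]
      by (intro sum_mono2) (use G.sub in \<open>auto intro!: less_imp_le[OF hpos]\<close>)
    finally show ?thesis by (simp add: nsum_def)
  qed
  have all: "(i, j) \<in> parcs H" if ij: "i \<in> pverts H" "j \<in> pverts H" "(f i, f j) \<in> parcs G" for i j
  proof (rule ccontr)
    assume n: "(i, j) \<notin> parcs H"
    have fi: "f i \<in> pverts G" using f ij by (auto simp: bij_betw_def)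
    have "f j \<notin> f ` (parcs H `` {i})" using n inj ij H.nb_sub by (auto dest!: inj_onD)
    then have "(\<Sum>w\<in>f ` (parcs H `` {i}). h w) < (\<Sum>w\<in>parcs G `` {f i}. h w)"
      using sub[of i] hpos ij G.nb_sub[of "f i"] by (intro sum_strict_mono2[where b="f j"]) (auto simp: less_imp_le)
    then have "rho H * h (f i) < nsum (parcs G) h (f i)"
      using y(2)[OF ij(1)] by (simp add: nsum_def[of "parcs G"] img h_def gf ij)
    then have "rho H < rho G" using G.rho_lower_test(2)[of h "rho H" "f i" "f i"] ge hpos fi by (auto simp: less_imp_le)
    then show False using le by simp
  qed
  show ?thesis
    using all a by (intro graph_isoI_inv[OF G.pg H.pg f]) blast
qed

lemma mem_class_iff:
  "G \<in> connected_graphs_with_dissociation_number n k \<longleftrightarrow>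
     conn_graph G \<and> card (pverts G) = n \<and> dissociation_number G = k"
  unfolding connected_graphs_with_dissociation_number_def conn_graph_def
  using connected_iff_cut_connected[of G] by blast

section \<open>The dissociation number as an attained maximum\<close>

lemma (in conn_graph) finite_dissociation_sets: "finite {S. dissociation_set G S}"
proof -
  have "{S. dissociation_set G S} \<subseteq> Pow (pverts G)" by (auto simp: dissociation_set_def)
  then show ?thesis using fin by (meson finite_Pow_iff finite_subset)
qed

lemma (in conn_graph) dissociation_number_attained:
  obtains S where "S \<subseteq> pverts G" "\<And>v. v \<in> S \<Longrightarrow> card (parcs G `` {v} \<inter> S) \<le> 1"
    "card S = dissociation_number G"
proof -
  have "{} \<in> {S. dissociation_set G S}" by (simp add: dissociation_set_def)
  then have "dissociation_number G \<in> card ` {S. dissociation_set G S}"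
    unfolding dissociation_number_def using finite_dissociation_sets by (intro Max_in) auto
  then obtain T where T: "dissociation_set G T" "card T = dissociation_number G" by force
  then show thesis using that[of T] unfolding dissociation_set_iff[OF pg] by blast
qed

lemma (in conn_graph) dissociation_number_ge:
  assumes "S \<subseteq> pverts G" "\<And>v. v \<in> S \<Longrightarrow> card (parcs G `` {v} \<inter> S) \<le> 1"
  shows "card S \<le> dissociation_number G"
proof -
  have "dissociation_set G S" using assms by (simp add: dissociation_set_iff[OF pg])
  then show ?thesis
    unfolding dissociation_number_def using finite_dissociation_sets by (intro Max_ge) auto
qed

lemma (in conn_graph) dissociation_numberI:
  assumes "S \<subseteq> pverts G" "\<And>v. v \<in> S \<Longrightarrow> card (parcs G `` {v} \<inter> S) \<le> 1" "k \<le> card S"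
    and "\<And>S. S \<subseteq> pverts G \<Longrightarrow> (\<And>v. v \<in> S \<Longrightarrow> card (parcs G `` {v} \<inter> S) \<le> 1) \<Longrightarrow> card S \<le> k"
  shows "dissociation_number G = k"
proof (rule antisym)
  show "dissociation_number G \<le> k"
    by (rule dissociation_number_attained) (use assms(4) in metis)
  show "k \<le> dissociation_number G" using dissociation_number_ge[OF assms(1,2)] assms(3) by simp
qed


section \<open>Dissociation number two\<close>

lemma (in sgraph) nsum_co_matching:
  assumes "v \<in> V" "q v \<in> V" "E `` {v} = V - {v, q v}"
  shows "nsum E y v = sum y V - y v - (if q v = v then 0 else y (q v))"
proof -
  have "sum y (V - {v, q v}) = sum y V - sum y {v, q v}"
    by (rule sum_diff) (use fin assms in auto)
  then show ?thesis using assms(3) by (simp add: nsum_def)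
qed

text \<open>A complete graph minus a maximum matching: the parts are the pairs \<open>2 * i\<close>,
  \<open>2 * i + 1\<close>, and for odd \<open>n\<close> the vertex \<open>n - 1\<close> is a part
  of its own.\<close>

definition co_matching_graph :: "nat \<Rightarrow> nat pair_pre_digraph" where
  "co_matching_graph n = \<lparr> pverts = {0..<n}, parcs = {(i, j). i < n \<and> j < n \<and> i div 2 \<noteq> j div 2} \<rparr>"

text \<open>
  For odd \<open>n\<close> the Perron vector is \<open>1\<close> at the matched vertices and \<open>(n - 1)/\<lambda>\<close> at the unmatched one, where
  \<open>\<lambda>\<close> is the positive root of \<open>\<lambda>\<^sup>2 = (n - 3) \<lambda> + (n - 1)\<close>.
\<close>

definition co_matching_rho :: "nat \<Rightarrow> real" where
  "co_matching_rho n = (if even n then real n - 2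
     else ((real n - 3) + sqrt ((real n - 3)\<^sup>2 + 4 * (real n - 1))) / 2)"

lemma co_matching_rho_odd:
  assumes "odd n" "n \<ge> 3"
  shows "0 < co_matching_rho n"
    and "real n - 3 + (real n - 1) / co_matching_rho n = co_matching_rho n"
proof -
  define s where "s = sqrt ((real n - 3)\<^sup>2 + 4 * (real n - 1))"
  have s: "s\<^sup>2 = (real n - 3)\<^sup>2 + 4 * (real n - 1)" "0 < s" using assms by (auto simp: s_def intro!: add_nonneg_pos)
  have l: "co_matching_rho n = ((real n - 3) + s) / 2" using assms by (simp add: co_matching_rho_def s_def)
  then show p: "0 < co_matching_rho n" using s assms by simp
  have "co_matching_rho n * co_matching_rho n = (real n - 3) * co_matching_rho n + (real n - 1)"
    using s(1) unfolding l by (simp add: field_simps power2_eq_square)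
  then show "real n - 3 + (real n - 1) / co_matching_rho n = co_matching_rho n"
    using p by (simp add: field_simps)
qed

lemma co_matching_graph_nb:
  assumes "v < n"
  defines "q \<equiv> (\<lambda>v. if even v then (if Suc v < n then Suc v else v) else v - 1)"
  shows "parcs (co_matching_graph n) `` {v} = {0..<n} - {v, q v}" "q v < n" "q v = v \<longleftrightarrow> odd n \<and> v = n - 1"
proof -
  have "j div 2 = v div 2 \<longleftrightarrow> j = v \<or> j = q v" if "j < n" for j
    using that assms(1) unfolding q_def by (auto elim!: evenE oddE)
  then have "{j. j < n \<and> j div 2 \<noteq> v div 2} = {0..<n} - {v, q v}" by auto
  moreover have "parcs (co_matching_graph n) `` {v} = {j. j < n \<and> j div 2 \<noteq> v div 2}"
    using assms(1) by (auto simp: co_matching_graph_def)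
  ultimately show "parcs (co_matching_graph n) `` {v} = {0..<n} - {v, q v}" by simp
  show "q v < n" using assms(1) by (auto simp: q_def)
  show "q v = v \<longleftrightarrow> odd n \<and> v = n - 1" using assms(1) by (auto simp: q_def elim!: evenE oddE)
qed

lemma conn_co_matching_graph:
  assumes "n \<ge> 3"
  shows "conn_graph (co_matching_graph n)"
proof -
  let ?G = "co_matching_graph n"
  have sg: "sgraph (pverts ?G) (parcs ?G)"
    by unfold_locales (auto simp: co_matching_graph_def)
  have "cut_connected (pverts ?G) (parcs ?G)"
  \<comment> \<open>The height is the distance from 0: only vertex 1 is not adjacent to 0, and it
    gets there through vertex 2, present since \<open>n \<ge> 3\<close>.\<close>
  proof (rule sgraph.cut_connectedI[OF sg, of 0 "\<lambda>v. if v = 0 then 0 else if v = 1 then 2 else 1"])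
    show "0 \<in> pverts ?G" using assms by (simp add: co_matching_graph_def)
    fix v assume "v \<in> pverts ?G" "v \<noteq> 0"
    then show "\<exists>w. (v, w) \<in> parcs ?G \<and> (if w = 0 then 0 else if w = 1 then 2 else 1) < (if v = 0 then 0 else if v = 1 then 2 else (1::nat))"
      using assms by (intro exI[of _ "if v = 1 then 2 else 0"]) (auto simp: co_matching_graph_def)
  qed
  then show ?thesis using sg by (simp add: conn_graph_def pair_graph_iff_sgraph)
qed

lemma half_parity_eqD: "x div 2 = y div 2 \<Longrightarrow> even x = even y \<Longrightarrow> x = y" for x y :: nat
  by (auto elim!: evenE oddE)

lemma dissociation_number_co_matching_graph:
  assumes "n \<ge> 3"
  shows "dissociation_number (co_matching_graph n) = 2"
proof -
  let ?G = "co_matching_graph n"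
  interpret conn_graph ?G using conn_co_matching_graph[OF assms] .
  show ?thesis
  proof (rule dissociation_numberI[of "{0, 1}"])
    show "{0, 1} \<subseteq> pverts ?G" using assms by (simp add: co_matching_graph_def)
    fix v :: nat assume "v \<in> {0, 1}"
    then have "parcs ?G `` {v} \<inter> {0, 1} = {}" by (auto simp: co_matching_graph_def)
    then show "card (parcs ?G `` {v} \<inter> {0, 1}) \<le> 1" by simp
  next
    fix S assume S: "S \<subseteq> pverts ?G" "\<And>v. v \<in> S \<Longrightarrow> card (parcs ?G `` {v} \<inter> S) \<le> 1"
    show "card S \<le> 2"
    proof (rule ccontr)
      assume "\<not> card S \<le> 2"
      then have "3 \<le> card S" by simp
      then obtain T where "T \<subseteq> S" "card T = 3" by (meson obtain_subset_with_card_n)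
      then obtain a b c where abc: "a \<in> S" "b \<in> S" "c \<in> S" "a \<noteq> b" "a \<noteq> c" "b \<noteq> c"
        by (auto simp: card_3_iff)
      \<comment> \<open>A vertex whose part differs from those of \<open>y\<close> and
        \<open>z\<close> is adjacent to both. Among three vertices one is in this position, as a
        part has at most two.\<close>
      have key: False if "x \<in> S" "y \<in> S" "z \<in> S" "y \<noteq> z" "x div 2 \<noteq> y div 2" "x div 2 \<noteq> z div 2" for x y z :: nat
      proof -
        have "{y, z} \<subseteq> parcs ?G `` {x} \<inter> S" using that S(1) by (auto simp: co_matching_graph_def subset_iff)
        then have "card {y, z} \<le> card (parcs ?G `` {x} \<inter> S)" by (intro card_mono) auto
        then show False using S(2)[of x] that by auto
      qed
      show False
      proof (cases "a div 2 = b div 2")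
        case True
        then have "c div 2 \<noteq> a div 2" using abc(4-6) half_parity_eqD by metis
        then show False using key[of c a b] True abc by simp
      next
        case False
        then show False using key[of a b c] key[of b a c] abc by fastforce
      qed
    qed
  qed simp
qed

lemma rho_co_matching_graph:
  assumes "n \<ge> 3"
  shows "rho (co_matching_graph n) = co_matching_rho n"
proof -
  let ?G = "co_matching_graph n"
  interpret conn_graph ?G using conn_co_matching_graph[OF assms] .
  define q where "q = (\<lambda>v. if even v then (if Suc v < n then Suc v else v) else v - 1)"
  define b where "b = (real n - 1) / co_matching_rho n"
  define y where "y = (\<lambda>v. if odd n \<and> v = n - 1 then b else 1)"
  have V: "pverts ?G = {0..<n}" by (simp add: co_matching_graph_def)
  have s: "sum y {0..<n} = (if odd n then real n - 1 + b else real n)"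
  proof (cases "odd n")
    case True
    then obtain m where m: "n = Suc m" by (cases n) auto
    show ?thesis using True by (simp add: y_def m)
  qed (simp add: y_def)
  show ?thesis
  proof (rule rho_eq[OF pg V_ne])
    fix v assume "v \<in> pverts ?G"
    then have v: "v < n" by (simp add: V)
    show "0 < y v" using assms co_matching_rho_odd[of n] by (simp add: y_def b_def)
    have "nsum (parcs ?G) y v = sum y {0..<n} - y v - (if q v = v then 0 else y (q v))"
      using nsum_co_matching[of v q y] co_matching_graph_nb[OF v] v unfolding q_def V by simp
    also have "\<dots> = co_matching_rho n * y v"
    proof (cases "odd n")
      case False
      then have "q v \<noteq> v" using co_matching_graph_nb(3)[OF v] by (simp add: q_def)
      then show ?thesis using False s by (simp add: y_def co_matching_rho_def)
    next
      case True
      have qq: "q v = v \<longleftrightarrow> v = n - 1" using co_matching_graph_nb(3)[OF v] True by (simp add: q_def)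
      have "q v \<noteq> n - 1" if "q v \<noteq> v"
        using that True v unfolding q_def by (cases "even v") (simp_all split: if_splits, presburger+)
      then have "y (q v) = 1" if "q v \<noteq> v" using that by (simp add: y_def)
      then show ?thesis
        using qq True s co_matching_rho_odd[OF True assms] by (auto simp: y_def b_def)
    qed
    finally show "nsum (parcs ?G) y v = co_matching_rho n * y v" .
  qed
qed

section \<open>Minimal graphs of dissociation number two\<close>

context conn_graph
begin

text \<open>Two non-neighbours of \<open>v\<close> would form with \<open>v\<close> a set spanning
  at most one edge, that is, a dissociation set with three elements. So each vertex has at most one
  non-neighbour, and this relation is symmetric.\<close>

lemma co_matching_involution:
  assumes "dissociation_number G = 2"
  obtains q where "\<And>v. v \<in> pverts G \<Longrightarrow> q v \<in> pverts G" "\<And>v. v \<in> pverts G \<Longrightarrow> q (q v) = v"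
    "\<And>v. v \<in> pverts G \<Longrightarrow> parcs G `` {v} = pverts G - {v, q v}"
proof -
  have uniq: "a = b" if "v \<in> pverts G" "a \<in> pverts G" "b \<in> pverts G" "a \<noteq> v" "b \<noteq> v"
    "(v, a) \<notin> parcs G" "(v, b) \<notin> parcs G" for v a b
  proof (rule ccontr)
    assume "a \<noteq> b"
    have "card {v, a, b} \<le> dissociation_number G"
    proof (rule dissociation_number_ge)
      show "{v, a, b} \<subseteq> pverts G" using that by simp
      fix x assume x: "x \<in> {v, a, b}"
      have "parcs G `` {x} \<inter> {v, a, b} \<subseteq> (if x = a then {b} else {a})"
        using that x irr symE by (auto split: if_splits)
      then have "card (parcs G `` {x} \<inter> {v, a, b}) \<le> card (if x = a then {b} else {a})"
        by (intro card_mono) auto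
      then show "card (parcs G `` {x} \<inter> {v, a, b}) \<le> 1" by (simp split: if_splits)
    qed
    moreover have "card {v, a, b} = 3" using that \<open>a \<noteq> b\<close> by simp
    ultimately show False using assms by simp
  qed
  define P where "P = (\<lambda>v a. a \<in> pverts G \<and> a \<noteq> v \<and> (v, a) \<notin> parcs G)"
  define q where "q = (\<lambda>v. if \<exists>a. P v a then SOME a. P v a else v)"
  have q1: "P v (q v)" if "P v a" for v a
    using someI[of "P v", OF that] that by (auto simp: q_def)
  have q2: "a = q v" if "P v a" "v \<in> pverts G" for v a
    using uniq[of v a "q v"] q1[OF that(1)] that by (auto simp: P_def)
  have q3: "q v = v" if "\<nexists>a. P v a" for v unfolding q_def using that by (rule if_not_P)
  show thesis
  proof (rule that[of q])
    fix v assume v: "v \<in> pverts G"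
    show qv: "q v \<in> pverts G"
    proof (cases "\<exists>a. P v a")
      case True
      then have "P v (q v)" using q1 by blast
      then show ?thesis by (simp add: P_def)
    qed (use v q3 in auto)
    show "q (q v) = v"
    proof (cases "\<exists>a. P v a")
      case True
      then have "P v (q v)" using q1 by auto
      then have "P (q v) v" using symE v by (auto simp: P_def)
      then show ?thesis using q2[of "q v" v] qv by simp
    qed (simp add: q3)
    show "parcs G `` {v} = pverts G - {v, q v}"
    proof (intro equalityI subsetI)
      fix w assume "w \<in> parcs G `` {v}"
      then have w: "(v, w) \<in> parcs G" "w \<in> pverts G" "w \<noteq> v" using sub irr by auto
      have "w \<noteq> q v"
      proof (cases "\<exists>a. P v a")
        case True
        then have "P v (q v)" using q1 by blast
        then show ?thesis using w by (auto simp: P_def)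
      qed (use w q3 in auto)
      then show "w \<in> pverts G - {v, q v}" using w by simp
    next
      fix w assume "w \<in> pverts G - {v, q v}"
      then show "w \<in> parcs G `` {v}" using q2[of v w] v by (auto simp: P_def)
    qed
  qed
qed

text \<open>The parts are the sets \<open>{v, q v}\<close>, and \<open>U\<close> collects the
  vertices alone in their part. Balance amounts to \<open>card U \<le> 1\<close>, which is where
  minimality enters.\<close>

lemma balanced_if_minimal:
  assumes k: "dissociation_number G = 2" and n: "card (pverts G) = n" "n \<ge> 3"
    and le: "rho G \<le> co_matching_rho n"
  shows "balanced_complete_multipartite (nat \<lceil>real n / 2\<rceil>) G"
proof -
  obtain q where q: "\<And>v. v \<in> pverts G \<Longrightarrow> q v \<in> pverts G" "\<And>v. v \<in> pverts G \<Longrightarrow> q (q v) = v"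
    "\<And>v. v \<in> pverts G \<Longrightarrow> parcs G `` {v} = pverts G - {v, q v}"
    using co_matching_involution[OF k] by metis
  define U where "U = {v \<in> pverts G. q v = v}"
  define P where "P = (\<lambda>v. {v, q v}) ` pverts G"
  have ns: "nsum (parcs G) h v = sum h (pverts G) - h v - (if q v = v then 0 else h (q v))"
    if "v \<in> pverts G" for h v
    using nsum_co_matching[of v q h] q that by simp
  have "finite U" using fin by (simp add: U_def)
  have P_eq: "X = {x, q x}" if "X \<in> P" "x \<in> X" for X x
  proof -
    from that(1) obtain v where v: "v \<in> pverts G" "X = {v, q v}" unfolding P_def by blast
    show ?thesis
    proof (cases "x = v")
      case False
      then have "x = q v" using that(2) v by simp
      then show ?thesis using v q(2)[OF v(1)] by (simp add: insert_commute)
    qed (use v in simp)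
  qed
  have disj: "disjoint P"
  proof (rule disjointI)
    fix X Y assume XY: "X \<in> P" "Y \<in> P" "X \<noteq> Y"
    show "X \<inter> Y = {}"
    proof (rule ccontr)
      assume "X \<inter> Y \<noteq> {}"
      then obtain x where "x \<in> X" "x \<in> Y" by blast
      then show False using P_eq XY by metis
    qed
  qed
  have UP: "\<Union>P = pverts G" using q(1) by (auto simp: P_def)
  have part: "partition_on (pverts G) P"
    using disj UP by (auto simp: partition_on_def P_def)
  have finP: "finite P" using fin by (simp add: P_def)
  have cX: "card X = (if \<exists>u\<in>U. X = {u} then 1 else 2)" if X: "X \<in> P" for X
  proof -
    obtain v where v: "v \<in> pverts G" "X = {v, q v}" using X by (auto simp: P_def)
    then show ?thesis by (cases "q v = v") (auto simp: U_def)
  qed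
  have "n = card (\<Union>P)" using UP n by simp
  also have "\<dots> = (\<Sum>X\<in>P. card X)"
    using disj fin q(1) by (intro card_Union_disjoint) (auto simp: P_def)
  finally have n1: "n = (\<Sum>X\<in>P. card X)" .
  have "card U = card ((\<lambda>u. {u}) ` U)" by (simp add: card_image)
  also have "(\<lambda>u. {u}) ` U = {X \<in> P. \<exists>u\<in>U. X = {u}}"
    by (auto simp: P_def U_def)
  also have "card \<dots> = (\<Sum>X\<in>P. if \<exists>u\<in>U. X = {u} then 1 else 0)"
    unfolding card_eq_sum by (rule sum.inter_filter[OF finP])
  \<comment> \<open>Counting singletons twice makes every part contribute 2.\<close>
  finally have "n + card U = (\<Sum>X\<in>P. card X + (if \<exists>u\<in>U. X = {u} then 1 else 0))"
    using n1 by (simp add: sum.distrib)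
  also have "\<dots> = (\<Sum>X\<in>P. 2)" using cX by (intro sum.cong) auto
  finally have nU: "n + card U = 2 * card P" by simp
  have U1: "card U \<le> 1"
  proof (rule ccontr)
    assume "\<not> card U \<le> 1"
    then obtain u u' where u: "u \<in> U" "u' \<in> U" "u \<noteq> u'"
      using \<open>finite U\<close> by (metis card_le_Suc0_iff_eq One_nat_def)
    \<comment> \<open>The Perron vector of the balanced graph, with its exceptional entry at
      \<open>u\<close>. At the second unmatched vertex \<open>u'\<close> no partner is subtracted,
      which makes the test inequality strict.\<close>
    define b where "b = (if odd n then (real n - 1) / co_matching_rho n else 1)"
    define h where "h = (\<lambda>v. if v = u then b else 1)"
    have uV: "u \<in> pverts G" "u' \<in> pverts G" using u by (auto simp: U_def)
    have b: "0 < b" using co_matching_rho_odd[of n] n by (auto simp: b_def)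
    have sh: "sum h (pverts G) = real n - 1 + b"
    proof -
      have "sum h (pverts G) = h u + sum h (pverts G - {u})" by (rule sum.remove[OF fin uV(1)])
      also have "sum h (pverts G - {u}) = (\<Sum>v\<in>pverts G - {u}. 1)"
        by (rule sum.cong) (auto simp: h_def)
      finally show ?thesis using fin uV n by (simp add: h_def of_nat_diff)
    qed
    have nb: "co_matching_rho n * h v \<le> nsum (parcs G) h v \<and> (v = u' \<longrightarrow> co_matching_rho n * h v < nsum (parcs G) h v)"
      if v: "v \<in> pverts G" for v
    proof -
      have qu: "q v = u \<longleftrightarrow> v = u" using q(2) v u uV by (auto simp: U_def)
      have e: "nsum (parcs G) h v = real n - 1 + b - h v - (if q v = v then 0 else h (q v))"
        using ns[OF v] sh by simp
      show ?thesis
      proof (cases "odd n")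
        case True
        then show ?thesis
          using e qu u co_matching_rho_odd[OF True n(2)] by (auto simp: h_def b_def U_def)
      next
        case False
        then show ?thesis
          using e qu u by (auto simp: h_def b_def U_def co_matching_rho_def)
      qed
    qed
    have "co_matching_rho n < rho G"
      by (rule rho_lower_test(2)[of h _ u u']) (use nb uV b in \<open>auto simp: h_def\<close>)
    then show False using le by simp
  qed
  have mp: "complete_multipartite G P"
    unfolding complete_multipartite_def
  proof (intro conjI ballI part)
    fix u v assume uv: "u \<in> pverts G" "v \<in> pverts G"
    have "(u, v) \<in> parcs G \<longleftrightarrow> v \<notin> {u, q u}" using q(3)[OF uv(1)] uv by blast
    also have "\<dots> \<longleftrightarrow> \<not> (\<exists>X\<in>P. u \<in> X \<and> v \<in> X)"
    proof -
      have "(\<exists>X\<in>P. u \<in> X \<and> v \<in> X) \<longleftrightarrow> v \<in> {u, q u}"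
      proof
        assume "\<exists>X\<in>P. u \<in> X \<and> v \<in> X"
        then show "v \<in> {u, q u}" using P_eq by metis
      qed (use uv in \<open>auto simp: P_def\<close>)
      then show ?thesis by simp
    qed
    finally show "(u, v) \<in> parcs G \<longleftrightarrow> \<not> (\<exists>X\<in>P. u \<in> X \<and> v \<in> X)" .
  qed
  have cP: "card P = nat \<lceil>real n / 2\<rceil>" using nU U1 by linarith
  have "int (card X) \<in> {\<lceil>real n / real (card P)\<rceil>, \<lfloor>real n / real (card P)\<rfloor>}" if X: "X \<in> P" for X
  proof (cases "card U = 0")
    case True
    then have "U = {}" using \<open>finite U\<close> by simp
    then have "card X = 2" using cX[OF X] by simp
    moreover have "real n / real (card P) = 2" using nU True n by (simp add: field_simps)
    ultimately show ?thesis by simp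
  next
    case False
    then have "n + 1 = 2 * card P" using nU U1 by linarith
    \<comment> \<open>With exactly one singleton, \<open>n / card P\<close> lies strictly between 1
      and 2, so both part sizes are admissible.\<close>
    then have e: "real n = 2 * real (card P) - 1" by linarith
    then have "\<lceil>real n / real (card P)\<rceil> = 2" "\<lfloor>real n / real (card P)\<rfloor> = 1"
      using n(2) by (auto simp: ceiling_eq_iff floor_eq_iff field_simps)
    then show ?thesis using cX[OF X] by simp
  qed
  then show ?thesis
    unfolding balanced_complete_multipartite_def cP[symmetric] using mp finP n(1) by blast
qed

end


section \<open>Connected graphs of maximum degree two\<close>

context cgraph
begin

definition path_from :: "'a \<Rightarrow> 'a list \<Rightarrow> bool" where
  "path_from s p \<longleftrightarrow> p \<noteq> [] \<and> p ! 0 = s \<and> distinct p \<and> set p \<subseteq> V \<and>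
     (\<forall>i. Suc i < length p \<longrightarrow> (p ! i, p ! Suc i) \<in> E)"

lemma longest_path_from:
  assumes "s \<in> V"
  obtains p where "path_from s p" "\<And>w. (last p, w) \<in> E \<Longrightarrow> w \<in> set p"
proof -
  have "path_from s [s]" using assms by (simp add: path_from_def)
  moreover have "\<forall>p. path_from s p \<longrightarrow> length p \<le> card V"
    unfolding path_from_def using fin by (metis card_mono distinct_card)
  ultimately obtain p where p: "path_from s p" "\<And>q. path_from s q \<Longrightarrow> length q \<le> length p"
    using ex_has_greatest_nat[of "path_from s" "[s]" length "Suc (card V)"]
    by (auto simp: less_Suc_eq_le)
  have "w \<in> set p" if w: "(last p, w) \<in> E" for w
  proof (rule ccontr)
    assume n: "w \<notin> set p"
    have "path_from s (p @ [w])" unfolding path_from_def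
    proof (intro conjI allI impI)
      show "(p @ [w]) ! 0 = s" "distinct (p @ [w])" "set (p @ [w]) \<subseteq> V"
        using p(1) n w sub by (auto simp: path_from_def nth_append)
      fix i assume "Suc i < length (p @ [w])"
      then consider "Suc i < length p" | "i = length p - 1" "p \<noteq> []"
        using p(1) unfolding path_from_def by fastforce
      then show "((p @ [w]) ! i, (p @ [w]) ! Suc i) \<in> E"
        by cases (use p(1) w in \<open>auto simp: path_from_def nth_append last_conv_nth\<close>)
    qed simp
    then show False using p(2) by fastforce
  qed
  then show thesis using that p(1) by blast
qed

lemma two_nbs:
  assumes "card (E `` {v}) \<le> 2" "(v, a) \<in> E" "(v, b) \<in> E" "a \<noteq> b"
  shows "E `` {v} = {a, b}"
proof -
  have "{a, b} = E `` {v}" using assms by (intro card_seteq) auto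
  then show ?thesis by simp
qed

text \<open>The start \<open>s\<close> is an end of the path to be found, or any vertex if all
  degrees are 2. On a longest path from \<open>s\<close> the inner vertices have both their
  neighbours on the path, so the last vertex can only be joined to its predecessor or to
  \<open>s\<close>. Hence the path is closed under adjacency and contains all vertices; the closing
  edge is present exactly when \<open>s\<close> has degree 2.\<close>

lemma path_or_cycle_arcs:
  assumes deg: "\<And>v. v \<in> V \<Longrightarrow> card (E `` {v}) \<le> 2" and s: "s \<in> V"
    and c: "card (E `` {s}) \<le> 1 \<or> (\<forall>v\<in>V. card (E `` {v}) = 2)"
  obtains p where "set p = V" "distinct p"
    "\<And>i j. i < length p \<Longrightarrow> j < length p \<Longrightarrow> (p ! i, p ! j) \<in> E \<longleftrightarrow> j = Suc i \<or> i = Suc j \<or>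
       (card (E `` {s}) = 2 \<and> (i = 0 \<and> Suc j = length p \<or> j = 0 \<and> Suc i = length p))"
proof -
  obtain p where p: "path_from s p" and mx: "\<And>w. (last p, w) \<in> E \<Longrightarrow> w \<in> set p"
    using longest_path_from[OF s] by blast
  define m where "m = length p"
  have m: "m > 0" and p0: "p ! 0 = s" and dist: "distinct p" and pV: "set p \<subseteq> V"
    and adj: "\<And>i. Suc i < m \<Longrightarrow> (p ! i, p ! Suc i) \<in> E"
    using p by (auto simp: path_from_def m_def)
  have inV: "p ! i \<in> V" if "i < m" for i using pV that by (auto simp: m_def)
  have eq: "p ! i = p ! j \<longleftrightarrow> i = j" if "i < m" "j < m" for i j
    using dist that by (simp add: nth_eq_iff_index_eq m_def)
  have mid: "E `` {p ! i} = {p ! (i - 1), p ! Suc i}" if "0 < i" "Suc i < m" for i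
  proof (rule two_nbs)
    show "(p ! i, p ! (i - 1)) \<in> E" using adj[of "i - 1"] that symE by simp
    show "(p ! i, p ! Suc i) \<in> E" using adj[of i] that by simp
    show "p ! (i - 1) \<noteq> p ! Suc i" using eq[of "i - 1" "Suc i"] that by simp
  qed (use deg inV that in auto)
  have midE: "(p ! i, p ! j) \<in> E \<longleftrightarrow> j = Suc i \<or> i = Suc j" if "0 < i" "Suc i < m" "j < m" for i j
  proof -
    have "(p ! i, p ! j) \<in> E \<longleftrightarrow> p ! j \<in> {p ! (i - 1), p ! Suc i}" using mid[OF that(1,2)] by auto
    also have "\<dots> \<longleftrightarrow> j = Suc i \<or> i = Suc j" using eq[of j "i - 1"] eq[of j "Suc i"] that by auto
    finally show ?thesis .
  qed
  have lst: "\<exists>j. w = p ! j \<and> j < m \<and> (Suc (Suc j) = m \<or> j = 0 \<and> 1 < m)" if w: "(p ! (m - 1), w) \<in> E" for w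
  proof -
    have "last p = p ! (m - 1)" using m by (simp add: m_def last_conv_nth)
    then have "w \<in> set p" using mx w by simp
    then obtain j where j: "j < m" "w = p ! j" by (auto simp: in_set_conv_nth m_def)
    have "j \<noteq> m - 1" using irr w j by auto
    moreover have "Suc (Suc j) = m" if "0 < j" "Suc j < m"
      using midE[of j "m - 1"] that symE[OF w] j by auto
    ultimately show ?thesis using j by (cases "j = 0") auto
  qed
  have ends: "E `` {p ! 0} \<subseteq> set p \<and> (\<forall>j<m. (p ! 0, p ! j) \<in> E \<longleftrightarrow> j = 1 \<or> card (E `` {s}) = 2 \<and> Suc j = m)"
    using c
  proof
    assume c1: "card (E `` {s}) \<le> 1"
    show ?thesis
    proof (cases "m = 1")
      case True
      have "E `` {p ! 0} = {}"
      proof (rule ccontr)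
        assume "E `` {p ! 0} \<noteq> {}"
        then obtain w where "(p ! (m - 1), w) \<in> E" using True by auto
        then show False using lst[of w] True irr by auto
      qed
      then show ?thesis using True c1 by auto
    next
      case False
      then have "(p ! 0, p ! 1) \<in> E" using adj[of 0] m by auto
      then have N: "{p ! 1} = E `` {p ! 0}" using c1 p0 by (intro card_seteq) auto
      have "1 < m" using m False by simp
      then have "p ! 1 \<in> set p" unfolding m_def by (rule nth_mem)
      then have "E `` {p ! 0} \<subseteq> set p" unfolding N[symmetric] by simp
      moreover have "(p ! 0, p ! j) \<in> E \<longleftrightarrow> j = 1" if "j < m" for j
      proof -
        have "(p ! 0, p ! j) \<in> E \<longleftrightarrow> p ! j \<in> {p ! 1}" unfolding N by simp
        then show ?thesis using eq[of j 1] that False m by simp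
      qed
      ultimately show ?thesis using c1 by auto
    qed
  next
    assume c2: "\<forall>v\<in>V. card (E `` {v}) = 2"
    \<comment> \<open>The last vertex has a neighbour besides its predecessor, and
      \<open>lst\<close> leaves only the start for it.\<close>
    have "\<exists>w. (p ! (m - 1), w) \<in> E \<and> w \<noteq> p ! (m - 2)"
    proof (rule ccontr)
      assume "\<nexists>w. (p ! (m - 1), w) \<in> E \<and> w \<noteq> p ! (m - 2)"
      then have "E `` {p ! (m - 1)} \<subseteq> {p ! (m - 2)}" by auto
      then have "card (E `` {p ! (m - 1)}) \<le> card {p ! (m - 2)}" by (intro card_mono) auto
      then show False using c2 inV[of "m - 1"] m by auto
    qed
    then obtain w where w: "(p ! (m - 1), w) \<in> E" "w \<noteq> p ! (m - 2)" by auto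
    then obtain j where "w = p ! j" "j < m" "Suc (Suc j) = m \<or> j = 0 \<and> 1 < m" using lst by blast
    then have j: "w = p ! 0" "1 < m" "m \<noteq> 2" using w(2) by auto
    then have N: "E `` {p ! 0} = {p ! 1, p ! (m - 1)}"
      using symE[OF w(1)] adj[of 0] c2 inV[of 0] eq[of 1 "m - 1"] by (intro two_nbs) auto
    have "card (E `` {s}) = 2" using c2 s by simp
    moreover have "(p ! 0, p ! j) \<in> E \<longleftrightarrow> j = 1 \<or> Suc j = m" if "j < m" for j
    proof -
      have "(p ! 0, p ! j) \<in> E \<longleftrightarrow> p ! j \<in> {p ! 1, p ! (m - 1)}" unfolding N[symmetric] by simp
      then show ?thesis using eq[of j 1] eq[of j "m - 1"] that \<open>1 < m\<close> by auto
    qed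
    moreover have "{p ! 1, p ! (m - 1)} \<subseteq> set p" using j(2) by (auto simp: m_def)
    ultimately show ?thesis using N by auto
  qed
  have closed: "set p = V"
  proof (rule closed_eq[OF pV])
    show "set p \<noteq> {}" using m by (auto simp: m_def)
    fix v w assume "v \<in> set p" "(v, w) \<in> E"
    then obtain i where i: "i < m" "v = p ! i" by (auto simp: in_set_conv_nth m_def)
    consider "i = 0" | "0 < i" "Suc i < m" | "i = m - 1" using i by linarith
    then show "w \<in> set p"
    proof cases
      case 1 then show ?thesis using ends \<open>(v, w) \<in> E\<close> i by auto
    next
      case 2
      then have "w = p ! (i - 1) \<or> w = p ! Suc i" using mid[of i] \<open>(v, w) \<in> E\<close> i by auto
      then show ?thesis using 2 by (auto simp: m_def)
    next
      case 3
      then show ?thesis using lst[of w] \<open>(v, w) \<in> E\<close> i by (auto simp: m_def)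
    qed
  qed
  show thesis
  proof (rule that[OF closed dist])
    fix i j assume ij: "i < length p" "j < length p"
    then have ij: "i < m" "j < m" by (auto simp: m_def)
    consider "i = 0" | "j = 0" | "0 < i" "Suc i < m" | "0 < j" "Suc j < m" | "i = m - 1" "j = m - 1"
      using ij by linarith
    then show "(p ! i, p ! j) \<in> E \<longleftrightarrow> j = Suc i \<or> i = Suc j \<or>
       (card (E `` {s}) = 2 \<and> (i = 0 \<and> Suc j = length p \<or> j = 0 \<and> Suc i = length p))"
    proof cases
      case 1
      then show ?thesis using ends ij irr[of "p ! 0"] by (auto simp flip: m_def)
    next
      case 2
      have "(p ! i, p ! j) \<in> E \<longleftrightarrow> (p ! 0, p ! i) \<in> E" using symE 2 by blast
      then show ?thesis using ends ij irr[of "p ! 0"] 2 by (auto simp flip: m_def)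
    next
      case 3
      then show ?thesis using midE[of i j] ij by (auto simp flip: m_def)
    next
      case 4
      have "(p ! i, p ! j) \<in> E \<longleftrightarrow> (p ! j, p ! i) \<in> E" using symE by blast
      then show ?thesis using midE[of j i] ij 4 by (auto simp flip: m_def)
    next
      case 5
      show ?thesis
      proof (cases "m = 1")
        case True
        then show ?thesis using 5 ends ij by (auto simp flip: m_def)
      next
        case False
        then show ?thesis using irr 5 m by (auto simp flip: m_def)
      qed
    qed
  qed
qed

end

lemma bij_betw_nth0: "distinct p \<Longrightarrow> bij_betw (\<lambda>i. p ! i) {0..<length p} (set p)"
  by (rule bij_betw_nth) auto

lemma cycle_graph_arc_iff:
  assumes "i < n" "j < n"
  shows "(i, j) \<in> parcs (cycle_graph n) \<longleftrightarrow>
    j = Suc i \<or> i = Suc j \<or> (i = 0 \<and> Suc j = n \<or> j = 0 \<and> Suc i = n)"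
proof -
  have mod: "j = Suc i mod n \<longleftrightarrow> j = Suc i \<or> j = 0 \<and> Suc i = n" if "i < n" "j < n" for i j
    using that by (cases "Suc i = n") auto
  have "(i, j) \<in> parcs (cycle_graph n) \<longleftrightarrow> j = Suc i mod n \<or> i = Suc j mod n"
    using assms by (simp add: cycle_graph_def)
  then show ?thesis unfolding mod[OF assms] mod[OF assms(2,1)] by blast
qed

lemma pair_graph_cycle_graph:
  assumes "3 \<le> n"
  shows "pair_graph (cycle_graph n)"
  unfolding pair_graph_iff_sgraph
proof
  show "parcs (cycle_graph n) \<subseteq> pverts (cycle_graph n) \<times> pverts (cycle_graph n)"
    by (auto simp: cycle_graph_def)
  show "(b, a) \<in> parcs (cycle_graph n)" if "(a, b) \<in> parcs (cycle_graph n)" for a b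
    using that by (auto simp: cycle_graph_def)
  show "(a, a) \<notin> parcs (cycle_graph n)" for a
  proof
    assume a: "(a, a) \<in> parcs (cycle_graph n)"
    then have "a < n" by (simp add: cycle_graph_def)
    then show False using a assms by (simp add: cycle_graph_arc_iff)
  qed
qed (simp add: cycle_graph_def)

context conn_graph
begin

lemma iso_path_graph:
  assumes deg: "\<And>v. v \<in> pverts G \<Longrightarrow> card (parcs G `` {v}) \<le> 2"
    and s: "s \<in> pverts G" "card (parcs G `` {s}) \<le> 1"
  shows "graph_iso G (path_graph (card (pverts G)))"
proof (rule path_or_cycle_arcs[OF deg s(1)])
  show "card (parcs G `` {s}) \<le> 1 \<or> (\<forall>v\<in>pverts G. card (parcs G `` {v}) = 2)" using s by simp
  fix p assume p: "set p = pverts G" "distinct p"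
    "\<And>i j. i < length p \<Longrightarrow> j < length p \<Longrightarrow> (p ! i, p ! j) \<in> parcs G \<longleftrightarrow> j = Suc i \<or> i = Suc j \<or>
       (card (parcs G `` {s}) = 2 \<and> (i = 0 \<and> Suc j = length p \<or> j = 0 \<and> Suc i = length p))"
  have n: "card (pverts G) = length p" using p by (metis distinct_card)
  show ?thesis unfolding n
  proof (rule graph_isoI_inv[OF pg])
    show "pair_graph (path_graph (length p))"
      unfolding pair_graph_iff_sgraph by unfold_locales (auto simp: path_graph_def)
    show "bij_betw (\<lambda>i. p ! i) (pverts (path_graph (length p))) (pverts G)"
      using bij_betw_nth0[OF p(2)] p(1) by (simp add: path_graph_def)
  qed (use p(3) s(2) in \<open>auto simp: path_graph_def\<close>)
qed

lemma iso_cycle_graph: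
  assumes deg: "\<And>v. v \<in> pverts G \<Longrightarrow> card (parcs G `` {v}) = 2"
  shows "3 \<le> card (pverts G)" "graph_iso G (cycle_graph (card (pverts G)))"
proof -
  obtain s where s: "s \<in> pverts G" using V_ne by auto
  have "insert s (parcs G `` {s}) \<subseteq> pverts G" using s nb_sub by auto
  then have "card (insert s (parcs G `` {s})) \<le> card (pverts G)" using fin by (rule card_mono[rotated])
  then show 3: "3 \<le> card (pverts G)" using deg[OF s] irr by (simp add: card_insert_if)
  show "graph_iso G (cycle_graph (card (pverts G)))"
  proof (rule path_or_cycle_arcs[OF _ s])
    show "card (parcs G `` {v}) \<le> 2" if "v \<in> pverts G" for v using deg[OF that] by simp
    show "card (parcs G `` {s}) \<le> 1 \<or> (\<forall>v\<in>pverts G. card (parcs G `` {v}) = 2)" using deg by simp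
    fix p assume p: "set p = pverts G" "distinct p"
      "\<And>i j. i < length p \<Longrightarrow> j < length p \<Longrightarrow> (p ! i, p ! j) \<in> parcs G \<longleftrightarrow> j = Suc i \<or> i = Suc j \<or>
         (card (parcs G `` {s}) = 2 \<and> (i = 0 \<and> Suc j = length p \<or> j = 0 \<and> Suc i = length p))"
    have n: "card (pverts G) = length p" using p by (metis distinct_card)
    show ?thesis unfolding n
    proof (rule graph_isoI_inv[OF pg])
      show "pair_graph (cycle_graph (length p))"
        using pair_graph_cycle_graph 3 n by simp
      show "bij_betw (\<lambda>i. p ! i) (pverts (cycle_graph (length p))) (pverts G)"
        using bij_betw_nth0[OF p(2)] p(1) by (simp add: cycle_graph_def)
    next
      fix i j assume "i \<in> pverts (cycle_graph (length p))" "j \<in> pverts (cycle_graph (length p))"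
      then have ij: "i < length p" "j < length p" by (auto simp: cycle_graph_def)
      show "(i, j) \<in> parcs (cycle_graph (length p)) \<longleftrightarrow> (p ! i, p ! j) \<in> parcs G"
        unfolding p(3)[OF ij] cycle_graph_arc_iff[OF ij] using deg[OF s] by blast
    qed
  qed
qed

end


section \<open>Forests, paths and cycles\<close>

definition dissoc :: "'a rel \<Rightarrow> 'a set \<Rightarrow> bool" where
  "dissoc E S \<longleftrightarrow> (\<forall>v\<in>S. card (E `` {v} \<inter> S) \<le> 1)"

text \<open>For the arc relation of a simple graph this says that \<open>W\<close> induces a forest.\<close>

definition one_degenerate :: "'a rel \<Rightarrow> 'a set \<Rightarrow> bool" where
  "one_degenerate E W \<longleftrightarrow> (\<forall>U\<subseteq>W. U \<noteq> {} \<longrightarrow> (\<exists>v\<in>U. card (E `` {v} \<inter> U) \<le> 1))"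

context sgraph
begin

lemma dissoc_union:
  assumes "dissoc E S" "dissoc E T" and n: "\<And>s t. s \<in> S \<Longrightarrow> t \<in> T \<Longrightarrow> (s, t) \<notin> E"
  shows "dissoc E (S \<union> T)"
  unfolding dissoc_def
proof
  fix v assume "v \<in> S \<union> T"
  then show "card (E `` {v} \<inter> (S \<union> T)) \<le> 1"
  proof
    assume v: "v \<in> S"
    then have "E `` {v} \<inter> (S \<union> T) = E `` {v} \<inter> S" using n by auto
    then show ?thesis using assms(1) v by (simp add: dissoc_def)
  next
    assume v: "v \<in> T"
    then have "E `` {v} \<inter> (S \<union> T) = E `` {v} \<inter> T" using n symE by auto
    then show ?thesis using assms(2) v by (simp add: dissoc_def)
  qed
qed

text \<open>One round of a greedy construction: \<open>T\<close> takes at least two thirds of the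
  removed part \<open>W - W'\<close> and has no edges to what remains. An isolated vertex is kept; a
  leaf whose neighbour has degree at most 2 is kept with that neighbour, at the cost of at most one
  more vertex; two leaves with a common neighbour are kept without it. If none of these occurs,
  deleting all leaves leaves degrees of at least 2, against degeneracy.\<close>

lemma one_degenerate_reducible:
  assumes W: "W \<subseteq> V" "W \<noteq> {}" and deg: "one_degenerate E W"
  obtains T W' where "W' \<subset> W" "T \<subseteq> W - W'" "dissoc E T" "\<And>s t. s \<in> W' \<Longrightarrow> t \<in> T \<Longrightarrow> (s, t) \<notin> E"
    "2 * card (W - W') \<le> 3 * card T"
proof -
  define N where "N = (\<lambda>v. E `` {v} \<inter> W)"
  have finN: "finite (N v)" for v by (simp add: N_def)
  have Nsym: "w \<in> N v \<Longrightarrow> v \<in> W \<Longrightarrow> v \<in> N w" for v w using symE by (auto simp: N_def)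
  have NW: "N v \<subseteq> W" for v by (auto simp: N_def)
  have NI: "(s, t) \<in> E \<Longrightarrow> s \<in> W \<Longrightarrow> s \<in> N t" for s t using symE by (auto simp: N_def)
  have nself: "v \<notin> N v" for v using irr by (auto simp: N_def)
  have dissocI: "dissoc E T" if T: "\<And>v. v \<in> T \<Longrightarrow> \<exists>a. N v \<inter> T \<subseteq> {a}" "T \<subseteq> W" for T
    unfolding dissoc_def
  proof
    fix v assume "v \<in> T"
    then obtain a where "N v \<inter> T \<subseteq> {a}" using T(1) by blast
    then have "E `` {v} \<inter> T \<subseteq> {a}" using T(2) by (auto simp: N_def)
    then have "card (E `` {v} \<inter> T) \<le> card {a}" by (intro card_mono) auto
    then show "card (E `` {v} \<inter> T) \<le> 1" by simp
  qed
  consider (isolated) v where "v \<in> W" "N v = {}"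
    | (pendant) l p where "l \<in> W" "N l = {p}" "card (N p) \<le> 2"
    | (twins) l1 l2 p where "l1 \<in> W" "l2 \<in> W" "l1 \<noteq> l2" "N l1 = {p}" "N l2 = {p}"
    | (none) "\<And>v. v \<in> W \<Longrightarrow> N v \<noteq> {}" "\<And>l p. l \<in> W \<Longrightarrow> N l = {p} \<Longrightarrow> 3 \<le> card (N p)"
        "\<And>l1 l2 p. l1 \<in> W \<Longrightarrow> l2 \<in> W \<Longrightarrow> N l1 = {p} \<Longrightarrow> N l2 = {p} \<Longrightarrow> l1 = l2"
    by (metis not_less_eq_eq numeral_2_eq_2 numeral_3_eq_3)
  then show thesis
  proof cases
    case isolated
    show thesis
    proof (rule that[of "W - {v}" "{v}"])
      show "dissoc E {v}" using isolated by (intro dissocI) auto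
      show "(s, t) \<notin> E" if "s \<in> W - {v}" "t \<in> {v}" for s t using isolated NI that by blast
      have "W - (W - {v}) = {v}" using isolated by auto
      then show "2 * card (W - (W - {v})) \<le> 3 * card {v}" by simp
    qed (use isolated in auto)
  next
    case pendant
    have p: "p \<in> W" "l \<noteq> p" using pendant(2) NW nself by auto
    have l: "l \<in> N p" using Nsym[of p l] pendant by simp
    have pN: "p \<notin> N p" by (rule nself)
    have eq: "W - (W - insert p (N p)) = insert p (N p)" using NW p by auto
    show thesis
    proof (rule that[of "W - insert p (N p)" "{l, p}"])
      show "dissoc E {l, p}"
      proof (rule dissocI)
        fix v assume "v \<in> {l, p}"
        then show "\<exists>a. N v \<inter> {l, p} \<subseteq> {a}" using nself[of p] pendant(2) by (cases "v = l") auto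
      qed (use pendant p in auto)
      show "(s, t) \<notin> E" if "s \<in> W - insert p (N p)" "t \<in> {l, p}" for s t
        using that NI[of s t] pendant(2) by auto
      show "W - insert p (N p) \<subset> W" using p by auto
      show "{l, p} \<subseteq> W - (W - insert p (N p))" unfolding eq using l by auto
      show "2 * card (W - (W - insert p (N p))) \<le> 3 * card {l, p}"
        unfolding eq using pendant(3) finN pN p by simp
    qed
  next
    case twins
    have "p \<in> N l1" "p \<in> N l2" using twins by auto
    then have p: "p \<in> W" "p \<noteq> l1" "p \<noteq> l2" using NW nself by blast+
    have eq: "W - (W - {p, l1, l2}) = {p, l1, l2}" using twins p by auto
    show thesis
    proof (rule that[of "W - {p, l1, l2}" "{l1, l2}"])
      show "dissoc E {l1, l2}"
      proof (rule dissocI)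
        fix v assume "v \<in> {l1, l2}"
        then show "\<exists>a. N v \<inter> {l1, l2} \<subseteq> {a}" using twins by auto
      qed (use twins in auto)
      show "(s, t) \<notin> E" if "s \<in> W - {p, l1, l2}" "t \<in> {l1, l2}" for s t
        using that NI[of s t] twins by auto
      show "W - {p, l1, l2} \<subset> W" using p by auto
      show "{l1, l2} \<subseteq> W - (W - {p, l1, l2})" unfolding eq by auto
      show "2 * card (W - (W - {p, l1, l2})) \<le> 3 * card {l1, l2}"
        unfolding eq using twins p by simp
    qed
  next
    case none
    define L where "L = {v \<in> W. card (N v) = 1}"
    have Nge: "card (N v) \<ge> 2" if "v \<in> W - L" for v
    proof -
      have "card (N v) \<noteq> 0" using none(1)[of v] finN that by auto
      moreover have "card (N v) \<noteq> 1" using that by (auto simp: L_def)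
      ultimately show ?thesis by linarith
    qed
    have leafE: "N l = {p}" if "l \<in> L" "p \<in> N l" for l p
      using that by (auto simp: L_def card_1_singleton_iff)
    \<comment> \<open>A vertex outside \<open>L\<close> is next to at most one leaf, and if there is
      one its degree is at least 3, so two neighbours survive.\<close>
    have U2: "2 \<le> card (E `` {v} \<inter> (W - L))" if v: "v \<in> W - L" for v
    proof -
      have e: "E `` {v} \<inter> (W - L) = N v - (N v \<inter> L)" by (auto simp: N_def)
      show ?thesis
      proof (cases "N v \<inter> L = {}")
        case True
        then show ?thesis using e Nge[OF v] by simp
      next
        case False
        then obtain l where l: "l \<in> N v" "l \<in> L" by auto
        have lW: "l \<in> W" using l by (simp add: L_def)
        have Nl: "N l = {v}" using leafE[OF l(2)] Nsym[OF l(1)] v by auto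
        have "N v \<inter> L = {l}"
        proof (intro equalityI subsetI)
          fix l' assume l': "l' \<in> N v \<inter> L"
          then have "N l' = {v}" using leafE[of l' v] Nsym[of l' v] v by auto
          then show "l' \<in> {l}" using none(3)[OF _ lW _ Nl, of l'] l' by (auto simp: L_def)
        qed (use l in auto)
        then have "card (E `` {v} \<inter> (W - L)) = card (N v) - 1" using e l by simp
        then show ?thesis using none(2)[OF lW Nl] by linarith
      qed
    qed
    have "W - L \<noteq> {}"
    proof
      assume "W - L = {}"
      then obtain l where l: "l \<in> L" using W by auto
      then obtain p where p: "N l = {p}" by (auto simp: L_def card_1_singleton_iff)
      then have "p \<in> L" using NW[of l] \<open>W - L = {}\<close> by auto
      moreover have "3 \<le> card (N p)" using none(2) p l by (auto simp: L_def)
      ultimately show False by (simp add: L_def)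
    qed
    then obtain v where "v \<in> W - L" "card (E `` {v} \<inter> (W - L)) \<le> 1"
      using deg unfolding one_degenerate_def by (meson Diff_subset)
    then show thesis using U2 by fastforce
  qed
qed

lemma dissoc_of_one_degenerate:
  assumes "W \<subseteq> V" "one_degenerate E W"
  shows "\<exists>S\<subseteq>W. dissoc E S \<and> 2 * card W \<le> 3 * card S"
proof -
  have "finite W" using assms(1) fin by (rule finite_subset)
  then show ?thesis using assms
  proof (induction rule: finite_psubset_induct)
    case (psubset W)
    show ?case
    proof (cases "W = {}")
      case True
      then show ?thesis by (auto simp: dissoc_def)
    next
      case False
      then obtain T W' where T: "W' \<subset> W" "T \<subseteq> W - W'" "dissoc E T"
        "\<And>s t. s \<in> W' \<Longrightarrow> t \<in> T \<Longrightarrow> (s, t) \<notin> E" "2 * card (W - W') \<le> 3 * card T"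
        using one_degenerate_reducible[OF psubset.prems(1) _ psubset.prems(2)] by metis
      have "one_degenerate E W'" using psubset.prems(2) T(1) unfolding one_degenerate_def by blast
      then obtain S where S: "S \<subseteq> W'" "dissoc E S" "2 * card W' \<le> 3 * card S"
        using psubset.IH[OF T(1)] psubset.prems(1) T(1) by blast
      have "finite S" "finite T" using S(1) T(1,2) psubset.hyps by (meson finite_Diff finite_subset psubset_imp_subset)+
      then have "card (S \<union> T) = card S + card T"
        using S(1) T(2) by (intro card_Un_disjoint) auto
      moreover have "card W = card W' + card (W - W')"
        using T(1) psubset.hyps by (metis card_Diff_subset card_mono finite_subset le_add_diff_inverse psubset_imp_subset)
      moreover have "dissoc E (S \<union> T)" using S T by (intro dissoc_union) auto
      ultimately show ?thesis using S T by (intro exI[of _ "S \<union> T"]) auto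
    qed
  qed
qed

end

lemma (in conn_graph) iso_cycle_if_not_one_degenerate:
  assumes nd: "\<not> one_degenerate (parcs G) (pverts G)"
  shows "2 \<le> rho G" "rho G \<le> 2 \<Longrightarrow> is_cycle_graph G"
proof -
  obtain U where U: "U \<subseteq> pverts G" "U \<noteq> {}" "\<And>v. v \<in> U \<Longrightarrow> 2 \<le> card (parcs G `` {v} \<inter> U)"
    using nd unfolding one_degenerate_def by (metis not_less_eq_eq numeral_2_eq_2 One_nat_def)
  define h :: "'a \<Rightarrow> real" where "h = indicator U"
  have ns: "nsum (parcs G) h v = card (parcs G `` {v} \<inter> U)" for v
    by (simp add: nsum_def h_def indicator_def sum.If_cases Int_def)
  have ge: "2 * h v \<le> nsum (parcs G) h v" for v
    using U(3)[of v] by (cases "v \<in> U") (simp_all add: ns, simp_all add: h_def)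
  obtain u where u: "u \<in> U" using U by auto
  note lt = rho_lower_test[of h 2 u, OF _ ge]
  show "2 \<le> rho G" by (rule lt) (use u U in \<open>auto simp: h_def\<close>)
  assume le: "rho G \<le> 2"
  \<comment> \<open>Equality in the test means that a vertex of \<open>U\<close> has exactly two
    neighbours in \<open>U\<close> and a vertex outside has none, so \<open>U\<close> is closed
    under adjacency.\<close>
  have eq: "2 * h v = card (parcs G `` {v} \<inter> U)" if v: "v \<in> pverts G" for v
  proof (rule ccontr)
    assume "2 * h v \<noteq> card (parcs G `` {v} \<inter> U)"
    then have "2 * h v < nsum (parcs G) h v" using ge[of v] ns by simp
    then have "2 < rho G" using v u U by (intro lt(2)[of v]) (auto simp: h_def)
    then show False using le by simp
  qed
  have "U = pverts G"
  proof (rule closed_eq[OF U(1,2)])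
    fix v w assume vw: "v \<in> U" "(v, w) \<in> parcs G"
    show "w \<in> U"
    proof (rule ccontr)
      assume "w \<notin> U"
      then have "parcs G `` {w} \<inter> U = {}" using eq[of w] vw sub by (auto simp: h_def)
      then show False using vw symE by auto
    qed
  qed
  then have d: "card (parcs G `` {v}) = 2" if "v \<in> pverts G" for v
  proof -
    have "parcs G `` {v} \<inter> U = parcs G `` {v}" using \<open>U = pverts G\<close> nb_sub by auto
    then show ?thesis using eq[OF that] that \<open>U = pverts G\<close> by (simp add: h_def)
  qed
  show "is_cycle_graph G" unfolding is_cycle_graph_def using iso_cycle_graph[OF d] by blast
qed

section \<open>Dissociation numbers of paths and cycles\<close>

lemma conn_path_graph:
  assumes "1 \<le> n"
  shows "conn_graph (path_graph n)"
proof -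
  let ?G = "path_graph n"
  have sg: "sgraph (pverts ?G) (parcs ?G)" by unfold_locales (auto simp: path_graph_def)
  have "cut_connected (pverts ?G) (parcs ?G)"
  proof (rule sgraph.cut_connectedI[OF sg, of 0 "\<lambda>v. v"])
    fix v assume "v \<in> pverts ?G" "v \<noteq> 0"
    then show "\<exists>w. (v, w) \<in> parcs ?G \<and> w < v"
      by (intro exI[of _ "v - 1"]) (auto simp: path_graph_def)
  qed (use assms in \<open>simp add: path_graph_def\<close>)
  then show ?thesis using sg by (simp add: conn_graph_def pair_graph_iff_sgraph)
qed

lemma conn_cycle_graph:
  assumes "3 \<le> n"
  shows "conn_graph (cycle_graph n)"
proof -
  let ?G = "cycle_graph n"
  have sg: "sgraph (pverts ?G) (parcs ?G)"
    using pair_graph_cycle_graph[OF assms] by (simp add: pair_graph_iff_sgraph)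
  have "cut_connected (pverts ?G) (parcs ?G)"
  proof (rule sgraph.cut_connectedI[OF sg, of 0 "\<lambda>v. v"])
    fix v assume "v \<in> pverts ?G" "v \<noteq> 0"
    then show "\<exists>w. (v, w) \<in> parcs ?G \<and> w < v"
      by (intro exI[of _ "v - 1"]) (auto simp: cycle_graph_def)
  qed (use assms in \<open>simp add: cycle_graph_def\<close>)
  then show ?thesis using sg by (simp add: conn_graph_def pair_graph_iff_sgraph)
qed

text \<open>Induction in steps of three, each of which adds at most two elements. The bound is two
  thirds of \<open>n\<close>, rounded up.\<close>

lemma card_no_three_consecutive:
  fixes S :: "nat set"
  assumes "\<And>i. \<not> (i \<in> S \<and> Suc i \<in> S \<and> Suc (Suc i) \<in> S)"
  shows "card (S \<inter> {0..<n}) \<le> (2 * n + 2) div 3"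
proof (induction n rule: less_induct)
  case (less n)
  consider "n = 0" | "n = 1" | "n = 2" | m where "n = m + 3"
    by (metis One_nat_def Suc_1 add.commute add_Suc_right add_0_left le_add_diff_inverse less_Suc_eq linorder_not_less numeral_3_eq_3 less_one)
  then show ?case
  proof cases
    case 2
    have "card (S \<inter> {0..<n}) \<le> card {0..<n}" by (intro card_mono) auto
    then show ?thesis using 2 by simp
  next
    case 3
    have "card (S \<inter> {0..<n}) \<le> card {0..<n}" by (intro card_mono) auto
    then show ?thesis using 3 by simp
  next
    case (4 m)
    have "S \<inter> {0..<n} = (S \<inter> {0..<m}) \<union> (S \<inter> {m, Suc m, Suc (Suc m)})" using 4 by auto
    then have "card (S \<inter> {0..<n}) \<le> card (S \<inter> {0..<m}) + card (S \<inter> {m, Suc m, Suc (Suc m)})"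
      by (metis card_Un_le)
    moreover have "card (S \<inter> {m, Suc m, Suc (Suc m)}) < card {m, Suc m, Suc (Suc m)}"
      by (rule psubset_card_mono) (use assms[of m] in auto)
    moreover have "card (S \<inter> {0..<m}) \<le> (2 * m + 2) div 3" using less 4 by simp
    ultimately show ?thesis using 4 by simp
  qed simp
qed

lemma card_ge_two_nbs:
  assumes "a \<in> X" "b \<in> X" "a \<noteq> b" "finite X"
  shows "\<not> card X \<le> 1"
proof -
  have "card {a, b} \<le> card X" using assms by (intro card_mono) auto
  then show ?thesis using assms by simp
qed

lemma dissociation_number_path_graph:
  assumes "1 \<le> n"
  shows "dissociation_number (path_graph n) = (2 * n + 2) div 3"
proof -
  let ?G = "path_graph n"
  interpret conn_graph ?G using conn_path_graph[OF assms] .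
  have V: "pverts ?G = {0..<n}" by (simp add: path_graph_def)
  have "one_degenerate (parcs ?G) {0..<n}" unfolding one_degenerate_def
  proof (intro allI impI)
    fix U assume U: "U \<subseteq> {0..<n}" "U \<noteq> {}"
    then have f: "finite U" by (meson finite_atLeastLessThan finite_subset)
    have "parcs ?G `` {Max U} \<inter> U \<subseteq> {Max U - 1}" using Max_ge[OF f] by (fastforce simp: path_graph_def)
    then have "card (parcs ?G `` {Max U} \<inter> U) \<le> card {Max U - 1}" by (intro card_mono) auto
    then show "\<exists>v\<in>U. card (parcs ?G `` {v} \<inter> U) \<le> 1" using Max_in[OF f U(2)] by auto
  qed
  then obtain S where S: "S \<subseteq> {0..<n}" "dissoc (parcs ?G) S" "2 * n \<le> 3 * card S"
    using dissoc_of_one_degenerate[of "{0..<n}"] by (auto simp: V)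
  show ?thesis
  proof (rule dissociation_numberI[of S])
    show "S \<subseteq> pverts ?G" using S V by simp
    show "\<And>v. v \<in> S \<Longrightarrow> card (parcs ?G `` {v} \<inter> S) \<le> 1" using S by (simp add: dissoc_def)
    show "(2 * n + 2) div 3 \<le> card S" using S by linarith
    fix S assume S: "S \<subseteq> pverts ?G" "\<And>v. v \<in> S \<Longrightarrow> card (parcs ?G `` {v} \<inter> S) \<le> 1"
    have "\<not> (i \<in> S \<and> Suc i \<in> S \<and> Suc (Suc i) \<in> S)" for i
    proof
      assume i: "i \<in> S \<and> Suc i \<in> S \<and> Suc (Suc i) \<in> S"
      have "\<not> card (parcs ?G `` {Suc i} \<inter> S) \<le> 1"
        by (rule card_ge_two_nbs[of i _ "Suc (Suc i)"]) (use i S(1) in \<open>auto simp: path_graph_def\<close>)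
      then show False using S(2) i by blast
    qed
    then have "card (S \<inter> {0..<n}) \<le> (2 * n + 2) div 3" by (rule card_no_three_consecutive)
    moreover have "S \<inter> {0..<n} = S" using S(1) V by auto
    ultimately show "card S \<le> (2 * n + 2) div 3" by simp
  qed
qed

text \<open>Lower bound: without the vertex \<open>n - 1\<close> a path remains, and
  \<open>2 * (n - 1) / 3\<close> rounded up is \<open>2 * n div 3\<close>. Upper bound: among three
  cyclically consecutive vertices at most two belong to \<open>S\<close>, and the \<open>n\<close>
  such triples count every element of \<open>S\<close> three times.\<close>

lemma dissociation_number_cycle_graph:
  assumes "3 \<le> n"
  shows "dissociation_number (cycle_graph n) = 2 * n div 3"
proof -
  let ?G = "cycle_graph n"
  interpret conn_graph ?G using conn_cycle_graph[OF assms] .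
  have V: "pverts ?G = {0..<n}" by (simp add: cycle_graph_def)
  have "one_degenerate (parcs ?G) {0..<n - 1}" unfolding one_degenerate_def
  proof (intro allI impI)
    fix U assume U: "U \<subseteq> {0..<n - 1}" "U \<noteq> {}"
    then have f: "finite U" by (meson finite_atLeastLessThan finite_subset)
    have mU: "Max U \<in> U" using Max_in[OF f U(2)] .
    have "parcs ?G `` {Max U} \<inter> U \<subseteq> {Max U - 1}"
    proof
      fix j assume j: "j \<in> parcs ?G `` {Max U} \<inter> U"
      then have "j \<le> Max U" "j < n - 1" "Max U < n - 1" using Max_ge[OF f] U mU by auto
      then show "j \<in> {Max U - 1}" using j cycle_graph_arc_iff[of "Max U" n j] by auto
    qed
    then have "card (parcs ?G `` {Max U} \<inter> U) \<le> card {Max U - 1}" by (intro card_mono) auto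
    then show "\<exists>v\<in>U. card (parcs ?G `` {v} \<inter> U) \<le> 1" using mU by auto
  qed
  moreover have "{0..<n - 1} \<subseteq> pverts ?G" using V by auto
  ultimately obtain S where S: "S \<subseteq> {0..<n - 1}" "dissoc (parcs ?G) S" "2 * (n - 1) \<le> 3 * card S"
    using dissoc_of_one_degenerate[of "{0..<n - 1}"] by auto
  show ?thesis
  proof (rule dissociation_numberI[of S])
    show "S \<subseteq> pverts ?G" using S V by auto
    show "\<And>v. v \<in> S \<Longrightarrow> card (parcs ?G `` {v} \<inter> S) \<le> 1" using S by (simp add: dissoc_def)
    show "2 * n div 3 \<le> card S" using S assms by linarith
    fix S assume S: "S \<subseteq> pverts ?G" "\<And>v. v \<in> S \<Longrightarrow> card (parcs ?G `` {v} \<inter> S) \<le> 1"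
    define \<sigma> where "\<sigma> = (\<lambda>i. Suc i mod n)"
    have \<sigma>: "\<sigma> i = (if Suc i = n then 0 else Suc i)" if "i < n" for i using that by (simp add: \<sigma>_def)
    have inj: "inj_on \<sigma> {0..<n}" by (auto simp: inj_on_def \<sigma> split: if_splits)
    have "\<sigma> ` {0..<n} \<subseteq> {0..<n}" using assms by (auto simp: \<sigma>)
    then have bij: "bij_betw \<sigma> {0..<n} {0..<n}" using inj by (simp add: bij_betw_def endo_inj_surj)
    have c: "(\<Sum>i\<in>{0..<n}. of_bool (i \<in> S)) = card S"
    proof -
      have "{0..<n} \<inter> {i. i \<in> S} = S" using S(1) V by auto
      then show ?thesis by (simp add: of_bool_def sum.If_cases)
    qed
    have c1: "(\<Sum>i\<in>{0..<n}. of_bool (\<sigma> i \<in> S)) = card S"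
      using sum.reindex_bij_betw[OF bij, of "\<lambda>i. of_bool (i \<in> S) :: nat"] c by simp
    have c2: "(\<Sum>i\<in>{0..<n}. of_bool (\<sigma> (\<sigma> i) \<in> S)) = card S"
      using sum.reindex_bij_betw[OF bij, of "\<lambda>i. of_bool (\<sigma> i \<in> S) :: nat"] c1 by simp
    have "3 * card S = (\<Sum>i\<in>{0..<n}. of_bool (i \<in> S) + of_bool (\<sigma> i \<in> S) + of_bool (\<sigma> (\<sigma> i) \<in> S))"
      unfolding sum.distrib c c1 c2 by simp
    also have "\<dots> \<le> (\<Sum>i\<in>{0..<n}. 2)"
    proof (rule sum_mono)
      fix i assume i: "i \<in> {0..<n}"
      have "\<not> (i \<in> S \<and> \<sigma> i \<in> S \<and> \<sigma> (\<sigma> i) \<in> S)"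
      proof
        assume s: "i \<in> S \<and> \<sigma> i \<in> S \<and> \<sigma> (\<sigma> i) \<in> S"
        have lt: "\<sigma> i < n" "\<sigma> (\<sigma> i) < n" using assms by (auto simp: \<sigma>_def)
        have "\<not> card (parcs ?G `` {\<sigma> i} \<inter> S) \<le> 1"
        proof (rule card_ge_two_nbs[of i _ "\<sigma> (\<sigma> i)"])
          show "i \<noteq> \<sigma> (\<sigma> i)" using i lt assms by (auto simp: \<sigma> split: if_splits)
        qed (use s i lt in \<open>auto simp: cycle_graph_def \<sigma>_def\<close>)
        then show False using S(2) s by blast
      qed
      then show "of_bool (i \<in> S) + of_bool (\<sigma> i \<in> S) + of_bool (\<sigma> (\<sigma> i) \<in> S) \<le> (2::nat)"
        by (auto simp: of_bool_def)
    qed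
    finally show "card S \<le> 2 * n div 3" by simp
  qed
qed

lemma rho_cycle_graph:
  assumes "3 \<le> n"
  shows "rho (cycle_graph n) = 2"
proof -
  let ?G = "cycle_graph n"
  interpret conn_graph ?G using conn_cycle_graph[OF assms] .
  show ?thesis
  proof (rule rho_eq[OF pg V_ne, of "\<lambda>_. 1"])
    fix v assume "v \<in> pverts ?G"
    then have v: "v < n" by (simp add: cycle_graph_def)
    define N where "N = {if v = 0 then n - 1 else v - 1, if Suc v = n then 0 else Suc v}"
    have "j \<in> parcs ?G `` {v} \<longleftrightarrow> j \<in> N" for j
    proof (cases "j < n")
      case True
      then show ?thesis using v assms by (auto simp: cycle_graph_arc_iff[OF v True] N_def)
    next
      case False
      then show ?thesis using v assms by (auto simp: cycle_graph_def N_def)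
    qed
    then have "parcs ?G `` {v} = N" by blast
    then have "card (parcs ?G `` {v}) = 2" using v assms by (auto simp: card_insert_if N_def)
    then show "nsum (parcs ?G) (\<lambda>_. 1) v = 2 * 1" by (simp add: nsum_def)
  qed simp
qed


section \<open>The path minimises the spectral radius\<close>

text \<open>The numerator of \<open>f p + f q - f (p + q)\<close> over its common denominator, for
  \<open>f p = sin p / sin (p + t)\<close>.\<close>

lemma sin_subadditive_identity:
  fixes p q t :: real
  shows "sin p * sin (q + t) * sin (p + q + t) + sin q * sin (p + t) * sin (p + q + t)
           - sin (p + q) * sin (p + t) * sin (q + t)
         = sin (p + q + 2 * t) * sin p * sin q"
proof -
  \<comment> \<open>The addition theorems turn the claim into a polynomial identity in six
    independent variables.\<close>
  have "a * (c * f + d * e) * ((a * d + b * c) * f + (b * d - a * c) * e)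
      + c * (a * f + b * e) * ((a * d + b * c) * f + (b * d - a * c) * e)
      - (a * d + b * c) * (a * f + b * e) * (c * f + d * e)
    = ((a * d + b * c) * (f * f - e * e) + (b * d - a * c) * (2 * (e * f))) * a * c" for a b c d e f :: real
    by (simp add: algebra_simps)
  from this[where a = "sin p" and b = "cos p" and c = "sin q" and d = "cos q" and e = "sin t" and f = "cos t"] show ?thesis
    by (simp add: sin_add cos_add sin_double cos_double power2_eq_square mult.assoc)
qed

lemma sin_ratio_subadditive:
  fixes p q t :: real
  assumes "0 \<le> p" "0 \<le> q" "0 < t" "p + q + 2 * t \<le> pi"
  shows "sin (p + q) / sin (p + q + t) \<le> sin p / sin (p + t) + sin q / sin (q + t)"
    and "0 < p \<Longrightarrow> 0 < q \<Longrightarrow> p + q + 2 * t < pi \<Longrightarrow>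
      sin (p + q) / sin (p + q + t) < sin p / sin (p + t) + sin q / sin (q + t)"
proof -
  have pos: "0 < sin (p + t)" "0 < sin (q + t)" "0 < sin (p + q + t)"
    using assms by (auto intro!: sin_gt_zero)
  have "sin p / sin (p + t) + sin q / sin (q + t) - sin (p + q) / sin (p + q + t)
      = sin (p + q + 2 * t) * sin p * sin q / (sin (p + t) * sin (q + t) * sin (p + q + t))"
    unfolding sin_subadditive_identity[symmetric] using pos by (simp add: field_simps)
  moreover have "0 \<le> sin (p + q + 2 * t) * sin p * sin q"
    using assms by (intro mult_nonneg_nonneg sin_ge_zero) auto
  moreover have "0 < sin (p + q + 2 * t) * sin p * sin q" if "0 < p" "0 < q" "p + q + 2 * t < pi"
    using assms that by (intro mult_pos_pos sin_gt_zero) auto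
  moreover have "0 < sin (p + t) * sin (q + t) * sin (p + q + t)" using pos by simp
  ultimately show "sin (p + q) / sin (p + q + t) \<le> sin p / sin (p + t) + sin q / sin (q + t)"
    and "0 < p \<Longrightarrow> 0 < q \<Longrightarrow> p + q + 2 * t < pi \<Longrightarrow>
      sin (p + q) / sin (p + q + t) < sin p / sin (p + t) + sin q / sin (q + t)"
    by (smt (verit, best) divide_nonneg_pos divide_pos_pos)+
qed

section \<open>Ratios of entries in the Perron vector of a path\<close>

definition path_angle :: "nat \<Rightarrow> real" where
  "path_angle n = pi / (real n + 1)"

text \<open>With \<theta> = \<open>path_angle n\<close>, the path on \<open>n\<close> vertices has
  the Perron vector \<open>sin (j * \<theta>)\<close>, \<open>j = 1, ..., n\<close>; this is the
  quotient of its entries \<open>m\<close> and \<open>m + 1\<close>, the share of \<open>y v\<close>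
  that a path of \<open>m\<close> vertices hanging off \<open>v\<close> returns to
  \<open>v\<close>.\<close>

definition path_ratio :: "nat \<Rightarrow> nat \<Rightarrow> real" where
  "path_ratio n m = sin (real m * path_angle n) / sin (real (Suc m) * path_angle n)"

lemma path_angle: "0 < path_angle n" "(real n + 1) * path_angle n = pi"
  by (auto simp: path_angle_def field_simps intro!: divide_pos_pos)

lemma path_angle_mult: "m \<le> Suc n \<Longrightarrow> real m * path_angle n \<le> pi"
  "m \<le> n \<Longrightarrow> real m * path_angle n < pi"
proof -
  show "real m * path_angle n \<le> pi" if "m \<le> Suc n"
  proof -
    have "real m * path_angle n \<le> (real n + 1) * path_angle n"
      using that path_angle(1)[of n] by (intro mult_right_mono) auto
    then show ?thesis by (simp add: path_angle)
  qed
  show "real m * path_angle n < pi" if "m \<le> n"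
  proof -
    have "real m * path_angle n < (real n + 1) * path_angle n"
      using that path_angle(1)[of n] by (intro mult_strict_right_mono) auto
    then show ?thesis by (simp add: path_angle)
  qed
qed

lemma sin_path_angle_pos: "0 < m \<Longrightarrow> m \<le> n \<Longrightarrow> 0 < sin (real m * path_angle n)"
  using path_angle(1)[of n] path_angle_mult(2)[of m n] by (intro sin_gt_zero) auto

text \<open>For \<open>a + b = n - 1\<close> there is equality, as the factor
  \<open>sin ((a + b + 2) * \<theta>)\<close> becomes the sine of \<pi>. Strictness therefore asks
  for \<open>Suc (a + b) < n\<close>.\<close>

lemma path_ratio_subadditive:
  "a + b < n \<Longrightarrow> path_ratio n (a + b) \<le> path_ratio n a + path_ratio n b"
  "0 < a \<Longrightarrow> 0 < b \<Longrightarrow> Suc (a + b) < n \<Longrightarrow> path_ratio n (a + b) < path_ratio n a + path_ratio n b"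
proof -
  let ?t = "path_angle n"
  have e: "real (a + b) * ?t = real a * ?t + real b * ?t"
     "real (Suc (a + b)) * ?t = real a * ?t + real b * ?t + ?t"
     "real (Suc a) * ?t = real a * ?t + ?t" "real (Suc b) * ?t = real b * ?t + ?t"
     "real (a + b + 2) * ?t = real a * ?t + real b * ?t + 2 * ?t"
    by (simp_all add: algebra_simps)
  note t = path_angle(1)[of n]
  show "path_ratio n (a + b) \<le> path_ratio n a + path_ratio n b" if "a + b < n"
    unfolding path_ratio_def e using t path_angle_mult(1)[of "a + b + 2" n] that
    by (intro sin_ratio_subadditive(1)) (auto simp flip: e(5))
  show "path_ratio n (a + b) < path_ratio n a + path_ratio n b" if "0 < a" "0 < b" "Suc (a + b) < n"
    unfolding path_ratio_def e using t path_angle_mult[of "a + b + 2" n] that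
    by (intro sin_ratio_subadditive(2)) (auto simp flip: e(5))
qed

lemma path_ratio_0: "path_ratio n 0 = 0"
  by (simp add: path_ratio_def)

lemma path_ratio_pos: "0 < m \<Longrightarrow> m < n \<Longrightarrow> 0 < path_ratio n m"
  unfolding path_ratio_def by (intro divide_pos_pos sin_path_angle_pos) auto

text \<open>The recursion \<open>f(m) = 1 / (2 cos \<theta> - f(m - 1))\<close>, from the three-term
  recurrence of the sines.\<close>

lemma path_ratio_rec:
  assumes "0 < m" "m < n"
  shows "path_ratio n m * (2 * cos (path_angle n) - path_ratio n (m - 1)) = 1"
proof -
  let ?t = "path_angle n"
  obtain k where k: "m = Suc k" using assms by (cases m) auto
  have pos: "0 < sin (real (Suc k) * ?t)" "0 < sin (real (Suc (Suc k)) * ?t)"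
    by (rule sin_path_angle_pos, use assms k in simp, use assms k in simp)+
  have "sin (real (Suc (Suc k)) * ?t) + sin (real k * ?t) = 2 * sin (real (Suc k) * ?t) * cos ?t"
    using sin_add[of "real (Suc k) * ?t" ?t] sin_diff[of "real (Suc k) * ?t" ?t] by (simp add: algebra_simps)
  then show ?thesis using pos by (simp add: path_ratio_def k divide_simps) (simp add: algebra_simps)
qed

text \<open>The arguments are the supplements of \<open>2 * \<theta>\<close> and
  \<open>\<theta>\<close>, so the quotient is
  \<open>sin (2 * \<theta>) / sin \<theta>\<close>.\<close>

lemma path_ratio_last: "2 \<le> n \<Longrightarrow> path_ratio n (n - 1) = 2 * cos (path_angle n)"
proof -
  assume n: "2 \<le> n"
  let ?t = "path_angle n"
  have "real n * ?t = pi - ?t" using path_angle(2)[of n] by (simp add: algebra_simps)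
  moreover have "real (n - 1) * ?t = pi - 2 * ?t"
    using path_angle(2)[of n] n by (simp add: of_nat_diff algebra_simps)
  ultimately show ?thesis
    using n sin_path_angle_pos[of 1 n] by (simp add: path_ratio_def sin_double)
qed

lemma cos_path_angle_less: "cos (path_angle n) < 1"
proof -
  have "path_angle n \<le> pi" using path_angle_mult(1)[of 1 n] by simp
  then have "cos (path_angle n) < cos 0" using path_angle(1)[of n] by (intro cos_monotone_0_pi) auto
  then show ?thesis by simp
qed

lemma rho_path_graph:
  assumes "1 \<le> n"
  shows "rho (path_graph n) = 2 * cos (path_angle n)"
proof -
  let ?G = "path_graph n"
  interpret conn_graph ?G using conn_path_graph[OF assms] .
  \<comment> \<open>The sine vanishes at the positions 0 and \<open>n + 1\<close> just beyond the
    ends, so the recurrence also holds at the end vertices.\<close>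
  define y where "y = (\<lambda>i. sin (real (Suc i) * path_angle n))"
  show ?thesis
  proof (rule rho_eq[OF pg V_ne, of y])
    fix v assume "v \<in> pverts ?G"
    then have v: "v < n" by (simp add: path_graph_def)
    show "0 < y v" unfolding y_def using v by (intro sin_path_angle_pos) auto
    have N: "parcs ?G `` {v} = (if v = 0 then {} else {v - 1}) \<union> (if Suc v = n then {} else {Suc v})"
      using v by (auto simp: path_graph_def)
    have l: "(if v = 0 then 0 else y (v - 1)) = sin (real v * path_angle n)"
      by (cases v) (simp_all add: y_def)
    have r: "(if Suc v = n then 0 else y (Suc v)) = sin (real (Suc (Suc v)) * path_angle n)"
      using path_angle(2)[of n] by (auto simp: y_def algebra_simps)
    have "nsum (parcs ?G) y v = (if v = 0 then 0 else y (v - 1)) + (if Suc v = n then 0 else y (Suc v))"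
      unfolding nsum_def N by (cases "v = 0"; cases "Suc v = n") (simp_all add: sum.insert_if)
    also have "\<dots> = 2 * cos (path_angle n) * y v"
      unfolding l r unfolding y_def
      using sin_add[of "real (Suc v) * path_angle n" "path_angle n"]
        sin_diff[of "real (Suc v) * path_angle n" "path_angle n"] by (simp add: algebra_simps)
    finally show "nsum (parcs ?G) y v = 2 * cos (path_angle n) * y v" .
  qed
qed

section \<open>Branches hanging off a vertex\<close>

context cgraph
begin

text \<open>Every vertex of \<open>B\<close> is joined to \<open>v\<close> by a walk inside \<open>B \<union> {v}\<close>, again expressed by cuts.\<close>

definition branch_conn :: "'a \<Rightarrow> 'a set \<Rightarrow> bool" where
  "branch_conn v B \<longleftrightarrow> (\<forall>U\<subseteq>B. U \<noteq> {} \<longrightarrow> (\<exists>u\<in>U. \<exists>w\<in>insert v (B - U). (u, w) \<in> E))"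

text \<open>\<open>C\<close> is the component of \<open>B\<close> that contains a neighbour
  \<open>r\<close> of \<open>v\<close>; the rest of \<open>C\<close> hangs off \<open>r\<close>, and
  the other components still hang off \<open>v\<close>. Both pieces are smaller, which drives the
  induction in \<open>branch_bound\<close>.\<close>

lemma branch_split:
  assumes B: "B \<subseteq> V" "v \<notin> B" "B \<noteq> {}" and c: "branch_conn v B"
  obtains r C where "r \<in> C" "C \<subseteq> B" "(v, r) \<in> E" "branch_conn r (C - {r})" "branch_conn v (B - C)"
proof -
  obtain r where r: "r \<in> B" "(v, r) \<in> E"
    using c B(3) symE unfolding branch_conn_def by (metis Diff_cancel insertE empty_iff subset_refl)
  define R where "R = E \<inter> B \<times> B"
  define C where "C = R\<^sup>* `` {r}"
  have rC: "r \<in> C" by (simp add: C_def)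
  have step: "y \<in> C" if "x \<in> C" "(x, y) \<in> E" "y \<in> B" "x \<in> B" for x y
    using that by (auto simp: C_def R_def intro: rtrancl_into_rtrancl)
  have CB: "C \<subseteq> B"
  proof -
    have "(r, x) \<in> R\<^sup>* \<Longrightarrow> x \<in> B" for x by (induction rule: rtrancl_induct) (use r in \<open>auto simp: R_def\<close>)
    then show ?thesis by (auto simp: C_def)
  qed
  show thesis
  proof (rule that[OF rC CB r(2)])
    show "branch_conn r (C - {r})" unfolding branch_conn_def
    proof (intro allI impI)
      fix U assume U: "U \<subseteq> C - {r}" "U \<noteq> {}"
      show "\<exists>u\<in>U. \<exists>w\<in>insert r (C - {r} - U). (u, w) \<in> E"
      proof (rule ccontr)
        assume n: "\<not> (\<exists>u\<in>U. \<exists>w\<in>insert r (C - {r} - U). (u, w) \<in> E)"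
        have "(r, x) \<in> R\<^sup>* \<Longrightarrow> x \<notin> U" for x
        proof (induction rule: rtrancl_induct)
          case base then show ?case using U by auto
        next
          case (step x y)
          have "x \<in> C" using step by (simp add: C_def)
          moreover have "(y, x) \<in> E" using step symE by (auto simp: R_def)
          ultimately show ?case using n step.IH by blast
        qed
        then show False using U by (auto simp: C_def)
      qed
    qed
    show "branch_conn v (B - C)" unfolding branch_conn_def
    proof (intro allI impI)
      fix U assume U: "U \<subseteq> B - C" "U \<noteq> {}"
      then obtain u w where uw: "u \<in> U" "w \<in> insert v (B - U)" "(u, w) \<in> E"
        using c unfolding branch_conn_def by (metis Diff_subset order_trans)
      have "w \<notin> C" using step[of w u] symE[OF uw(3)] uw U CB by auto
      then show "\<exists>u\<in>U. \<exists>w\<in>insert v (B - C - U). (u, w) \<in> E" using uw by blast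
    qed
  qed
qed

end

locale path_bounded = cgraph V E for V :: "'a set" and E +
  fixes y :: "'a \<Rightarrow> real" and n :: nat
  assumes n: "card V = n" "2 \<le> n"
    and ypos: "\<And>v. v \<in> V \<Longrightarrow> 0 < y v"
    and super: "\<And>v. v \<in> V \<Longrightarrow> nsum E y v \<le> 2 * cos (path_angle n) * y v"
begin

lemma sum_nb_mono: "X \<subseteq> Y \<Longrightarrow> Y \<subseteq> V \<Longrightarrow> sum y X \<le> sum y Y"
  using fin ypos by (intro sum_mono2) (auto intro: finite_subset less_imp_le)

text \<open>\<open>C\<close> hangs off \<open>v\<close> through \<open>r\<close>. The inequality at
  \<open>r\<close> gives \<open>y v + f(c - 1) * y r \<le> 2 cos \<theta> * y r\<close> with
  \<open>c = card C\<close>, and \<open>path_ratio_rec\<close> solves it for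
  \<open>y r\<close>.\<close>

lemma root_bound:
  assumes C: "C \<subseteq> V" "v \<in> V" "v \<notin> C" "r \<in> C" "(v, r) \<in> E"
    and IH: "path_ratio n (card (C - {r})) * y r \<le> sum y (E `` {r} \<inter> (C - {r}))"
  shows "path_ratio n (card C) * y v \<le> y r"
proof -
  have finC: "finite C" using C fin by (meson finite_subset)
  have b: "0 < card C" using C(4) finC by (auto simp: card_gt_0_iff)
  have "card C < card V" using C fin by (intro psubset_card_mono) auto
  then have bn: "card C < n" using n by simp
  have "y v + sum y (E `` {r} \<inter> (C - {r})) = sum y (insert v (E `` {r} \<inter> (C - {r})))"
    using C finC by simp
  also have "\<dots> \<le> nsum E y r" unfolding nsum_def
    using C symE nb_sub by (intro sum_nb_mono) auto
  also have "\<dots> \<le> 2 * cos (path_angle n) * y r" using super C by auto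
  finally have "y v \<le> (2 * cos (path_angle n) - path_ratio n (card C - 1)) * y r"
    using IH C(4) finC by (simp add: algebra_simps)
  then have "path_ratio n (card C) * y v
      \<le> path_ratio n (card C) * ((2 * cos (path_angle n) - path_ratio n (card C - 1)) * y r)"
    using path_ratio_pos[OF b bn] by (intro mult_left_mono) auto
  also have "\<dots> = y r" using path_ratio_rec[OF b bn] by (simp flip: mult.assoc)
  finally show ?thesis .
qed

text \<open>Induction over \<open>branch_split\<close>: the pieces contribute at least
  \<open>f(card C) * y v\<close> and \<open>f(card (B - C)) * y v\<close>, and subadditivity joins
  them. With two neighbours in \<open>B\<close> the bound is strict: either a second neighbour in
  \<open>C\<close> was not counted, or \<open>B - C\<close> is nonempty and subadditivity is
  strict.\<close>

lemma branch_bound: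
  assumes "B \<subseteq> V" "v \<in> V" "v \<notin> B" "branch_conn v B"
  shows "path_ratio n (card B) * y v \<le> sum y (E `` {v} \<inter> B) \<and>
    (Suc (card B) < n \<longrightarrow> 2 \<le> card (E `` {v} \<inter> B) \<longrightarrow> path_ratio n (card B) * y v < sum y (E `` {v} \<inter> B))"
proof -
  have "finite B" using assms fin by (meson finite_subset)
  then show ?thesis using assms
  proof (induction arbitrary: v rule: finite_psubset_induct)
    case (psubset B)
    show ?case
    proof (cases "B = {}")
      case True
      then show ?thesis by (simp add: path_ratio_0)
    next
      case False
      then obtain r C where rC: "r \<in> C" "C \<subseteq> B" "(v, r) \<in> E" "branch_conn r (C - {r})" "branch_conn v (B - C)"
        using branch_split psubset.prems by metis
      have finC: "finite C" using rC psubset.hyps by (meson finite_subset)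
      have 1: "path_ratio n (card (C - {r})) * y r \<le> sum y (E `` {r} \<inter> (C - {r}))"
        using psubset.IH[of "C - {r}" r] rC psubset.prems by auto
      have yr: "path_ratio n (card C) * y v \<le> y r"
        by (rule root_bound[OF _ _ _ _ _ 1]) (use rC psubset.prems in auto)
      have 2: "path_ratio n (card (B - C)) * y v \<le> sum y (E `` {v} \<inter> (B - C))"
        using psubset.IH[of "B - C" v] rC psubset.prems by auto
      have cB: "card B = card C + card (B - C)"
        using rC finC psubset.hyps by (metis card_Diff_subset card_mono le_add_diff_inverse)
      have "card B < card V" using psubset.prems fin by (intro psubset_card_mono) auto
      then have Bn: "card B < n" using n by simp
      have yv: "0 < y v" using ypos psubset.prems by simp
      have sub: "path_ratio n (card B) * y v \<le> path_ratio n (card C) * y v + path_ratio n (card (B - C)) * y v"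
        using path_ratio_subadditive(1)[of "card C" "card (B - C)" n] Bn cB yv
        by (metis distrib_right less_imp_le mult_right_mono)
      define X where "X = E `` {v} \<inter> (C - {r})"
      have split: "sum y (E `` {v} \<inter> B) = y r + sum y X + sum y (E `` {v} \<inter> (B - C))"
      proof -
        have "E `` {v} \<inter> B = insert r (X \<union> (E `` {v} \<inter> (B - C)))" using rC by (auto simp: X_def)
        moreover have "r \<notin> X \<union> (E `` {v} \<inter> (B - C))" using rC by (auto simp: X_def)
        moreover have "sum y (X \<union> (E `` {v} \<inter> (B - C))) = sum y X + sum y (E `` {v} \<inter> (B - C))"
          by (rule sum.union_disjoint) (auto simp: X_def)
        ultimately show ?thesis by (simp add: X_def)
      qed
      have X0: "0 \<le> sum y X" using ypos psubset.prems rC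
        by (intro sum_nonneg) (auto simp: X_def intro!: less_imp_le)
      have "path_ratio n (card B) * y v < sum y (E `` {v} \<inter> B)"
        if big: "Suc (card B) < n" "2 \<le> card (E `` {v} \<inter> B)"
      proof (cases "X = {}")
        case False
        then have "0 < sum y X" using ypos psubset.prems rC by (intro sum_pos) (auto simp: X_def)
        then show ?thesis using sub yr 2 split by linarith
      next
        case True
        have "E `` {v} \<inter> B = insert r (E `` {v} \<inter> (B - C))" using True rC by (auto simp: X_def)
        then have "B - C \<noteq> {}" using big(2) by (metis Int_empty_right One_nat_def Suc_1 card.empty card.insert finite.emptyI
              empty_iff not_less_eq_eq le_refl)
        then have "0 < card (B - C)" using psubset.hyps by (simp add: card_gt_0_iff)
        moreover have "0 < card C" using rC finC by (auto simp: card_gt_0_iff)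
        ultimately have "path_ratio n (card B) < path_ratio n (card C) + path_ratio n (card (B - C))"
          using path_ratio_subadditive(2)[of "card C" "card (B - C)" n] big(1) cB by simp
        then have "path_ratio n (card B) * y v < (path_ratio n (card C) + path_ratio n (card (B - C))) * y v"
          using yv by simp
        then show ?thesis using yr 2 split X0 by (simp add: distrib_right)
      qed
      then show ?thesis using sub yr 2 split X0 by linarith
    qed
  qed
qed

text \<open>All of \<open>V - {v}\<close> has size \<open>n - 1\<close>, where subadditivity is an
  equality. Strictness is found one level deeper: after splitting off \<open>C\<close>, either
  another neighbour of \<open>v\<close> in \<open>C\<close> was not counted, or \<open>B - C\<close>
  contains two neighbours and \<open>branch_bound\<close> is strict for it.\<close>

lemma degree_le_2:
  assumes v: "v \<in> V"
  shows "card (E `` {v}) \<le> 2"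
proof (rule ccontr)
  assume deg: "\<not> card (E `` {v}) \<le> 2"
  define B where "B = V - {v}"
  have NB: "E `` {v} \<inter> B = E `` {v}" using sub irr by (auto simp: B_def)
  have cB: "card B = n - 1" using v n fin by (simp add: B_def)
  have bc: "branch_conn v B" unfolding branch_conn_def
  proof (intro allI impI, rule ccontr)
    fix U assume U: "U \<subseteq> B" "U \<noteq> {}" "\<not> (\<exists>u\<in>U. \<exists>w\<in>insert v (B - U). (u, w) \<in> E)"
    have "U = V" by (rule closed_eq) (use U sub in \<open>auto simp: B_def\<close>)
    then show False using U v by (auto simp: B_def)
  qed
  have "0 < card B" using cB n by simp
  then have "B \<noteq> {}" by auto
  then have BV: "B \<subseteq> V" "v \<notin> B" "B \<noteq> {}" by (auto simp: B_def)
  obtain r C where rC: "r \<in> C" "C \<subseteq> B" "(v, r) \<in> E" "branch_conn r (C - {r})" "branch_conn v (B - C)"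
    using branch_split[OF BV bc] by metis
  have finB: "finite B" "finite C" using BV rC fin by (meson finite_subset)+
  have 1: "path_ratio n (card (C - {r})) * y r \<le> sum y (E `` {r} \<inter> (C - {r}))"
    using branch_bound[of "C - {r}" r] rC BV by auto
  have yr: "path_ratio n (card C) * y v \<le> y r"
    by (rule root_bound[OF _ _ _ _ _ 1]) (use rC BV v in auto)
  have 2: "path_ratio n (card (B - C)) * y v \<le> sum y (E `` {v} \<inter> (B - C))"
    and 3: "Suc (card (B - C)) < n \<Longrightarrow> 2 \<le> card (E `` {v} \<inter> (B - C)) \<Longrightarrow>
      path_ratio n (card (B - C)) * y v < sum y (E `` {v} \<inter> (B - C))"
    using branch_bound[of "B - C" v] rC BV v by auto
  have cs: "card B = card C + card (B - C)" "0 < card C"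
    using rC finB by (metis card_Diff_subset card_mono le_add_diff_inverse, auto simp: card_gt_0_iff)
  have yv: "0 < y v" using ypos v by simp
  have sb: "2 * cos (path_angle n) * y v \<le> path_ratio n (card C) * y v + path_ratio n (card (B - C)) * y v"
    using path_ratio_subadditive(1)[of "card C" "card (B - C)" n] cs cB n yv path_ratio_last[OF n(2)]
    by (metis One_nat_def Suc_le_lessD distrib_right less_imp_le mult_right_mono Suc_1 Suc_pred diff_Suc_less lessI less_le_trans)
  define X where "X = E `` {v} \<inter> (C - {r})"
  have dec: "E `` {v} = insert r (X \<union> (E `` {v} \<inter> (B - C)))" using rC NB by (auto simp: X_def)
  have rX: "r \<notin> X \<union> (E `` {v} \<inter> (B - C))" using rC by (auto simp: X_def)
  have "sum y (X \<union> (E `` {v} \<inter> (B - C))) = sum y X + sum y (E `` {v} \<inter> (B - C))"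
    by (rule sum.union_disjoint) (auto simp: X_def)
  then have split: "nsum E y v = y r + sum y X + sum y (E `` {v} \<inter> (B - C))"
    unfolding nsum_def using rX by (subst dec) (simp add: X_def)
  have le: "nsum E y v \<le> 2 * cos (path_angle n) * y v" using super v by simp
  show False
  proof (cases "X = {}")
    case False
    then have "0 < sum y X" using ypos BV rC by (intro sum_pos) (auto simp: X_def)
    then show ?thesis using sb yr 2 split le by linarith
  next
    case True
    then have "card (E `` {v}) = Suc (card (E `` {v} \<inter> (B - C)))"
      using rX by (subst dec) (simp add: X_def)
    then have "2 \<le> card (E `` {v} \<inter> (B - C))" using deg by linarith
    moreover have "Suc (card (B - C)) < n" using cs cB n by linarith
    ultimately show ?thesis using 3 sb yr split le True by simp
  qed
qed

end

lemma (in conn_graph) path_if_rho_le: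
  assumes n: "card (pverts G) = n" "2 \<le> n" and le: "rho G \<le> rho (path_graph n)"
  shows "graph_iso G (path_graph n)"
proof -
  obtain y where y: "\<And>v. v \<in> pverts G \<Longrightarrow> 0 < y v" "\<And>v. v \<in> pverts G \<Longrightarrow> nsum (parcs G) y v = rho G * y v"
    by (rule perron_rho) blast
  have le2: "rho G \<le> 2 * cos (path_angle n)" using le rho_path_graph[of n] n by simp
  have super: "nsum (parcs G) y v \<le> 2 * cos (path_angle n) * y v" if "v \<in> pverts G" for v
    using y[OF that] le2 by (simp add: mult_right_mono)
  interpret path_bounded "pverts G" "parcs G" y n
    by unfold_locales (use n y super in auto)
  \<comment> \<open>Were all degrees at least 2, the constant test vector would give
    \<open>rho G \<ge> 2 > 2 * cos (path_angle n)\<close>.\<close>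
  have "\<exists>v\<in>pverts G. card (parcs G `` {v}) \<le> 1"
  proof (rule ccontr)
    assume "\<not> ?thesis"
    then have "2 * 1 \<le> nsum (parcs G) (\<lambda>_. 1) v" if "v \<in> pverts G" for v
      using that by (force simp: nsum_def)
    moreover obtain u where "u \<in> pverts G" using V_ne by auto
    ultimately have "2 \<le> rho G" using rho_lower_test(1)[of "\<lambda>_. 1" 2 u] by simp
    then show False using le2 cos_path_angle_less[of n] by simp
  qed
  then show ?thesis using iso_path_graph degree_le_2 n(1) by blast
qed


section \<open>The inequality between two hubs\<close>

lemma four_mult_le_square_sum:
  fixes a b :: real
  shows "4 * (a * b) \<le> (a + b)\<^sup>2"
proof -
  have "(a + b)\<^sup>2 - 4 * (a * b) = (a - b)\<^sup>2" by (simp add: power2_eq_square algebra_simps)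
  then show ?thesis by (metis diff_ge_0_iff_ge zero_le_power2)
qed

lemma le_of_add_nonneg: "a + b = c \<Longrightarrow> 0 \<le> b \<Longrightarrow> a \<le> c" for a b c :: real
  by linarith

lemma le_of_double_le: "2 * a \<le> 2 * b + 1 \<Longrightarrow> a \<le> b" for a b :: nat
  by presburger

lemma le_Suc_of_double_le: "2 * a \<le> 2 * b + 3 \<Longrightarrow> a \<le> b + 1" for a b :: nat
  by presburger

text \<open>
  The Perron equation of \<open>H(n)\<close> for \<open>x = \<rho>\<^sup>2\<close>, with \<open>p\<close> branch edges at \<open>a\<close>, and \<open>q\<close> branch edges and \<open>r\<close>
  leaves at \<open>d\<close>.  The assumption \<open>p \<ge> 2\<close>, which yields \<open>x > 4\<close>, is where \<open>n \<ge> 10\<close> enters.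
\<close>

locale broom_equation =
  fixes p q r :: nat and x s :: real
  assumes pq: "q \<le> p" "p \<le> Suc q" "2 \<le> p" and r: "r \<le> 1"
    and x: "1 < x" and s: "s = x / (x - 1)"
    and pos: "0 < x - (real p + 1) * s"
    and eq: "(x - (real p + 1) * s) * (x - real r - (real q + 1) * s) = s\<^sup>2 / x"
begin

lemma s_gt_1: "1 < s" using x by (simp add: s)

text \<open>From \<open>3 * s \<le> (p + 1) * s < x\<close>; the resulting bound
  \<open>s < 4 / 3\<close> is behind all numerical estimates below.\<close>

lemma x_gt_4: "4 < x"
proof -
  have "3 * s \<le> (real p + 1) * s" using pq(3) s_gt_1 by (intro mult_right_mono) auto
  then have "3 * s < x" using pos by linarith
  then have "3 * x < x * (x - 1)" using x by (simp add: s divide_less_eq)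
  then have "x * 3 < x * (x - 1)" by (simp add: mult.commute)
  then show ?thesis using x by (simp add: mult_less_cancel_left)
qed

lemma s_less: "s < 4 / 3" using x_gt_4 by (simp add: s divide_less_eq)

text \<open>Equivalent to \<open>s / x = s - 1\<close>; it makes the right-hand side of the broom
  equation a polynomial in \<open>s\<close>.\<close>

lemma s_sq: "s\<^sup>2 / x = s\<^sup>2 - s"
proof -
  have "s * (x - 1) = x" using x by (simp add: s)
  then have "s = (s - 1) * x" by (simp add: algebra_simps)
  then have "s / x = s - 1" using x by (simp add: divide_eq_eq)
  moreover have "s\<^sup>2 / x = s * (s / x)" by (simp add: power2_eq_square)
  ultimately show ?thesis by (simp add: power2_eq_square right_diff_distrib)
qed

text \<open>The sum of the two factors in the broom equation; its square is four times their product
  plus their squared difference.\<close>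

definition S :: real where "S = 2 * x - real r - (real p + real q + 2) * s"

lemma S_sq: "S\<^sup>2 = 4 * (s\<^sup>2 - s) + ((real p - real q) * s - real r)\<^sup>2"
proof -
  have "S\<^sup>2 = 4 * ((x - (real p + 1) * s) * (x - real r - (real q + 1) * s)) + ((real p - real q) * s - real r)\<^sup>2"
    by (simp add: S_def power2_eq_square algebra_simps)
  then show ?thesis by (simp add: eq s_sq)
qed

lemma pq_cases: "p = q \<or> p = Suc q" using pq by linarith

lemma r_cases: "r = 0 \<or> r = 1" using r by linarith

text \<open>The difference \<open>(p - q) * s - r\<close> can only be 0, \<open>s\<close>,
  \<open>-1\<close> or \<open>s - 1\<close>.\<close>

lemma diff_sq_le: "((real p - real q) * s - real r)\<^sup>2 \<le> s\<^sup>2"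
  and diff_sq_le_1: "r = 1 \<Longrightarrow> ((real p - real q) * s - real r)\<^sup>2 \<le> 1"
proof -
  have "1 \<le> s\<^sup>2" using s_gt_1 by (simp add: one_le_power)
  moreover have "(s - 1)\<^sup>2 \<le> 1\<^sup>2" using s_gt_1 s_less by (intro power_mono) auto
  ultimately show "((real p - real q) * s - real r)\<^sup>2 \<le> s\<^sup>2"
    and "r = 1 \<Longrightarrow> ((real p - real q) * s - real r)\<^sup>2 \<le> 1"
    using pq_cases r_cases by (auto simp: power2_eq_square)
qed

lemma S_sq_le: "S\<^sup>2 \<le> s * (5 * s - 4)"
proof -
  have "S\<^sup>2 \<le> 4 * (s\<^sup>2 - s) + s\<^sup>2" unfolding S_sq using diff_sq_le by (rule add_left_mono)
  also have "\<dots> = s * (5 * s - 4)" by (simp add: power2_eq_square algebra_simps)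
  finally show ?thesis .
qed

lemma S_less: "S < 19 / 10"
proof -
  have "S\<^sup>2 \<le> s * (5 * s - 4)" by (rule S_sq_le)
  \<comment> \<open>The bound increases with \<open>s\<close>, and its value at 4/3 is 32/9, just
    below 3.61; hence the constant 19/10.\<close>
  also have "\<dots> \<le> 4 / 3 * (5 * (4 / 3) - 4)" using s_gt_1 s_less by (intro mult_mono) auto
  also have "\<dots> < (19 / 10)\<^sup>2" by (simp add: power2_eq_square)
  finally show ?thesis by (rule power2_less_imp_less) simp
qed

text \<open>For \<open>r = 1\<close> the squared difference is at most 1, which completes
  \<open>4 * (s\<^sup>2 - s)\<close> to the square of \<open>2 * s - 1\<close>.\<close>

lemma S_le_r1: "r = 1 \<Longrightarrow> S \<le> 2 * s - 1"
proof -
  assume r1: "r = 1"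
  have "S\<^sup>2 \<le> 4 * (s\<^sup>2 - s) + 1" unfolding S_sq using diff_sq_le_1[OF r1] by (rule add_left_mono)
  also have "\<dots> = (2 * s - 1)\<^sup>2" by (simp add: power2_diff power_mult_distrib)
  finally have "S\<^sup>2 \<le> (2 * s - 1)\<^sup>2" .
  then show ?thesis by (rule power2_le_imp_le) (use s_gt_1 in simp)
qed

lemma S_less_2s: "S < 2 * s"
proof -
  have "S\<^sup>2 < (2 * s)\<^sup>2"
  proof -
    have "S\<^sup>2 \<le> s * (5 * s - 4)" by (rule S_sq_le)
    also have "\<dots> < s * (4 * s)" using s_gt_1 s_less by (intro mult_strict_left_mono) auto
    finally show ?thesis by (simp add: power2_eq_square)
  qed
  then show ?thesis by (rule power2_less_imp_less) (use s_gt_1 in simp)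
qed

text \<open>AM-GM gives \<open>T \<ge> 4\<close> because \<open>x \<ge> 4\<close>, while the order
  of the graph gives \<open>T \<le> S + s < 4\<close>.\<close>

lemma adjacent_hubs_impossible:
  assumes n: "2 + r1 + r2 + 2 * (t1 + t2) = 4 + r + 2 * (p + q)"
    and a: "0 < x - real r1 - real t1 * s" "0 < x - real r2 - real t2 * s"
    and ab: "x \<le> (x - real r1 - real t1 * s) * (x - real r2 - real t2 * s)"
  shows False
proof -
  define T where "T = (x - real r1 - real t1 * s) + (x - real r2 - real t2 * s)"
  have "2\<^sup>2 \<le> x" using x_gt_4 by simp
  then have "4\<^sup>2 \<le> 4 * x" by simp
  also have "\<dots> \<le> T\<^sup>2" using four_mult_le_square_sum[of "x - real r1 - real t1 * s" "x - real r2 - real t2 * s"] ab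
    unfolding T_def by linarith
  finally have T: "4 \<le> T" by (rule power2_le_imp_le[of 4 T]) (use a in \<open>simp add: T_def\<close>)
  \<comment> \<open>\<open>j\<close> counts the branch edges missing compared with
    \<open>H(n)\<close>. Each is made up for by two leaves and lowers the sum by
    \<open>2 - s\<close>. The path in \<open>H(n)\<close> has two vertices more than the pair of
    hubs, so \<open>j = -1\<close> can occur.\<close>
  define j where "j = real p + real q - real t1 - real t2"
  have e: "real r1 + real r2 = real r + 2 + 2 * j"
    using arg_cong[OF n, of real] by (simp add: j_def algebra_simps)
  have j: "-1 \<le> j"
  proof -
    have "t1 + t2 \<le> p + q + 1" using n r by - (rule le_Suc_of_double_le, linarith)
    then show ?thesis unfolding j_def by linarith
  qed
  have "T = S - 2 + 2 * s - j * (2 - s)"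
  proof -
    have "real r1 = real r + 2 + 2 * j - real r2" using e by linarith
    then show ?thesis unfolding T_def S_def j_def by (simp add: algebra_simps)
  qed
  then have "T + (j + 1) * (2 - s) = S + s" by (simp add: algebra_simps)
  moreover have "0 \<le> (j + 1) * (2 - s)" using j s_less by (intro mult_nonneg_nonneg) auto
  ultimately have "T \<le> S + s" by (rule le_of_add_nonneg)
  then show False using T S_less s_less by linarith
qed

text \<open>AM-GM gives \<open>T \<ge> 2\<close>. For \<open>r = 0\<close> no branch edge can be
  gained and \<open>T \<le> S + 2 * s - 3\<close>; for \<open>r = 1\<close> one can, and refuting
  \<open>T \<le> S + s - 1\<close> takes the sharper bound \<open>S \<le> 2 * s - 1\<close>.\<close>

lemma common_leaf_impossible:
  assumes n: "3 + r1 + r2 + 2 * (t1 + t2) = 4 + r + 2 * (p + q)"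
    and a: "0 < x - real r1 - real t1 * s - 1" "0 < x - real r2 - real t2 * s - 1"
    and ab: "1 \<le> (x - real r1 - real t1 * s - 1) * (x - real r2 - real t2 * s - 1)"
  shows False
proof -
  define T where "T = (x - real r1 - real t1 * s - 1) + (x - real r2 - real t2 * s - 1)"
  have "2\<^sup>2 \<le> T\<^sup>2" using four_mult_le_square_sum[of "x - real r1 - real t1 * s - 1" "x - real r2 - real t2 * s - 1"] ab
    unfolding T_def by simp
  then have T: "2 \<le> T" by (rule power2_le_imp_le[of 2 T]) (use a in \<open>simp add: T_def\<close>)
  define j where "j = real p + real q - real t1 - real t2"
  have e: "real r1 + real r2 = real r + 1 + 2 * j"
    using arg_cong[OF n, of real] by (simp add: j_def algebra_simps)
  have TS: "T = S + 2 * s - 3 - j * (2 - s)"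
  proof -
    have "real r1 = real r + 1 + 2 * j - real r2" using e by linarith
    then show ?thesis unfolding T_def S_def j_def by (simp add: algebra_simps)
  qed
  show False using r_cases
  proof
    assume "r = 0"
    then have "t1 + t2 \<le> p + q" using n by - (rule le_of_double_le, linarith)
    then have "0 \<le> j" unfolding j_def by linarith
    then have "0 \<le> j * (2 - s)" using s_less by simp
    moreover have "T + j * (2 - s) = S + 2 * s - 3" using TS by (rule eq_diff_eq[THEN iffD1])
    ultimately have "T \<le> S + 2 * s - 3" by (rule le_of_add_nonneg[rotated])
    then show False using T S_less s_less by linarith
  next
    assume r1: "r = 1"
    have "t1 + t2 \<le> p + q + 1" using n r by - (rule le_Suc_of_double_le, linarith)
    then have "-1 \<le> j" unfolding j_def by linarith
    then have nn: "0 \<le> (j + 1) * (2 - s)" using s_less by (intro mult_nonneg_nonneg) auto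
    have "T + (j + 1) * (2 - s) = S + s - 1" using TS by (simp add: algebra_simps)
    then have "T \<le> S + s - 1" using nn by (rule le_of_add_nonneg)
    then show False using T S_le_r1[OF r1] s_less by linarith
  qed
qed

text \<open>Hubs and link have four vertices, as in \<open>H(n)\<close>, so no branch edge can be
  gained and \<open>j\<close> is a natural number.\<close>

lemma inner_sum:
  assumes n: "4 + r1 + r2 + 2 * (t1 + t2) = 4 + r + 2 * (p + q)"
  defines "j \<equiv> p + q - t1 - t2"
  shows "t1 + t2 + j = p + q" "r1 + r2 = r + 2 * j"
    "(x - real r1 - (real t1 + 1) * s) + (x - real r2 - (real t2 + 1) * s) = S - real j * (2 - s)"
proof -
  have "t1 + t2 \<le> p + q" using n r by - (rule le_of_double_le, linarith)
  then show 1: "t1 + t2 + j = p + q" by (simp add: j_def)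
  then show 2: "r1 + r2 = r + 2 * j" using n by simp
  have e: "real p = real t1 + real t2 + real j - real q" "real r1 = real r + 2 * real j - real r2"
    using 1 2 by linarith+
  show "(x - real r1 - (real t1 + 1) * s) + (x - real r2 - (real t2 + 1) * s) = S - real j * (2 - s)"
    unfolding S_def e by (simp add: algebra_simps)
qed

text \<open>AM-GM gives \<open>T \<ge> 2 * s\<close>, but \<open>T \<le> S < 2 * s\<close>.\<close>

lemma common_pendant_impossible:
  assumes n: "4 + r1 + r2 + 2 * (t1 + t2) = 4 + r + 2 * (p + q)"
    and a: "0 < x - real r1 - (real t1 + 1) * s" "0 < x - real r2 - (real t2 + 1) * s"
    and ab: "s\<^sup>2 \<le> (x - real r1 - (real t1 + 1) * s) * (x - real r2 - (real t2 + 1) * s)"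
  shows False
proof -
  define j where "j = p + q - t1 - t2"
  have j: "(x - real r1 - (real t1 + 1) * s) + (x - real r2 - (real t2 + 1) * s) = S - real j * (2 - s)"
    unfolding j_def by (rule inner_sum(3)[OF n])
  define T where "T = (x - real r1 - (real t1 + 1) * s) + (x - real r2 - (real t2 + 1) * s)"
  have "(2 * s)\<^sup>2 \<le> T\<^sup>2"
    using four_mult_le_square_sum[of "x - real r1 - (real t1 + 1) * s" "x - real r2 - (real t2 + 1) * s"] ab
    unfolding T_def by (simp add: power_mult_distrib)
  then have T: "2 * s \<le> T" by (rule power2_le_imp_le[of "2 * s" T]) (use a in \<open>simp add: T_def\<close>)
  have "0 \<le> real j * (2 - s)" using s_less by simp
  moreover have "T + real j * (2 - s) = S" using j unfolding T_def by (rule eq_diff_eq[THEN iffD1])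
  ultimately have "T \<le> S" by (rule le_of_add_nonneg[rotated])
  then show False using T S_less_2s by linarith
qed

text \<open>The link of \<open>H(n)\<close> itself. A missing branch edge would lower the sum too
  far for the product, so \<open>j = 0\<close>. The sums then agree, a product at least as large
  means a difference at most as large, and the parity of \<open>t1 + t2\<close> leaves the
  parameters of \<open>H(n)\<close> and their mirror image.\<close>

lemma path_hubs_unique:
  assumes n: "4 + r1 + r2 + 2 * (t1 + t2) = 4 + r + 2 * (p + q)"
    and a: "0 < x - real r1 - (real t1 + 1) * s" "0 < x - real r2 - (real t2 + 1) * s"
    and ab: "s\<^sup>2 / x \<le> (x - real r1 - (real t1 + 1) * s) * (x - real r2 - (real t2 + 1) * s)"
  shows "r1 = 0 \<and> t1 = p \<and> r2 = r \<and> t2 = q \<or> r1 = r \<and> t1 = q \<and> r2 = 0 \<and> t2 = p"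
proof -
  let ?a = "x - real r1 - (real t1 + 1) * s" and ?b = "x - real r2 - (real t2 + 1) * s"
  define j where "j = p + q - t1 - t2"
  have j: "t1 + t2 + j = p + q" "r1 + r2 = r + 2 * j" "?a + ?b = S - real j * (2 - s)"
    unfolding j_def by (rule inner_sum[OF n])+
  define T where "T = ?a + ?b"
  have T: "0 < T" using a by (simp add: T_def)
  have ab': "4 * (s\<^sup>2 - s) \<le> 4 * (?a * ?b)" using ab s_sq by simp
  have j0: "j = 0"
  proof (rule ccontr)
    assume "j \<noteq> 0"
    then have "1 * (2 - s) \<le> real j * (2 - s)" using s_less by (intro mult_right_mono) auto
    then have "2 - s \<le> real j * (2 - s)" by simp
    then have "T + (2 - s) \<le> T + real j * (2 - s)" by (rule add_left_mono)
    also have "\<dots> = S" using j(3) unfolding T_def by (rule eq_diff_eq[THEN iffD1])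
    finally have "T + (2 - s) \<le> S" .
    then have "(T + (2 - s))\<^sup>2 \<le> S\<^sup>2" using T s_less by (intro power_mono) auto
    then have 1: "(T + (2 - s))\<^sup>2 \<le> 4 * (s\<^sup>2 - s) + s\<^sup>2" using S_sq diff_sq_le by linarith
    have 2: "4 * (s\<^sup>2 - s) \<le> T\<^sup>2" using four_mult_le_square_sum[of ?a ?b] ab' unfolding T_def by linarith
    \<comment> \<open>Cancelling \<open>T\<^sup>2\<close> against \<open>4 * (s\<^sup>2 - s)\<close>
      leaves \<open>2 * T * (2 - s) \<le> s\<^sup>2 - (2 - s)\<^sup>2 = 4 * (s - 1)\<close>.\<close>
    have 3: "T * (2 - s) \<le> 2 * (s - 1)"
      using 1 2 by (simp add: power2_eq_square algebra_simps)
    have "(T * (2 - s))\<^sup>2 \<le> (2 * (s - 1))\<^sup>2" using 3 T s_less by (intro power_mono) auto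
    moreover have "4 * (s\<^sup>2 - s) * (2 - s)\<^sup>2 \<le> T\<^sup>2 * (2 - s)\<^sup>2" using 2 by (rule mult_right_mono) simp
    ultimately have "4 * (s\<^sup>2 - s) * (2 - s)\<^sup>2 \<le> (2 * (s - 1))\<^sup>2" by (simp add: power_mult_distrib)
    then have "(4 * (s - 1)) * (s * (2 - s)\<^sup>2) \<le> (4 * (s - 1)) * (s - 1)"
      by (simp add: power2_eq_square algebra_simps)
    then have 4: "s * (2 - s)\<^sup>2 \<le> s - 1" using s_gt_1 by (simp add: mult_le_cancel_left)
    \<comment> \<open>For \<open>s < 4 / 3\<close> the left side of \<open>4\<close> exceeds 4/9 and
      its right side is below 1/3.\<close>
    have "(2 / 3)\<^sup>2 < (2 - s)\<^sup>2" using s_less by (intro power_strict_mono) auto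
    moreover have "1 * (2 - s)\<^sup>2 \<le> s * (2 - s)\<^sup>2" using s_gt_1 by (intro mult_right_mono) auto
    ultimately have "(2 / 3)\<^sup>2 < s - 1" using 4 by linarith
    then show False using s_less by (simp add: power2_eq_square)
  qed
  have t: "t1 + t2 = p + q" and rr: "r1 + r2 = r" using j j0 by auto
  define D where "D = int t1 - int t2"
  have key: "(real_of_int D * s + (real r1 - real r2))\<^sup>2 \<le> ((real p - real q) * s - real r)\<^sup>2"
  proof -
    have "(?a - ?b)\<^sup>2 = (?a + ?b)\<^sup>2 - 4 * (?a * ?b)" by (simp add: power2_eq_square algebra_simps)
    also have "\<dots> \<le> S\<^sup>2 - 4 * (s\<^sup>2 - s)" using j(3) j0 ab' by simp
    also have "\<dots> = ((real p - real q) * s - real r)\<^sup>2" using S_sq by simp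
    finally have "(?a - ?b)\<^sup>2 \<le> ((real p - real q) * s - real r)\<^sup>2" .
    moreover have "?a - ?b = - (real_of_int D * s + (real r1 - real r2))" by (simp add: D_def algebra_simps)
    ultimately show ?thesis by (simp only: power2_minus)
  qed
  have par: "even D \<longleftrightarrow> p = q"
  proof -
    have "int t1 + int t2 = int p + int q" using t by linarith
    then have "D = int p + int q - 2 * int t2" by (simp add: D_def)
    then show ?thesis using pq_cases by auto
  qed
  \<comment> \<open>Stated for any integer because it serves for \<open>D\<close> or
    \<open>- D\<close>, depending on which hub carries the leaf. The inequality leaves at most two
    consecutive integers, and parity selects one.\<close>
  have r1D: "D' = int p - int q"
    if "(real_of_int D' * s - 1)\<^sup>2 \<le> ((real p - real q) * s - 1)\<^sup>2" "even D' \<longleftrightarrow> p = q" for D'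
  proof (cases "p = q")
    case True
    then have "\<bar>real_of_int D' * s - 1\<bar> \<le> 1" using that by (simp add: abs_square_le_1)
    then have b: "0 \<le> real_of_int D' * s" "real_of_int D' * s \<le> 2" by auto
    have "0 \<le> D'" using b(1) s_gt_1 by (simp add: zero_le_mult_iff)
    moreover have "D' < 2"
    proof (rule ccontr)
      assume "\<not> D' < 2"
      then have "2 * s \<le> real_of_int D' * s" using s_gt_1 by (intro mult_right_mono) auto
      then show False using b s_gt_1 by linarith
    qed
    ultimately show ?thesis using that(2) True by presburger
  next
    case False
    then have p: "p = Suc q" using pq_cases by simp
    then have "(real_of_int D' * s - 1)\<^sup>2 \<le> (s - 1)\<^sup>2" using that(1) by simp
    then have "\<bar>real_of_int D' * s - 1\<bar> \<le> s - 1" using s_gt_1 by (metis abs_le_square_iff abs_of_pos diff_gt_0_iff_gt)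
    then have b: "2 - s \<le> real_of_int D' * s" "real_of_int D' * s \<le> 1 * s" by auto
    have "0 < real_of_int D' * s" using b(1) s_less by linarith
    then have "0 < D'" using s_gt_1 by (simp add: zero_less_mult_iff)
    moreover have "D' \<le> 1" using b(2) s_gt_1 by simp
    ultimately show ?thesis using p by simp
  qed
  show ?thesis using r_cases
  proof
    assume r0: "r = 0"
    then have "(real_of_int D * s)\<^sup>2 \<le> ((real p - real q) * s)\<^sup>2" using key rr by simp
    then have "(real_of_int D)\<^sup>2 \<le> (real p - real q)\<^sup>2" using s_gt_1 by (simp add: power_mult_distrib)
    then have "\<bar>real_of_int D\<bar> \<le> \<bar>real p - real q\<bar>" by (simp add: abs_le_square_iff)
    then have "\<bar>D\<bar> \<le> int p - int q" using pq by linarith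
    then have "- (int p - int q) \<le> D" "D \<le> int p - int q" by auto
    then have "D = int p - int q \<or> D = int q - int p" using par pq_cases by presburger
    then show ?thesis using t rr r0 by (auto simp: D_def)
  next
    assume r1: "r = 1"
    then consider "r1 = 0" "r2 = 1" | "r1 = 1" "r2 = 0" using rr by linarith
    then show ?thesis
    proof cases
      case 1
      then have "D = int p - int q" using r1D[of D] key par r1 by simp
      then show ?thesis using 1 t r1 by (auto simp: D_def)
    next
      case 2
      have "(real_of_int (- D) * s - 1)\<^sup>2 = (real_of_int D * s + 1)\<^sup>2"
        by (simp add: power2_eq_square algebra_simps)
      then have "- D = int p - int q" using r1D[of "- D"] key par r1 2 by simp
      then show ?thesis using 2 t r1 by (auto simp: D_def)
    qed
  qed
qed

end


section \<open>Hubs, branches and embeddings of trees\<close>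

text \<open>The values \<open>a\<close>, \<open>b\<close>, \<open>c\<close> along a pendant path
  from a hub; eliminating \<open>c\<close> is the origin of \<sigma>.\<close>

lemma branch_ge:
  fixes l a b c :: real
  assumes "1 < l" "a + c \<le> l * b" "b \<le> l * c"
  shows "l\<^sup>2 / (l\<^sup>2 - 1) * a \<le> l * b"
proof -
  have l2: "0 < l\<^sup>2 - 1" using assms(1) by simp
  have "l * (a + c) \<le> l * (l * b)" using assms(1,2) by (intro mult_left_mono) auto
  then have "l * a \<le> (l\<^sup>2 - 1) * b" using assms(3) by (simp add: power2_eq_square algebra_simps)
  then have "l * (l * a) \<le> l * ((l\<^sup>2 - 1) * b)" using assms(1) by (intro mult_left_mono) auto
  then have "l\<^sup>2 * a \<le> (l * b) * (l\<^sup>2 - 1)" by (simp add: power2_eq_square mult_ac)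
  then show ?thesis using l2 by (simp add: divide_le_eq)
qed

lemma branch_eq:
  fixes l a b c :: real
  assumes "1 < l" "a + c = l * b" "b = l * c"
  shows "l\<^sup>2 / (l\<^sup>2 - 1) * a = l * b"
proof -
  have l2: "0 < l\<^sup>2 - 1" using assms(1) by simp
  have "a = (l\<^sup>2 - 1) * c" using assms(2,3) by (simp add: power2_eq_square algebra_simps)
  then show ?thesis using l2 assms(3) by (simp add: power2_eq_square)
qed

text \<open>Values \<open>a\<close>, \<open>b\<close>, \<open>c\<close>, \<open>d\<close> on a path
  between two hubs. Moving \<open>d / l\<close> from \<open>c\<close> to \<open>a\<close> turns the
  inequalities into those of a pendant path.\<close>

lemma middle_ge:
  fixes l a b c d :: real
  assumes "1 < l" "a + c \<le> l * b" "b + d \<le> l * c"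
  shows "l\<^sup>2 / (l\<^sup>2 - 1) * a + l\<^sup>2 / (l\<^sup>2 - 1) / l * d \<le> l * b"
proof -
  have "(a + d / l) + (c - d / l) \<le> l * b" "b \<le> l * (c - d / l)"
    using assms by (auto simp: algebra_simps)
  from branch_ge[OF assms(1) this] show ?thesis
    by (simp only: distrib_left times_divide_eq_right times_divide_eq_left)
qed

lemma middle_eq:
  fixes l a b c d :: real
  assumes "1 < l" "a + c = l * b" "b + d = l * c"
  shows "l\<^sup>2 / (l\<^sup>2 - 1) * a + l\<^sup>2 / (l\<^sup>2 - 1) / l * d = l * b"
proof -
  have "(a + d / l) + (c - d / l) = l * b" "b = l * (c - d / l)"
    using assms by (auto simp: algebra_simps)
  from branch_eq[OF assms(1) this] show ?thesis
    by (simp only: distrib_left times_divide_eq_right times_divide_eq_left)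
qed

text \<open>Positivity of both coefficients comes along; it is needed to pass from
  \<open>T\<^sup>2\<close> to \<open>T\<close> after AM-GM.\<close>

lemma hub_product:
  fixes a b y z \<beta> :: real
  assumes "0 < y" "0 < z" "0 < \<beta>" "\<beta> * z \<le> a * y" "\<beta> * y \<le> b * z"
  shows "0 < a" "0 < b" "\<beta>\<^sup>2 \<le> a * b"
proof -
  have "0 < \<beta> * z" "0 < \<beta> * y" using assms by auto
  then have "0 < a * y" "0 < b * z" using assms(4,5) by linarith+
  then show ab: "0 < a" "0 < b" using assms(1,2) by (auto simp: zero_less_mult_iff)
  have "(\<beta> * z) * (\<beta> * y) \<le> (a * y) * (b * z)"
    by (rule mult_mono) (use assms ab in auto)
  then have "\<beta>\<^sup>2 * (y * z) \<le> (a * b) * (y * z)" by (simp add: power2_eq_square mult_ac)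
  then show "\<beta>\<^sup>2 \<le> a * b" using assms(1,2) by simp
qed

locale super_graph = sgraph V E for V :: "'a set" and E +
  fixes y :: "'a \<Rightarrow> real" and l :: real
  assumes l: "1 < l"
    and ypos: "\<And>v. v \<in> V \<Longrightarrow> 0 < y v"
    and super: "\<And>v. v \<in> V \<Longrightarrow> nsum E y v \<le> l * y v"
begin

definition s :: real where "s = l\<^sup>2 / (l\<^sup>2 - 1)"

lemma s_pos: "0 < s" using l by (simp add: s_def)

lemma sum_le:
  assumes "X \<subseteq> E `` {v}" "v \<in> V"
  shows "sum y X \<le> l * y v"
proof -
  have "sum y X \<le> sum y (E `` {v})"
    using assms nb_sub[of v] ypos by (intro sum_mono2) (auto intro!: less_imp_le)
  then show ?thesis using super[OF assms(2)] by (simp add: nsum_def)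
qed

text \<open>A fixed point of \<open>q\<close> counts as a leaf at \<open>u\<close>, any other
  \<open>w\<close> as a branch edge with end \<open>q w\<close>. Further edges of the graph only
  enlarge neighbour sums, so inequalities result.\<close>

lemma hub_sum:
  assumes u: "u \<in> V" and R: "R \<subseteq> E `` {u}"
    and q: "\<And>w. w \<in> R \<Longrightarrow> q w \<noteq> w \<Longrightarrow> (w, q w) \<in> E \<and> q w \<noteq> u"
  shows "(real (card {w \<in> R. q w = w}) + real (card {w \<in> R. q w \<noteq> w}) * s) * y u \<le> l * sum y R"
proof -
  define L M where "L = {w \<in> R. q w = w}" and "M = {w \<in> R. q w \<noteq> w}"
  have finR: "finite R" using R by (rule finite_subset) simp
  have RV: "w \<in> V" if "w \<in> R" for w using that R sub by auto
  have RLM: "R = L \<union> M" "L \<inter> M = {}" "finite L" "finite M" using finR by (auto simp: L_def M_def)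
  have leaf: "y u \<le> l * y w" if w: "w \<in> L" for w
  proof -
    have "sum y {u} \<le> l * y w" by (rule sum_le) (use w R symE RV in \<open>auto simp: L_def\<close>)
    then show ?thesis by simp
  qed
  have mid: "s * y u \<le> l * y w" if w: "w \<in> M" for w
  proof -
    have wq: "w \<in> R" "q w \<noteq> w" using w by (auto simp: M_def)
    have e: "(w, q w) \<in> E" "q w \<noteq> u" using q[OF wq] by auto
    have "sum y {u, q w} \<le> l * y w" by (rule sum_le) (use wq e R symE RV in auto)
    then have 1: "y u + y (q w) \<le> l * y w" using e by simp
    have "sum y {w} \<le> l * y (q w)" by (rule sum_le) (use e symE sub in auto)
    then show ?thesis unfolding s_def using branch_ge[OF l 1] by simp
  qed
  have "(real (card L) + real (card M) * s) * y u = (\<Sum>w\<in>L. y u) + (\<Sum>w\<in>M. s * y u)"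
    by (simp add: algebra_simps)
  also have "\<dots> \<le> (\<Sum>w\<in>L. l * y w) + (\<Sum>w\<in>M. l * y w)"
    using leaf mid by (intro add_mono sum_mono)
  also have "\<dots> = l * sum y R"
    unfolding RLM(1) using RLM(2-4) by (simp add: sum.union_disjoint sum_distrib_left distrib_left)
  finally show ?thesis by (simp add: L_def M_def)
qed

lemma hub_bound:
  assumes u: "u \<in> V" and R: "R \<subseteq> E `` {u}"
    and q: "\<And>w. w \<in> R \<Longrightarrow> q w \<noteq> w \<Longrightarrow> (w, q w) \<in> E \<and> q w \<noteq> u"
    and c: "(u, c) \<in> E" "c \<notin> R"
  shows "l * y c \<le> (l\<^sup>2 - real (card {w \<in> R. q w = w}) - real (card {w \<in> R. q w \<noteq> w}) * s) * y u"
proof -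
  have finR: "finite R" using R by (rule finite_subset) simp
  have "sum y (insert c R) \<le> l * y u" by (rule sum_le) (use u R c in auto)
  then have "l * (y c + sum y R) \<le> l * (l * y u)" using finR c l by (intro mult_left_mono) auto
  moreover note hub_sum[OF u R q]
  ultimately show ?thesis by (simp add: power2_eq_square algebra_simps)
qed

end

text \<open>
  The vertices of \<open>H\<close> form an initial segment \<open>{0..<m}\<close>, so that \<^const>\<open>fresh_vertex\<close> returns \<open>m\<close>.
\<close>

definition emb :: "'a rel \<Rightarrow> nat pair_pre_digraph \<Rightarrow> (nat \<Rightarrow> 'a) \<Rightarrow> 'a set \<Rightarrow> bool" where
  "emb E H f X \<longleftrightarrow> (\<exists>m>0. pverts H = {0..<m}) \<and> bij_betw f (pverts H) X \<and>
     parcs H \<subseteq> pverts H \<times> pverts H \<and> (\<forall>i j. (i, j) \<in> parcs H \<longrightarrow> (f i, f j) \<in> E)"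

lemma embI:
  assumes "pverts H = {0..<m}" "0 < m" "bij_betw f {0..<m} X" "parcs H \<subseteq> {0..<m} \<times> {0..<m}"
    "\<And>i j. (i, j) \<in> parcs H \<Longrightarrow> (f i, f j) \<in> E"
  shows "emb E H f X"
  using assms unfolding emb_def by metis

lemma fresh_vertex_eq: "pverts H = {0..<m} \<Longrightarrow> 0 < m \<Longrightarrow> fresh_vertex H = m"
proof -
  assume H: "pverts H = {0..<m}" "0 < m"
  then have "Max (pverts H) = m - 1" by (intro Max_eqI) auto
  then show ?thesis using H by (simp add: fresh_vertex_def)
qed

lemma attach_leaf_eq:
  assumes "pverts H = {0..<m}" "0 < m"
  shows "pverts (attach_leaf v H) = {0..<Suc m}" "parcs (attach_leaf v H) = parcs H \<union> {(v, m), (m, v)}"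
  by (auto simp: attach_leaf_def fresh_vertex_eq[OF assms] assms(1))

lemma attach_branch_edge_eq:
  assumes "pverts H = {0..<m}" "0 < m"
  shows "pverts (attach_branch_edge v H) = {0..<m + 2}"
    "parcs (attach_branch_edge v H) = parcs H \<union> {(v, m), (m, v), (m, Suc m), (Suc m, m)}"
  by (auto simp: attach_branch_edge_def Let_def fresh_vertex_eq[OF assms] assms(1))

text \<open>The new map agrees with the old one, so the images of the hubs stay known through
  repeated attachments.\<close>

lemma emb_attach_leaf:
  assumes E: "\<And>a b. (a, b) \<in> E \<Longrightarrow> (b, a) \<in> E" and f: "emb E H f X" and v: "v \<in> pverts H"
    and a: "(f v, a) \<in> E" "a \<notin> X"
  shows "\<exists>f'. emb E (attach_leaf v H) f' (insert a X) \<and> (\<forall>i\<in>pverts H. f' i = f i) \<and>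
    pverts H \<subseteq> pverts (attach_leaf v H)"
proof -
  obtain m where m: "0 < m" "pverts H = {0..<m}" using f unfolding emb_def by blast
  have f: "bij_betw f {0..<m} X" "parcs H \<subseteq> {0..<m} \<times> {0..<m}" "\<And>i j. (i, j) \<in> parcs H \<Longrightarrow> (f i, f j) \<in> E"
    using f unfolding emb_def m(2) by blast+
  note H = attach_leaf_eq[OF m(2,1), of v]
  define f' where "f' = f(m := a)"
  have agree: "f' i = f i" if "i < m" for i using that by (simp add: f'_def)
  have "bij_betw f' {0..<m} X" using f(1) by (rule iffD2[OF bij_betw_cong, rotated]) (simp add: agree)
  then have "bij_betw f' (insert m {0..<m}) (insert a X)"
    using notIn_Un_bij_betw[of m "{0..<m}" f' X] a by (simp add: f'_def)
  moreover have "insert m {0..<m} = {0..<Suc m}" by auto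
  moreover have "(f' i, f' j) \<in> E" if ij: "(i, j) \<in> parcs (attach_leaf v H)" for i j
  proof -
    have f'v: "f' v = f v" "f' m = a" using v m by (simp_all add: f'_def)
    consider "(i, j) \<in> parcs H" | "i = v" "j = m" | "i = m" "j = v" using ij unfolding H by blast
    then show ?thesis
    proof cases
      case 1
      then have "i < m" "j < m" using f(2) by auto
      then show ?thesis using f(3)[OF 1] by (simp add: agree)
    qed (use a(1) E[OF a(1)] f'v in simp_all)
  qed
  moreover have "parcs (attach_leaf v H) \<subseteq> {0..<Suc m} \<times> {0..<Suc m}"
    using f(2) v m by (auto simp: H)
  ultimately have "emb E (attach_leaf v H) f' (insert a X)"
    using H(1) by (intro embI[of _ "Suc m"]) simp_all
  moreover have "pverts H \<subseteq> pverts (attach_leaf v H)" by (simp add: H(1) m(2))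
  ultimately show ?thesis using agree m(2) by (intro exI[of _ f']) simp
qed

lemma emb_attach_branch_edge:
  assumes E: "\<And>a b. (a, b) \<in> E \<Longrightarrow> (b, a) \<in> E" and f: "emb E H f X" and v: "v \<in> pverts H"
    and a: "(f v, a) \<in> E" "a \<notin> X" and b: "(a, b) \<in> E" "b \<notin> X" "a \<noteq> b"
  shows "\<exists>f'. emb E (attach_branch_edge v H) f' (insert b (insert a X)) \<and> (\<forall>i\<in>pverts H. f' i = f i) \<and>
    pverts H \<subseteq> pverts (attach_branch_edge v H)"
proof -
  obtain m where m: "0 < m" "pverts H = {0..<m}" using f unfolding emb_def by blast
  have f: "bij_betw f {0..<m} X" "parcs H \<subseteq> {0..<m} \<times> {0..<m}" "\<And>i j. (i, j) \<in> parcs H \<Longrightarrow> (f i, f j) \<in> E"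
    using f unfolding emb_def m(2) by blast+
  note H = attach_branch_edge_eq[OF m(2,1), of v]
  define f' where "f' = f(m := a, Suc m := b)"
  have agree: "f' i = f i" if "i < m" for i using that by (simp add: f'_def)
  have "bij_betw f' {0..<m} X" using f(1) by (rule iffD2[OF bij_betw_cong, rotated]) (simp add: agree)
  then have 1: "bij_betw f' (insert m {0..<m}) (insert a X)"
    using notIn_Un_bij_betw[of m "{0..<m}" f' X] a by (simp add: f'_def)
  then have "bij_betw f' (insert (Suc m) (insert m {0..<m})) (insert b (insert a X))"
    using notIn_Un_bij_betw[of "Suc m" "insert m {0..<m}" f' "insert a X"] b by (simp add: f'_def)
  moreover have "insert (Suc m) (insert m {0..<m}) = {0..<m + 2}" by auto
  moreover have "(f' i, f' j) \<in> E" if ij: "(i, j) \<in> parcs (attach_branch_edge v H)" for i j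
  proof -
    have f'v: "f' v = f v" "f' m = a" "f' (Suc m) = b" using v m by (simp_all add: f'_def)
    consider "(i, j) \<in> parcs H" | "i = v" "j = m" | "i = m" "j = v" | "i = m" "j = Suc m" | "i = Suc m" "j = m"
      using ij unfolding H by blast
    then show ?thesis
    proof cases
      case 1
      then have "i < m" "j < m" using f(2) by auto
      then show ?thesis using f(3)[OF 1] by (simp add: agree)
    qed (use a(1) E[OF a(1)] b(1) E[OF b(1)] f'v in simp_all)
  qed
  moreover have "parcs (attach_branch_edge v H) \<subseteq> {0..<m + 2} \<times> {0..<m + 2}"
    using f(2) v m by (auto simp: H)
  ultimately have "emb E (attach_branch_edge v H) f' (insert b (insert a X))"
    using H(1) by (intro embI[of _ "m + 2"]) simp_all
  moreover have "pverts H \<subseteq> pverts (attach_branch_edge v H)" by (simp add: H(1) m(2))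
  ultimately show ?thesis using agree m(2) by (intro exI[of _ f']) simp
qed

lemma emb_attach_branch_edges:
  assumes E: "\<And>a b. (a, b) \<in> E \<Longrightarrow> (b, a) \<in> E" and f: "emb E H f X" and v: "v \<in> pverts H"
    and M: "finite M" "\<And>a. a \<in> M \<Longrightarrow> (f v, a) \<in> E" "\<And>a. a \<in> M \<Longrightarrow> (a, e a) \<in> E"
      "inj_on e M" "M \<inter> e ` M = {}" "(M \<union> e ` M) \<inter> X = {}"
  shows "\<exists>f'. emb E ((attach_branch_edge v ^^ card M) H) f' (X \<union> M \<union> e ` M) \<and> (\<forall>i\<in>pverts H. f' i = f i) \<and>
    pverts H \<subseteq> pverts ((attach_branch_edge v ^^ card M) H)"
  using M
proof (induction M rule: finite_induct)
  case empty
  then show ?case using f by auto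
next
  case (insert a M)
  have "inj_on e M" "M \<inter> e ` M = {}" "(M \<union> e ` M) \<inter> X = {}" using insert.prems by auto
  then obtain f' where f': "emb E ((attach_branch_edge v ^^ card M) H) f' (X \<union> M \<union> e ` M)"
      "\<forall>i\<in>pverts H. f' i = f i" "pverts H \<subseteq> pverts ((attach_branch_edge v ^^ card M) H)"
    using insert.IH insert.prems by blast
  let ?H = "(attach_branch_edge v ^^ card M) H"
  have fv: "f' v = f v" using f'(2) v by blast
  have "\<exists>f''. emb E (attach_branch_edge v ?H) f'' (insert (e a) (insert a (X \<union> M \<union> e ` M))) \<and>
      (\<forall>i\<in>pverts ?H. f'' i = f' i) \<and> pverts ?H \<subseteq> pverts (attach_branch_edge v ?H)"
  proof (rule emb_attach_branch_edge[OF E f'(1)])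
    show "v \<in> pverts ?H" using v f'(3) by blast
    show "(f' v, a) \<in> E" using insert.prems(1) fv by simp
    show "(a, e a) \<in> E" using insert.prems(2) by simp
    show "a \<notin> X \<union> M \<union> e ` M" "e a \<notin> X \<union> M \<union> e ` M" "a \<noteq> e a"
      using insert.prems(3-5) insert.hyps by auto
  qed
  then obtain f'' where f'': "emb E (attach_branch_edge v ?H) f'' (insert (e a) (insert a (X \<union> M \<union> e ` M)))"
      "\<forall>i\<in>pverts ?H. f'' i = f' i" "pverts ?H \<subseteq> pverts (attach_branch_edge v ?H)"
    by blast
  have "insert (e a) (insert a (X \<union> M \<union> e ` M)) = X \<union> insert a M \<union> e ` insert a M" by auto
  moreover have "\<forall>i\<in>pverts H. f'' i = f i" using f''(2) f'(2,3) by auto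
  ultimately show ?case using f''(1,3) f'(3) insert.hyps by (intro exI[of _ f'']) auto
qed

text \<open>
  The involution \<open>q\<close> exchanges the two ends of each \<open>K\<^sub>2\<close> component and fixes isolated vertices; \<open>R\<close> picks
  from each component one vertex with property \<open>P\<close>.
\<close>

lemma representatives:
  assumes q: "\<And>w. w \<in> W \<Longrightarrow> q w \<in> W" "\<And>w. w \<in> W \<Longrightarrow> q (q w) = w"
    and P: "\<And>w. w \<in> W \<Longrightarrow> P w \<or> P (q w)"
  shows "\<exists>R\<subseteq>W. (\<forall>w\<in>R. P w) \<and> R \<union> q ` R = W \<and> (\<forall>w\<in>R. q w \<in> R \<longrightarrow> q w = w)"
proof -
  \<comment> \<open>The choice depends only on the set \<open>{w, q w}\<close>, so both ends of a
    component choose the same vertex.\<close>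
  define c where "c = (\<lambda>w. SOME z. z \<in> {w, q w} \<and> P z)"
  have c: "c w \<in> {w, q w} \<and> P (c w)" if w: "w \<in> W" for w
  proof -
    have "\<exists>z. z \<in> {w, q w} \<and> P z" using P[OF w] by blast
    then show ?thesis unfolding c_def by (rule someI_ex)
  qed
  have cq: "c (q w) = c w" if w: "w \<in> W" for w
  proof -
    have "{q w, q (q w)} = {w, q w}" using q(2)[OF w] by auto
    then show ?thesis unfolding c_def by simp
  qed
  define R where "R = c ` W"
  have RW: "R \<subseteq> W"
  proof
    fix z assume "z \<in> R"
    then obtain w where "w \<in> W" "z = c w" by (auto simp: R_def)
    then show "z \<in> W" using c[of w] q(1)[of w] by auto
  qed
  have cR: "c z = z" if "z \<in> R" for z
  proof -
    obtain w where w: "w \<in> W" "z = c w" using \<open>z \<in> R\<close> by (auto simp: R_def)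
    then consider "z = w" | "z = q w" using c[of w] by auto
    then show ?thesis by cases (use w cq[of w] in auto)
  qed
  have "R \<union> q ` R = W"
  proof
    show "R \<union> q ` R \<subseteq> W" using RW q(1) by auto
    show "W \<subseteq> R \<union> q ` R"
    proof
      fix w assume w: "w \<in> W"
      have "c w \<in> R" using w by (simp add: R_def)
      moreover consider "c w = w" | "c w = q w" using c[OF w] by auto
      moreover have "q (q w) = w" by (rule q(2)[OF w])
      ultimately show "w \<in> R \<union> q ` R"
        by cases (simp, metis UnCI imageI)
    qed
  qed
  moreover have "q w = w" if "w \<in> R" "q w \<in> R" for w
    using cR[OF that(1)] cR[OF that(2)] cq[of w] that(1) RW by (metis subsetD)
  moreover have "P w" if "w \<in> R" for w using c[of w] cR[OF that] RW that by (metis subsetD)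
  ultimately show ?thesis using RW by blast
qed

text \<open>Induced degree at most 1 makes every component of \<open>W\<close> a vertex or an edge;
  \<open>q\<close> goes to the other end, or stays put at an isolated vertex.\<close>

lemma (in sgraph) partner:
  assumes W: "W \<subseteq> V" "dissoc E W"
  shows "\<exists>q. \<forall>w\<in>W. q w \<in> W \<and> q (q w) = w \<and> (q w \<noteq> w \<longrightarrow> (w, q w) \<in> E) \<and> (\<forall>z\<in>W. (w, z) \<in> E \<longrightarrow> z = q w)"
proof -
  define q where "q = (\<lambda>w. if \<exists>z\<in>W. (w, z) \<in> E then SOME z. z \<in> W \<and> (w, z) \<in> E else w)"
  have uniq: "z = z'" if "w \<in> W" "z \<in> W" "z' \<in> W" "(w, z) \<in> E" "(w, z') \<in> E" for w z z'
  proof (rule ccontr)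
    assume "z \<noteq> z'"
    then have "\<not> card (E `` {w} \<inter> W) \<le> 1" using that by (intro card_ge_two_nbs[of z _ z']) auto
    then show False using W(2) that(1) by (auto simp: dissoc_def)
  qed
  have q1: "q w \<in> W \<and> (w, q w) \<in> E" if "z \<in> W" "(w, z) \<in> E" for w z
  proof -
    have "\<exists>z. z \<in> W \<and> (w, z) \<in> E" using that by blast
    then have "(SOME z. z \<in> W \<and> (w, z) \<in> E) \<in> W \<and> (w, SOME z. z \<in> W \<and> (w, z) \<in> E) \<in> E" by (rule someI_ex)
    moreover have "\<exists>z\<in>W. (w, z) \<in> E" using that by blast
    ultimately show ?thesis by (simp add: q_def)
  qed
  have q2: "q w = w" if "\<not> (\<exists>z\<in>W. (w, z) \<in> E)" for w unfolding q_def using that by (rule if_not_P)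
  have "q w \<in> W \<and> q (q w) = w \<and> (q w \<noteq> w \<longrightarrow> (w, q w) \<in> E) \<and> (\<forall>z\<in>W. (w, z) \<in> E \<longrightarrow> z = q w)" if w: "w \<in> W" for w
  proof (cases "\<exists>z\<in>W. (w, z) \<in> E")
    case True
    then have 1: "q w \<in> W" "(w, q w) \<in> E" using q1 by blast+
    then have 2: "q (q w) \<in> W" "(q w, q (q w)) \<in> E" using q1[OF w, of "q w"] symE by blast+
    have "q (q w) = w" using uniq[OF 1(1) 2(1) w 2(2)] symE[OF 1(2)] by blast
    then show ?thesis using 1 uniq[OF w] by blast
  next
    case False
    then show ?thesis using q2[OF False] w by metis
  qed
  then show ?thesis by blast
qed


section \<open>The trees S(r, t)\<close>

text \<open>Closed form of the arcs added by \<open>t\<close> attachments at \<open>v\<close> to a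
  graph on \<open>{0..<m}\<close>: the \<open>i\<close>-th branch edge has the vertices
  \<open>m + 2 * i\<close>, next to \<open>v\<close>, and \<open>m + 2 * i + 1\<close>.
  Neighbourhoods can be read off without unfolding the iteration.\<close>

definition branch_arcs :: "nat \<Rightarrow> nat \<Rightarrow> nat \<Rightarrow> nat rel" where
  "branch_arcs v m t = {(a, b). \<exists>i<t. a = v \<and> b = m + 2 * i \<or> a = m + 2 * i \<and> b = v \<or>
     a = m + 2 * i \<and> b = Suc (m + 2 * i) \<or> a = Suc (m + 2 * i) \<and> b = m + 2 * i}"

lemma branch_arcs_0: "branch_arcs v m 0 = {}"
  by (simp add: branch_arcs_def)

lemma branch_arcs_Suc: "branch_arcs v m (Suc t) = branch_arcs v m t \<union>
    {(v, m + 2 * t), (m + 2 * t, v), (m + 2 * t, Suc (m + 2 * t)), (Suc (m + 2 * t), m + 2 * t)}"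
  unfolding branch_arcs_def less_Suc_eq by blast

lemma funpow_attach_branch_edge:
  assumes "pverts H = {0..<m}" "0 < m"
  shows "pverts ((attach_branch_edge v ^^ t) H) = {0..<m + 2 * t} \<and>
    parcs ((attach_branch_edge v ^^ t) H) = parcs H \<union> branch_arcs v m t"
proof (induction t)
  case 0
  then show ?case using assms by (simp add: branch_arcs_0)
next
  case (Suc t)
  have "pverts ((attach_branch_edge v ^^ t) H) = {0..<m + 2 * t}" "0 < m + 2 * t" using Suc assms by auto
  note * = attach_branch_edge_eq[OF this, of v]
  then show ?case using Suc by (simp add: branch_arcs_Suc Un_assoc)
qed

lemma branch_arcs_sym: "(a, b) \<in> branch_arcs v m t \<Longrightarrow> (b, a) \<in> branch_arcs v m t"
  unfolding branch_arcs_def by blast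

lemma branch_arcs_irr: "v < m \<Longrightarrow> (a, a) \<notin> branch_arcs v m t"
  unfolding branch_arcs_def by auto

lemma branch_arcs_sub: "(a, b) \<in> branch_arcs v m t \<Longrightarrow> v < k \<Longrightarrow> m + 2 * t \<le> k \<Longrightarrow> a < k \<and> b < k"
  unfolding branch_arcs_def by auto

lemma branch_arcs_hub: "v < m \<Longrightarrow> branch_arcs v m t `` {v} = (\<lambda>i. m + 2 * i) ` {..<t}"
  unfolding branch_arcs_def by auto

lemma branch_arcs_other: "v < m \<Longrightarrow> w < m \<Longrightarrow> w \<noteq> v \<Longrightarrow> branch_arcs v m t `` {w} = {}"
  unfolding branch_arcs_def by auto

lemma branch_arcs_beyond: "v < m \<Longrightarrow> m + 2 * t \<le> w \<Longrightarrow> branch_arcs v m t `` {w} = {}"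
  unfolding branch_arcs_def by auto

lemma branch_arcs_mid: "v < m \<Longrightarrow> i < t \<Longrightarrow> branch_arcs v m t `` {m + 2 * i} = {v, Suc (m + 2 * i)}"
  unfolding branch_arcs_def by (auto; presburger)

lemma branch_arcs_end: "v < m \<Longrightarrow> i < t \<Longrightarrow> branch_arcs v m t `` {Suc (m + 2 * i)} = {m + 2 * i}"
  unfolding branch_arcs_def by (auto; presburger)

lemma branch_vertex_cases:
  assumes "m \<le> w" "w < m + 2 * t"
  shows "\<exists>i<t. w = m + 2 * i \<or> w = Suc (m + 2 * i)"
proof -
  obtain d where d: "w = m + d" using assms(1) le_Suc_ex by blast
  show ?thesis
  proof (cases "even d")
    case True
    then obtain i where "d = 2 * i" by (elim evenE)
    then show ?thesis using d assms(2) by (intro exI[of _ i]) simp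
  next
    case False
    then obtain i where "d = 2 * i + 1" by (elim oddE)
    then show ?thesis using d assms(2) by (intro exI[of _ i]) simp
  qed
qed

lemma card_le_1_of_subset: "X \<subseteq> {a} \<Longrightarrow> card X \<le> 1"
  using card_mono[of "{a}" X] by simp

text \<open>The counterpart of \<open>hub_sum\<close> for the exact Perron equation at a hub of a
  tree.\<close>

lemma hub_sum_eq:
  fixes y :: "'a \<Rightarrow> real" and l yu :: real
  assumes "1 < l" "finite L" "finite M" "L \<inter> M = {}"
    and leaf: "\<And>w. w \<in> L \<Longrightarrow> yu = l * y w"
    and mid: "\<And>w. w \<in> M \<Longrightarrow> yu + y (e w) = l * y w" "\<And>w. w \<in> M \<Longrightarrow> y w = l * y (e w)"
  shows "(real (card L) + real (card M) * (l\<^sup>2 / (l\<^sup>2 - 1))) * yu = l * sum y (L \<union> M)"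
proof -
  have "(real (card L) + real (card M) * (l\<^sup>2 / (l\<^sup>2 - 1))) * yu
      = (\<Sum>w\<in>L. yu) + (\<Sum>w\<in>M. l\<^sup>2 / (l\<^sup>2 - 1) * yu)"
    by (simp add: algebra_simps)
  also have "\<dots> = (\<Sum>w\<in>L. l * y w) + (\<Sum>w\<in>M. l * y w)"
    by (intro arg_cong2[of _ _ _ _ "(+)"] sum.cong refl leaf branch_eq[OF assms(1) mid])
  also have "\<dots> = l * sum y (L \<union> M)"
    using assms(2-4) by (simp add: sum.union_disjoint sum_distrib_left distrib_left)
  finally show ?thesis .
qed

text \<open>Along a pendant path \<open>l\<^sup>2 * c = a + c > c\<close>.\<close>

lemma one_less_of_pendant_path:
  fixes l a b c :: real
  assumes "0 < a" "0 < b" "0 < c" "a + c = l * b" "b = l * c"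
  shows "1 < l"
proof -
  have l: "0 < l" using assms(2,3,5) by (simp add: zero_less_mult_iff)
  have "c < (l * l) * c" using assms(1,4,5) by (simp add: mult.assoc)
  then have "1 < l * l" using assms(3) by simp
  then show ?thesis using l by (metis linorder_not_less mult_le_one less_imp_le)
qed

definition star_base :: "nat \<Rightarrow> nat pair_pre_digraph" where
  "star_base r = (attach_leaf 0 ^^ r) \<lparr> pverts = {0}, parcs = {} \<rparr>"

lemma star_base_eq:
  assumes "r \<le> 1"
  shows "pverts (star_base r) = {0..<1 + r}" "parcs (star_base r) = (if r = 1 then {(0, 1), (1, 0)} else {})"
proof -
  have z: "pverts \<lparr> pverts = {0}, parcs = {} \<rparr> = {0..<1::nat}" by auto
  show "pverts (star_base r) = {0..<1 + r}" "parcs (star_base r) = (if r = 1 then {(0, 1), (1, 0)} else {})"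
    using assms attach_leaf_eq[OF z, of 0] by (auto simp: star_base_def le_Suc_eq)
qed

lemma S_tree_eq:
  assumes "r \<le> 1"
  shows "pverts (S_tree r t) = {0..<1 + r + 2 * t}"
    "parcs (S_tree r t) = (if r = 1 then {(0, 1), (1, 0)} else {}) \<union> branch_arcs 0 (1 + r) t"
  using funpow_attach_branch_edge[OF star_base_eq(1)[OF assms], where v = 0 and t = t] star_base_eq(2)[OF assms]
  by (simp_all add: S_tree_def star_base_def)

lemma S_tree_nb:
  assumes "r \<le> 1"
  shows "parcs (S_tree r t) `` {0} = (if r = 1 then {1} else {}) \<union> (\<lambda>i. 1 + r + 2 * i) ` {..<t}"
    and "r = 1 \<Longrightarrow> parcs (S_tree r t) `` {1} = {0}"
    and "i < t \<Longrightarrow> parcs (S_tree r t) `` {1 + r + 2 * i} = {0, Suc (1 + r + 2 * i)}"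
    and "i < t \<Longrightarrow> parcs (S_tree r t) `` {Suc (1 + r + 2 * i)} = {1 + r + 2 * i}"
proof -
  have rr: "r = 0 \<or> r = 1" using assms by linarith
  have *: "(if r = 1 then {(0, 1), (1, 0)} else {}) `` {w} = (if r = 1 \<and> w = 0 then {1} else if r = 1 \<and> w = 1 then {0} else {})"
    for w :: nat by auto
  note N = S_tree_eq(2)[OF assms, of t]
  show "parcs (S_tree r t) `` {0} = (if r = 1 then {1} else {}) \<union> (\<lambda>i. 1 + r + 2 * i) ` {..<t}"
    unfolding N Un_Image * by (subst branch_arcs_hub) simp_all
  show "parcs (S_tree r t) `` {1} = {0}" if "r = 1"
    unfolding N Un_Image * by (subst branch_arcs_other) (use that in simp_all)
  show "parcs (S_tree r t) `` {1 + r + 2 * i} = {0, Suc (1 + r + 2 * i)}" if "i < t"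
    unfolding N Un_Image * by (subst branch_arcs_mid) (use that rr in auto)
  show "parcs (S_tree r t) `` {Suc (1 + r + 2 * i)} = {1 + r + 2 * i}" if "i < t"
    unfolding N Un_Image * by (subst branch_arcs_end) (use that rr in auto)
qed

lemma S_tree_vertex_cases:
  assumes "r \<le> 1" "w \<in> pverts (S_tree r t)"
  shows "w = 0 \<or> r = 1 \<and> w = 1 \<or> (\<exists>i<t. w = 1 + r + 2 * i) \<or> (\<exists>i<t. w = Suc (1 + r + 2 * i))"
proof (cases "1 + r \<le> w")
  case True
  then show ?thesis using branch_vertex_cases[of "1 + r" w t] assms(2) S_tree_eq(1)[OF assms(1), of t] by auto
next
  case False
  then show ?thesis using assms(1) by linarith
qed

lemma conn_S_tree:
  assumes r: "r \<le> 1"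
  shows "conn_graph (S_tree r t)"
proof -
  let ?G = "S_tree r t"
  have sg: "sgraph (pverts ?G) (parcs ?G)"
  proof
    show "finite (pverts ?G)" by (simp add: S_tree_eq[OF r])
    show "parcs ?G \<subseteq> pverts ?G \<times> pverts ?G"
      using branch_arcs_sub[of _ _ 0 "1 + r" t "1 + r + 2 * t"] r
      by (auto simp: S_tree_eq[OF r] split: if_splits)
    show "(b, a) \<in> parcs ?G" if "(a, b) \<in> parcs ?G" for a b
      using that branch_arcs_sym[of a b 0 "1 + r" t] unfolding S_tree_eq[OF r] by (auto split: if_splits)
    show "(a, a) \<notin> parcs ?G" for a
      using branch_arcs_irr[of 0 "1 + r" a t] unfolding S_tree_eq[OF r] by auto
  qed
  have "cut_connected (pverts ?G) (parcs ?G)"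
  proof (rule sgraph.cut_connectedI[OF sg, of 0 "\<lambda>v. v"])
    show "0 \<in> pverts ?G" by (simp add: S_tree_eq[OF r])
    fix w assume w: "w \<in> pverts ?G" "w \<noteq> 0"
    consider "r = 1" "w = 1" | i where "i < t" "w = 1 + r + 2 * i" | i where "i < t" "w = Suc (1 + r + 2 * i)"
      using S_tree_vertex_cases[OF r w(1)] w(2) by blast
    then show "\<exists>z. (w, z) \<in> parcs ?G \<and> z < w"
    proof cases
      case 1
      then have "0 \<in> parcs ?G `` {w}" using S_tree_nb(2)[OF r, of t] by simp
      then show ?thesis using w(2) by blast
    next
      case 2
      then have "0 \<in> parcs ?G `` {w}" using S_tree_nb(3)[OF r 2(1)] by simp
      then show ?thesis using w(2) by blast
    next
      case 3
      then have "1 + r + 2 * i \<in> parcs ?G `` {w}" using S_tree_nb(4)[OF r 3(1)] by simp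
      then show ?thesis using 3 by (intro exI[of _ "1 + r + 2 * i"]) simp
    qed
  qed
  then show ?thesis using sg by (simp add: conn_graph_def pair_graph_iff_sgraph)
qed

lemma dissociation_number_S_tree:
  assumes r: "r \<le> 1" and t: "0 < t"
  shows "dissociation_number (S_tree r t) = r + 2 * t"
proof -
  let ?G = "S_tree r t"
  interpret conn_graph ?G by (rule conn_S_tree[OF r])
  have V: "pverts ?G = {0..<1 + r + 2 * t}" by (rule S_tree_eq[OF r])
  show ?thesis
  proof (rule dissociation_numberI[of "pverts ?G - {0}"])
    fix w assume w: "w \<in> pverts ?G - {0}"
    then consider "r = 1" "w = 1" | i where "i < t" "w = 1 + r + 2 * i" | i where "i < t" "w = Suc (1 + r + 2 * i)"
      using S_tree_vertex_cases[OF r, of w t] by blast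
    then show "card (parcs ?G `` {w} \<inter> (pverts ?G - {0})) \<le> 1"
    proof cases
      case 1
      then show ?thesis using S_tree_nb(2)[OF r, of t] by (intro card_le_1_of_subset[of _ 0]) auto
    next
      case 2
      then show ?thesis using S_tree_nb(3)[OF r 2(1)]
        by (intro card_le_1_of_subset[of _ "Suc (1 + r + 2 * i)"]) auto
    next
      case 3
      then show ?thesis using S_tree_nb(4)[OF r 3(1)]
        by (intro card_le_1_of_subset[of _ "1 + r + 2 * i"]) auto
    qed
  next
    fix S assume S: "S \<subseteq> pverts ?G" "\<And>v. v \<in> S \<Longrightarrow> card (parcs ?G `` {v} \<inter> S) \<le> 1"
    have "S \<noteq> pverts ?G"
    proof
      assume e: "S = pverts ?G"
      \<comment> \<open>The hub, the vertex \<open>1 + r\<close> of the first branch edge and the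
        end of that edge form a path on three vertices.\<close>
      have "\<not> card (parcs ?G `` {1 + r} \<inter> S) \<le> 1"
      proof (rule card_ge_two_nbs)
        show "0 \<in> parcs ?G `` {1 + r} \<inter> S" "Suc (1 + r) \<in> parcs ?G `` {1 + r} \<inter> S"
          using S_tree_nb(3)[OF r t] t by (auto simp: e V)
      qed auto
      moreover have "1 + r \<in> S" using t by (simp add: e V)
      ultimately show False using S(2) by blast
    qed
    then have "card S < card (pverts ?G)" using S(1) fin by (intro psubset_card_mono) auto
    then show "card S \<le> r + 2 * t" by (simp add: V)
  qed (auto simp: V)
qed

lemma rho_S_tree:
  assumes r: "r \<le> 1" and t: "0 < t"
  defines "l \<equiv> rho (S_tree r t)"
  shows "1 < l" "real r + real t * (l\<^sup>2 / (l\<^sup>2 - 1)) = l\<^sup>2"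
proof -
  let ?G = "S_tree r t"
  interpret conn_graph ?G by (rule conn_S_tree[OF r])
  have V: "pverts ?G = {0..<1 + r + 2 * t}" by (rule S_tree_eq[OF r])
  obtain y where y: "\<And>v. v \<in> pverts ?G \<Longrightarrow> 0 < y v" "\<And>v. v \<in> pverts ?G \<Longrightarrow> nsum (parcs ?G) y v = l * y v"
    unfolding l_def by (rule perron_rho) blast
  note ev = y(2)[unfolded nsum_def]
  define M where "M = (\<lambda>i. 1 + r + 2 * i) ` {..<t}"
  define L where "L = (if r = 1 then {1::nat} else {})"
  have cM: "card M = t" unfolding M_def by (subst card_image) (auto simp: inj_on_def)
  have cL: "card L = r" using r by (auto simp: L_def)
  have MV: "w \<in> pverts ?G" "Suc w \<in> pverts ?G" if "w \<in> M" for w using that by (auto simp: M_def V)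
  have mid: "y 0 + y (Suc w) = l * y w" "y w = l * y (Suc w)" if w: "w \<in> M" for w
  proof -
    obtain i where i: "i < t" "w = 1 + r + 2 * i" using w by (auto simp: M_def)
    show "y 0 + y (Suc w) = l * y w" using ev[OF MV(1)[OF w]] S_tree_nb(3)[OF r i(1)] i by simp
    show "y w = l * y (Suc w)" using ev[OF MV(2)[OF w]] S_tree_nb(4)[OF r i(1)] i by simp
  qed
  have leaf: "y 0 = l * y w" if w: "w \<in> L" for w
  proof -
    have rw: "r = 1" "w = 1" using w by (auto simp: L_def split: if_splits)
    have "1 \<in> pverts ?G" unfolding V using rw(1) by simp
    from ev[OF this] show ?thesis using S_tree_nb(2)[OF r rw(1), of t] rw by simp
  qed
  have m: "1 + r \<in> M" using t by (auto simp: M_def)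
  have 0: "0 \<in> pverts ?G" by (simp add: V)
  show l1: "1 < l"
    by (rule one_less_of_pendant_path[OF y(1)[OF 0] y(1)[OF MV(1)[OF m]] y(1)[OF MV(2)[OF m]] mid[OF m]])
  have "(real (card L) + real (card M) * (l\<^sup>2 / (l\<^sup>2 - 1))) * y 0 = l * sum y (L \<union> M)"
    by (rule hub_sum_eq[where e = Suc]) (use l1 leaf mid in \<open>auto simp: L_def M_def\<close>)
  also have "sum y (L \<union> M) = l * y 0"
    using ev[OF 0] S_tree_nb(1)[OF r, of t] by (simp add: L_def M_def)
  finally have "(real r + real t * (l\<^sup>2 / (l\<^sup>2 - 1))) * y 0 = l\<^sup>2 * y 0"
    by (simp add: cM cL power2_eq_square)
  then show "real r + real t * (l\<^sup>2 / (l\<^sup>2 - 1)) = l\<^sup>2" using y(1)[OF 0] by simp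
qed

lemma rep_counts:
  assumes fin: "finite W" and R: "R \<subseteq> W" "R \<union> q ` R = W" "\<And>w. w \<in> R \<Longrightarrow> q w \<in> R \<Longrightarrow> q w = w"
    and q: "\<And>w. w \<in> W \<Longrightarrow> q (q w) = w"
  defines "L \<equiv> {w \<in> R. q w = w}" and "M \<equiv> {w \<in> R. q w \<noteq> w}"
  shows "finite L" "finite M" "W = L \<union> M \<union> q ` M" "inj_on q M" "M \<inter> q ` M = {}" "L \<inter> (M \<union> q ` M) = {}"
    "card W = card L + 2 * card M"
proof -
  show f: "finite L" "finite M" using R(1) fin unfolding L_def M_def by (auto intro: finite_subset)
  have qL: "q ` L = L" by (force simp: L_def)
  have "R = L \<union> M" by (auto simp: L_def M_def)
  then show W: "W = L \<union> M \<union> q ` M" using R(2) qL by auto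
  show i: "inj_on q M" using q R(1) unfolding M_def inj_on_def by (metis (no_types, lifting) mem_Collect_eq subsetD)
  show d1: "M \<inter> q ` M = {}" using R(3) unfolding M_def by blast
  have "q m \<notin> L" if "m \<in> M" for m using that R(3) unfolding L_def M_def by blast
  then show d2: "L \<inter> (M \<union> q ` M) = {}" unfolding L_def M_def by blast
  have "card W = card L + card (M \<union> q ` M)" unfolding W using f d2 by (subst card_Un_disjoint[symmetric]) (auto simp: Un_assoc)
  also have "card (M \<union> q ` M) = card M + card M" using f d1 i by (simp add: card_Un_disjoint card_image)
  finally show "card W = card L + 2 * card M" by simp
qed


section \<open>The trees H(n)\<close>

lemma (in conn_graph) spanning_emb_iso:
  assumes "emb (parcs G) H f (pverts G)" "conn_graph H" "rho G \<le> rho H"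
  shows "graph_iso G H"
proof -
  have "bij_betw f (pverts H) (pverts G)" "\<And>i j. (i, j) \<in> parcs H \<Longrightarrow> (f i, f j) \<in> parcs G"
    using assms(1) unfolding emb_def by blast+
  then show ?thesis using conn_graph_axioms assms(2,3) by (intro spanning_copy_iso)
qed

text \<open>Otherwise the component \<open>{w, q w}\<close> of \<open>W\<close> would be closed
  under adjacency and hence be the whole graph.\<close>

lemma (in conn_graph) partner_meets_outside:
  assumes W: "W \<subseteq> pverts G" "W \<noteq> pverts G" and w: "w \<in> W" "q w \<in> W" "q (q w) = w"
    and nb: "\<And>w z. w \<in> W \<Longrightarrow> z \<in> W \<Longrightarrow> (w, z) \<in> parcs G \<Longrightarrow> z = q w"
  shows "\<exists>x\<in>pverts G - W. (x, w) \<in> parcs G \<or> (x, q w) \<in> parcs G"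
proof (rule ccontr)
  assume n: "\<not> ?thesis"
  have "{w, q w} = pverts G"
  proof (rule closed_eq)
    fix a b assume a: "a \<in> {w, q w}" "(a, b) \<in> parcs G"
    have "b \<in> W"
    proof (rule ccontr)
      assume "b \<notin> W"
      moreover have "b \<in> pverts G" using a(2) sub by blast
      ultimately show False using n symE[OF a(2)] a(1) by blast
    qed
    moreover have "a \<in> W" using a(1) w by blast
    ultimately have "b = q a" using nb a(2) by blast
    then show "b \<in> {w, q w}" using a(1) w(3) by auto
  qed (use w W in auto)
  moreover have "{w, q w} \<subseteq> W" using w by simp
  ultimately show False using W by simp
qed

text \<open>Trading a branch edge for two leaves raises \<open>r + t * \<sigma>\<close> by
  \<open>2 - \<sigma>\<close>, but it must not exceed its value for \<open>S(r0, t0)\<close>. So no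
  trade is possible once \<open>\<sigma> < 2\<close>, that is \<open>\<rho>\<^sup>2 > 2\<close>, and
  this is what \<open>2 \<le> r0 + t0\<close> secures.\<close>

lemma (in conn_graph) S_tree_unique:
  assumes r0: "r0 \<le> 1" and t0: "2 \<le> r0 + t0" and n: "card (pverts G) = 1 + r0 + 2 * t0"
    and k: "dissociation_number G = r0 + 2 * t0"
    and le: "rho G \<le> rho (S_tree r0 t0)"
  shows "graph_iso G (S_tree r0 t0)"
proof -
  define l where "l = rho (S_tree r0 t0)"
  have t0': "0 < t0" using r0 t0 by linarith
  note lS = rho_S_tree[OF r0 t0', folded l_def]
  obtain y where y: "\<And>v. v \<in> pverts G \<Longrightarrow> 0 < y v" "\<And>v. v \<in> pverts G \<Longrightarrow> nsum (parcs G) y v = rho G * y v"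
    by (rule perron_rho) blast
  have "nsum (parcs G) y v \<le> l * y v" if "v \<in> pverts G" for v
    using y[OF that] le by (simp add: l_def mult_right_mono)
  then interpret super_graph "pverts G" "parcs G" y l
    using lS(1) y(1) by unfold_locales auto
  obtain W where W: "W \<subseteq> pverts G" "\<And>v. v \<in> W \<Longrightarrow> card (parcs G `` {v} \<inter> W) \<le> 1" "card W = r0 + 2 * t0"
    using dissociation_number_attained k by metis
  have "card (pverts G - W) = 1" using W n fin by (simp add: card_Diff_subset finite_subset)
  then obtain u where u: "pverts G - W = {u}" by (rule card_1_singletonE)
  have uV: "u \<in> pverts G" "u \<notin> W" using u by auto
  have finW: "finite W" using W(1) fin by (rule finite_subset)
  have "dissoc (parcs G) W" using W(2) by (simp add: dissoc_def)
  from partner[OF W(1) this] obtain q where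
    Q: "\<forall>w\<in>W. q w \<in> W \<and> q (q w) = w \<and> (q w \<noteq> w \<longrightarrow> (w, q w) \<in> parcs G) \<and>
      (\<forall>z\<in>W. (w, z) \<in> parcs G \<longrightarrow> z = q w)" ..
  have q: "\<And>w. w \<in> W \<Longrightarrow> q w \<in> W" "\<And>w. w \<in> W \<Longrightarrow> q (q w) = w"
    "\<And>w. w \<in> W \<Longrightarrow> q w \<noteq> w \<Longrightarrow> (w, q w) \<in> parcs G"
    "\<And>w z. w \<in> W \<Longrightarrow> z \<in> W \<Longrightarrow> (w, z) \<in> parcs G \<Longrightarrow> z = q w"
    using Q by blast+
  have uq: "(u, w) \<in> parcs G \<or> (u, q w) \<in> parcs G" if w: "w \<in> W" for w
    using partner_meets_outside[OF W(1) _ w q(1)[OF w] q(2)[OF w] q(4)] u uV by auto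
  obtain R where R: "R \<subseteq> W" "\<forall>w\<in>R. (u, w) \<in> parcs G" "R \<union> q ` R = W" "\<forall>w\<in>R. q w \<in> R \<longrightarrow> q w = w"
    using representatives[of W q "\<lambda>w. (u, w) \<in> parcs G", OF q(1,2) uq] by blast
  have R4: "q w = w" if "w \<in> R" "q w \<in> R" for w using R(4) that by blast
  define L M where "L = {w \<in> R. q w = w}" and "M = {w \<in> R. q w \<noteq> w}"
  note LM = rep_counts[OF finW R(1,3) R4 q(2), folded L_def M_def]
  have "(real (card L) + real (card M) * s) * y u \<le> l * sum y R"
    unfolding L_def M_def
  proof (rule hub_sum[OF uV(1)])
    show "R \<subseteq> parcs G `` {u}" using R(2) by blast
    show "(w, q w) \<in> parcs G \<and> q w \<noteq> u" if "w \<in> R" "q w \<noteq> w" for w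
      using q(3)[of w] q(1)[of w] that R(1) uV by blast
  qed
  also have "l * sum y R \<le> l * (l * y u)"
    using lS(1) R(2) uV by (intro mult_left_mono sum_le) auto
  finally have "(real (card L) + real (card M) * s) * y u \<le> l\<^sup>2 * y u"
    by (simp add: power2_eq_square mult.assoc)
  then have "real (card L) + real (card M) * s \<le> l\<^sup>2" using y(1)[OF uV(1)] by simp
  then have ineq: "real (card L) + real (card M) * s \<le> real r0 + real t0 * s"
    using lS(2) by (simp add: s_def)
  have s1: "1 < s" using lS(1) by (simp add: s_def)
  have "2 \<le> real r0 + real t0" using t0 by linarith
  also have "\<dots> < real r0 + real t0 * s" using s1 t0' by simp
  finally have "2 < l\<^sup>2" using lS(2) by (simp add: s_def)
  then have s2: "s < 2" by (simp add: s_def divide_less_eq)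
  have cnt: "card L + 2 * card M = r0 + 2 * t0" using LM(7) W(3) by simp
  have Mle: "card M \<le> t0"
    by (rule le_of_double_le) (use cnt r0 in linarith)
  have e: "card M = t0"
  proof (rule ccontr)
    assume "card M \<noteq> t0"
    then have "0 < real t0 - real (card M)" using Mle by simp
    then have "0 < (real t0 - real (card M)) * (2 - s)" using s2 by simp
    moreover have "real (card L) = real r0 + 2 * real t0 - 2 * real (card M)"
      using arg_cong[OF cnt, of real] by simp
    ultimately show False using ineq by (simp add: algebra_simps)
  qed
  then have cL: "card L = r0" using cnt by simp
  have base: "emb (parcs G) \<lparr> pverts = {0}, parcs = {} \<rparr> (\<lambda>_. u) {u}"
    by (rule embI[of _ 1]) auto
  have "\<exists>f. emb (parcs G) (star_base r0) f ({u} \<union> L) \<and> f 0 = u"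
  proof (cases "r0 = 0")
    case True
    then have "L = {}" using cL LM(1) by simp
    then show ?thesis using base True by (auto simp: star_base_def)
  next
    case False
    then have r1: "r0 = 1" using r0 by simp
    then obtain a where a: "L = {a}" using cL by (metis card_1_singletonE)
    then have "(u, a) \<in> parcs G" "a \<noteq> u" using R(1,2) uV by (auto simp: L_def)
    then show ?thesis
      using emb_attach_leaf[OF symE base, of 0 a] r1 a by (auto simp: star_base_def insert_commute)
  qed
  then obtain f where f: "emb (parcs G) (star_base r0) f ({u} \<union> L)" "f 0 = u" by blast
  have MR: "w \<in> W" "(u, w) \<in> parcs G" "(w, q w) \<in> parcs G" "q w \<in> W" if "w \<in> M" for w
    using that R(1,2) q(1,3) by (auto simp: M_def)
  have "\<exists>f'. emb (parcs G) ((attach_branch_edge 0 ^^ card M) (star_base r0)) f' ({u} \<union> L \<union> M \<union> q ` M) \<and>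
    (\<forall>i\<in>pverts (star_base r0). f' i = f i) \<and> pverts (star_base r0) \<subseteq> pverts ((attach_branch_edge 0 ^^ card M) (star_base r0))"
  proof (rule emb_attach_branch_edges[OF symE f(1)])
    show "0 \<in> pverts (star_base r0)" by (simp add: star_base_eq[OF r0])
    show "(M \<union> q ` M) \<inter> ({u} \<union> L) = {}" using MR(1,4) uV LM(6) by blast
  qed (use LM MR f(2) in auto)
  moreover have "{u} \<union> L \<union> M \<union> q ` M = pverts G" using u LM(3) W(1) by blast
  moreover have "(attach_branch_edge 0 ^^ card M) (star_base r0) = S_tree r0 t0"
    by (simp add: S_tree_def star_base_def e)
  ultimately obtain f' where "emb (parcs G) (S_tree r0 t0) f' (pverts G)" by auto
  then show ?thesis using spanning_emb_iso conn_S_tree[OF r0] le by blast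
qed

text \<open>The family of trees that contains \<open>H(n)\<close>, with the numbers of branch edges
  and leaves as free parameters.\<close>

definition broom :: "nat \<Rightarrow> nat \<Rightarrow> nat \<Rightarrow> nat pair_pre_digraph" where
  "broom p q r = (attach_leaf 3 ^^ r) ((attach_branch_edge 3 ^^ q) ((attach_branch_edge 0 ^^ p) (path_graph 4)))"

lemma path_graph_4_arcs: "parcs (path_graph 4) = {(0, 1), (1, 0), (1, 2), (2, 1), (2, 3), (3, 2)}"
proof -
  have "{..<3::nat} = {0, 1, 2}" by auto
  moreover have "parcs (path_graph 4) = (\<lambda>i. (i, Suc i)) ` {..<3} \<union> (\<lambda>i. (Suc i, i)) ` {..<3}"
    by (auto simp: path_graph_def)
  ultimately show ?thesis by (simp add: numeral_2_eq_2 numeral_3_eq_3 insert_commute)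
qed

lemma broom_eq:
  fixes p q r :: nat
  assumes r: "r \<le> 1"
  defines "k \<equiv> 4 + 2 * p + 2 * q"
  shows "pverts (broom p q r) = {0..<k + r}"
    "parcs (broom p q r) = {(0, 1), (1, 0), (1, 2), (2, 1), (2, 3), (3, 2)} \<union> branch_arcs 0 4 p \<union>
       branch_arcs 3 (4 + 2 * p) q \<union> (if r = 1 then {(3, k), (k, 3)} else {})"
proof -
  let ?A = "(attach_branch_edge 0 ^^ p) (path_graph 4)"
  let ?B = "(attach_branch_edge 3 ^^ q) ?A"
  have P: "pverts (path_graph 4) = {0..<4}" by (simp add: path_graph_def)
  have A: "pverts ?A = {0..<4 + 2 * p}" "parcs ?A = parcs (path_graph 4) \<union> branch_arcs 0 4 p"
    using funpow_attach_branch_edge[OF P, where v = 0 and t = p] by auto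
  have B: "pverts ?B = {0..<k}" "parcs ?B = parcs ?A \<union> branch_arcs 3 (4 + 2 * p) q"
    using funpow_attach_branch_edge[OF A(1), where v = 3 and t = q] by (auto simp: k_def)
  have k: "0 < k" by (simp add: k_def)
  have rr: "r = 0 \<or> r = 1" using r by linarith
  have C: "pverts (broom p q r) = {0..<k + r} \<and>
    parcs (broom p q r) = parcs (path_graph 4) \<union> branch_arcs 0 4 p \<union>
     branch_arcs 3 (4 + 2 * p) q \<union> (if r = 1 then {(3, k), (k, 3)} else {})"
    using rr
  proof
    assume "r = 0"
    then show ?thesis using A B by (simp add: broom_def)
  next
    assume "r = 1"
    then show ?thesis using A B attach_leaf_eq[OF B(1) k, of 3] by (simp add: broom_def)
  qed
  show "pverts (broom p q r) = {0..<k + r}" by (rule conjunct1[OF C])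
  show "parcs (broom p q r) = {(0, 1), (1, 0), (1, 2), (2, 1), (2, 3), (3, 2)} \<union> branch_arcs 0 4 p \<union>
     branch_arcs 3 (4 + 2 * p) q \<union> (if r = 1 then {(3, k), (k, 3)} else {})"
    by (rule conjunct2[OF C, unfolded path_graph_4_arcs])
qed

lemma broom_nb:
  assumes r: "r \<le> 1"
  shows "parcs (broom p q r) `` {0} = insert 1 ((\<lambda>i. 4 + 2 * i) ` {..<p})"
    and "parcs (broom p q r) `` {1} = {0, 2}"
    and "parcs (broom p q r) `` {2} = {1, 3}"
    and "parcs (broom p q r) `` {3} = insert 2 ((if r = 1 then {4 + 2 * p + 2 * q} else {}) \<union> (\<lambda>i. 4 + 2 * p + 2 * i) ` {..<q})"
    and "i < p \<Longrightarrow> parcs (broom p q r) `` {4 + 2 * i} = {0, Suc (4 + 2 * i)}"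
    and "i < p \<Longrightarrow> parcs (broom p q r) `` {Suc (4 + 2 * i)} = {4 + 2 * i}"
    and "i < q \<Longrightarrow> parcs (broom p q r) `` {4 + 2 * p + 2 * i} = {3, Suc (4 + 2 * p + 2 * i)}"
    and "i < q \<Longrightarrow> parcs (broom p q r) `` {Suc (4 + 2 * p + 2 * i)} = {4 + 2 * p + 2 * i}"
    and "r = 1 \<Longrightarrow> parcs (broom p q r) `` {4 + 2 * p + 2 * q} = {3}"
proof -
  define k where "k = 4 + 2 * p + 2 * q"
  note N = broom_eq(2)[OF r, of p q, folded k_def]
  have P: "{(0, 1), (1, 0), (1, 2), (2, 1), (2, 3), (3, 2)} `` {w} =
    (if w = 0 then {1} else if w = 1 then {0, 2} else if w = 2 then {1, 3} else if w = 3 then {2} else {})" for w :: nat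
    by auto
  have K: "(if r = 1 then {(3, k), (k, 3)} else {}) `` {w} =
    (if r = 1 \<and> w = 3 then {k} else if r = 1 \<and> w = k then {3} else {})" for w
    by (auto simp: k_def)
  have D: "parcs (broom p q r) `` {w} =
    (if w = 0 then {1} else if w = 1 then {0, 2} else if w = 2 then {1, 3} else if w = 3 then {2} else {})
    \<union> branch_arcs 0 4 p `` {w} \<union> branch_arcs 3 (4 + 2 * p) q `` {w}
    \<union> (if r = 1 \<and> w = 3 then {k} else if r = 1 \<and> w = k then {3} else {})" for w
    unfolding N Un_Image P K ..
  show "parcs (broom p q r) `` {0} = insert 1 ((\<lambda>i. 4 + 2 * i) ` {..<p})"
    unfolding D by (simp add: branch_arcs_hub branch_arcs_other k_def)
  show "parcs (broom p q r) `` {1} = {0, 2}" "parcs (broom p q r) `` {2} = {1, 3}"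
    unfolding D by (simp_all add: branch_arcs_other k_def)
  show "parcs (broom p q r) `` {3} = insert 2 ((if r = 1 then {4 + 2 * p + 2 * q} else {}) \<union> (\<lambda>i. 4 + 2 * p + 2 * i) ` {..<q})"
    unfolding D by (auto simp: branch_arcs_other branch_arcs_hub k_def)
  show "parcs (broom p q r) `` {4 + 2 * i} = {0, Suc (4 + 2 * i)}" if i: "i < p"
    using i branch_arcs_mid[of 0 4 i p] branch_arcs_other[of 3 "4 + 2 * p" "4 + 2 * i" q]
    unfolding D by (auto simp: k_def)
  show "parcs (broom p q r) `` {Suc (4 + 2 * i)} = {4 + 2 * i}" if i: "i < p"
    using i branch_arcs_end[of 0 4 i p] branch_arcs_other[of 3 "4 + 2 * p" "Suc (4 + 2 * i)" q]
    unfolding D by (auto simp: k_def)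
  show "parcs (broom p q r) `` {4 + 2 * p + 2 * i} = {3, Suc (4 + 2 * p + 2 * i)}" if i: "i < q"
    using i branch_arcs_mid[of 3 "4 + 2 * p" i q] branch_arcs_beyond[of 0 4 p "4 + 2 * p + 2 * i"]
    unfolding D by (auto simp: k_def)
  show "parcs (broom p q r) `` {Suc (4 + 2 * p + 2 * i)} = {4 + 2 * p + 2 * i}" if i: "i < q"
  proof -
    have "Suc (4 + 2 * p + 2 * i) \<noteq> k" unfolding k_def by presburger
    then show ?thesis
      using i branch_arcs_end[of 3 "4 + 2 * p" i q] branch_arcs_beyond[of 0 4 p "Suc (4 + 2 * p + 2 * i)"]
      unfolding D by auto
  qed
  show "parcs (broom p q r) `` {4 + 2 * p + 2 * q} = {3}" if "r = 1"
    using that branch_arcs_beyond[of 3 "4 + 2 * p" q k] branch_arcs_beyond[of 0 4 p k]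
    unfolding D by (auto simp: k_def)
qed

lemma broom_vertex_cases:
  assumes r: "r \<le> 1" and w: "w \<in> pverts (broom p q r)"
  obtains "w = 0" | "w = 1" | "w = 2" | "w = 3" | i where "i < p" "w = 4 + 2 * i" | i where "i < p" "w = Suc (4 + 2 * i)"
    | i where "i < q" "w = 4 + 2 * p + 2 * i" | i where "i < q" "w = Suc (4 + 2 * p + 2 * i)"
    | "r = 1" "w = 4 + 2 * p + 2 * q"
proof -
  have lt: "w < 4 + 2 * p + 2 * q + r" using w by (simp add: broom_eq[OF r])
  consider "w < 4" | "4 \<le> w" "w < 4 + 2 * p" | "4 + 2 * p \<le> w" "w < 4 + 2 * p + 2 * q" | "4 + 2 * p + 2 * q \<le> w"
    by linarith
  then show thesis
  proof cases
    case 1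
    then have "w = 0 \<or> w = 1 \<or> w = 2 \<or> w = 3" by linarith
    then show thesis using that(1-4) by blast
  next
    case 2
    then show thesis using branch_vertex_cases[OF 2] that(5,6) by blast
  next
    case 3
    then show thesis using branch_vertex_cases[OF 3] that(7,8) by blast
  next
    case 4
    then have "r = 1" "w = 4 + 2 * p + 2 * q" using lt r by linarith+
    then show thesis by (rule that(9))
  qed
qed

lemma conn_broom:
  assumes r: "r \<le> 1"
  shows "conn_graph (broom p q r)"
proof -
  let ?G = "broom p q r"
  let ?k = "4 + 2 * p + 2 * q + r"
  have V: "pverts ?G = {0..<?k}" by (rule broom_eq[OF r])
  have sg: "sgraph (pverts ?G) (parcs ?G)"
  proof
    show "finite (pverts ?G)" by (simp add: V)
    show "parcs ?G \<subseteq> pverts ?G \<times> pverts ?G"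
      using branch_arcs_sub[of _ _ 0 4 p ?k] branch_arcs_sub[of _ _ 3 "4 + 2 * p" q ?k]
      by (auto simp: broom_eq[OF r] split: if_splits)
    show "(b, a) \<in> parcs ?G" if "(a, b) \<in> parcs ?G" for a b
      using that branch_arcs_sym[of a b 0 4 p] branch_arcs_sym[of a b 3 "4 + 2 * p" q]
      unfolding broom_eq[OF r] by (auto split: if_splits)
    show "(a, a) \<notin> parcs ?G" for a
      using branch_arcs_irr[of 0 4 a p] branch_arcs_irr[of 3 "4 + 2 * p" a q] unfolding broom_eq[OF r] by auto
  qed
  have "cut_connected (pverts ?G) (parcs ?G)"
  proof (rule sgraph.cut_connectedI[OF sg, of 0 "\<lambda>v. v"])
    show "0 \<in> pverts ?G" by (simp add: V)
    fix w assume w: "w \<in> pverts ?G" "w \<noteq> 0"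
    have *: "\<exists>z. (w, z) \<in> parcs ?G \<and> z < w" if "z \<in> parcs ?G `` {w}" "z < w" for z
      using that by blast
    show "\<exists>z. (w, z) \<in> parcs ?G \<and> z < w"
      using r w(1)
    proof (cases rule: broom_vertex_cases)
      case 1 then show ?thesis using w(2) by simp
    next
      case 2 show ?thesis unfolding 2 by (rule *[of 0, unfolded 2]) (simp_all add: broom_nb(2)[OF r, simplified])
    next
      case 3 show ?thesis by (rule *[of 1]) (simp_all add: 3 broom_nb(3)[OF r])
    next
      case 4 show ?thesis by (rule *[of 2]) (simp_all add: 4 broom_nb(4)[OF r])
    next
      case (5 i) show ?thesis by (rule *[of 0]) (use broom_nb(5)[OF r 5(1)] 5 in simp_all)
    next
      case (6 i) show ?thesis by (rule *[of "4 + 2 * i"]) (use broom_nb(6)[OF r 6(1)] 6 in simp_all)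
    next
      case (7 i) show ?thesis by (rule *[of 3]) (use broom_nb(7)[OF r 7(1)] 7 in simp_all)
    next
      case (8 i) show ?thesis by (rule *[of "4 + 2 * p + 2 * i"]) (use broom_nb(8)[OF r 8(1)] 8 in simp_all)
    next
      case 9 show ?thesis by (rule *[of 3]) (use broom_nb(9)[OF r 9(1)] 9 in simp_all)
    qed
  qed
  then show ?thesis using sg by (simp add: conn_graph_def pair_graph_iff_sgraph)
qed

text \<open>Lower bound: delete the hubs 0 and 3. Upper bound: each of the disjoint three-vertex
  paths 1, 0, 4 and 2, 3, \<open>4 + 2 * p\<close> must lose a vertex.\<close>

lemma dissociation_number_broom:
  assumes r: "r \<le> 1" and pq: "0 < p" "0 < q"
  shows "dissociation_number (broom p q r) = 2 + 2 * p + 2 * q + r"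
proof -
  let ?G = "broom p q r"
  interpret conn_graph ?G by (rule conn_broom[OF r])
  have V: "pverts ?G = {0..<4 + 2 * p + 2 * q + r}" by (rule broom_eq[OF r])
  show ?thesis
  proof (rule dissociation_numberI[of "pverts ?G - {0, 3}"])
    have "card (pverts ?G - {0, 3}) = card (pverts ?G) - card {0, 3::nat}"
      by (rule card_Diff_subset) (auto simp: V)
    then show "2 + 2 * p + 2 * q + r \<le> card (pverts ?G - {0, 3})" by (simp add: V)
    fix w assume w: "w \<in> pverts ?G - {0, 3}"
    have *: "card (parcs ?G `` {w} \<inter> (pverts ?G - {0, 3})) \<le> 1" if "parcs ?G `` {w} \<subseteq> {0, 3, a}" for a
      by (rule card_le_1_of_subset[of _ a]) (use that in auto)
    from w have "w \<in> pverts ?G" by simp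
    with r show "card (parcs ?G `` {w} \<inter> (pverts ?G - {0, 3})) \<le> 1"
    proof (cases rule: broom_vertex_cases)
      case 1 then show ?thesis using w by simp
    next
      case 2 show ?thesis by (rule *[of 2]) (use broom_nb(2)[OF r, of p q] 2 in simp)
    next
      case 3 show ?thesis by (rule *[of 1]) (use broom_nb(3)[OF r, of p q] 3 in simp)
    next
      case 4 then show ?thesis using w by simp
    next
      case (5 i) show ?thesis by (rule *[of "Suc (4 + 2 * i)"]) (use broom_nb(5)[OF r 5(1), of q] 5 in simp)
    next
      case (6 i) show ?thesis by (rule *[of "4 + 2 * i"]) (use broom_nb(6)[OF r 6(1), of q] 6 in simp)
    next
      case (7 i) show ?thesis by (rule *[of "Suc (4 + 2 * p + 2 * i)"]) (use broom_nb(7)[OF r 7(1), of p] 7 in simp)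
    next
      case (8 i) show ?thesis by (rule *[of "4 + 2 * p + 2 * i"]) (use broom_nb(8)[OF r 8(1), of p] 8 in simp)
    next
      case 9 show ?thesis by (rule *[of 3]) (use broom_nb(9)[OF r 9(1), of p q] 9 in simp)
    qed
  next
    fix S assume S: "S \<subseteq> pverts ?G" "\<And>v. v \<in> S \<Longrightarrow> card (parcs ?G `` {v} \<inter> S) \<le> 1"
    have miss: "\<exists>x\<in>{a, b, c}. x \<notin> S" if "{b, c} \<subseteq> parcs ?G `` {a}" "b \<noteq> c" for a b c
    proof (rule ccontr)
      assume n: "\<not> ?thesis"
      then have "\<not> card (parcs ?G `` {a} \<inter> S) \<le> 1"
        using that by (intro card_ge_two_nbs[of b _ c]) auto
      then show False using S(2)[of a] n by blast
    qed
    have "{1, 4} \<subseteq> parcs ?G `` {0}" "(1::nat) \<noteq> 4"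
      using broom_nb(1)[OF r, of p q] pq by auto
    from miss[OF this] obtain x where x: "x \<in> {0, 1, 4}" "x \<notin> S" by blast
    have "{2, 4 + 2 * p} \<subseteq> parcs ?G `` {3}" "2 \<noteq> 4 + 2 * p"
      using broom_nb(4)[OF r, of p q] pq by auto
    from miss[OF this] obtain z where z: "z \<in> {3, 2, 4 + 2 * p}" "z \<notin> S" by blast
    have xz: "x \<noteq> z" "x \<in> pverts ?G" "z \<in> pverts ?G" using x z pq by (auto simp: V)
    have "card S \<le> card (pverts ?G - {x, z})"
      using S(1) x z fin by (intro card_mono) auto
    also have "\<dots> = card (pverts ?G) - card {x, z}" using xz by (intro card_Diff_subset) auto
    finally show "card S \<le> 2 + 2 * p + 2 * q + r" using xz by (simp add: V)
  qed auto
qed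

text \<open>Eliminating leaves, branch edges and the two middle vertices from the Perron equations
  leaves one equation per hub, \<open>A\<close> and \<open>B\<close>, which are multiplied. The
  first factor is positive because \<open>y\<close> is.\<close>

lemma broom_equation_rho:
  assumes pq: "q \<le> p" "p \<le> Suc q" "2 \<le> p" and r: "r \<le> 1"
  defines "l \<equiv> rho (broom p q r)"
  shows "1 < l" "broom_equation p q r (l\<^sup>2) (l\<^sup>2 / (l\<^sup>2 - 1))"
proof -
  let ?G = "broom p q r"
  let ?k = "4 + 2 * p + 2 * q"
  interpret conn_graph ?G by (rule conn_broom[OF r])
  have V: "pverts ?G = {0..<?k + r}" by (rule broom_eq[OF r])
  obtain y where y: "\<And>v. v \<in> pverts ?G \<Longrightarrow> 0 < y v" "\<And>v. v \<in> pverts ?G \<Longrightarrow> nsum (parcs ?G) y v = l * y v"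
    unfolding l_def by (rule perron_rho) blast
  note ev = y(2)[unfolded nsum_def]
  define M where "M = (\<lambda>i. 4 + 2 * i) ` {..<p}"
  define M' where "M' = (\<lambda>i. 4 + 2 * p + 2 * i) ` {..<q}"
  define L where "L = (if r = 1 then {?k} else {})"
  have c: "card M = p" "card M' = q" unfolding M_def M'_def by (subst card_image; auto simp: inj_on_def)+
  have cL: "card L = r" using r by (auto simp: L_def)
  have disj: "L \<inter> M' = {}" by (auto simp: L_def M'_def)
  have hubs: "0 \<in> pverts ?G" "1 \<in> pverts ?G" "2 \<in> pverts ?G" "3 \<in> pverts ?G" by (auto simp: V)
  have MV: "w \<in> pverts ?G" "Suc w \<in> pverts ?G" if "w \<in> M" for w using that by (auto simp: M_def V)
  have MV': "w \<in> pverts ?G" "Suc w \<in> pverts ?G" if "w \<in> M'" for w using that by (auto simp: M'_def V)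
  have mid: "y 0 + y (Suc w) = l * y w" "y w = l * y (Suc w)" if w: "w \<in> M" for w
  proof -
    obtain i where i: "i < p" "w = 4 + 2 * i" using w by (auto simp: M_def)
    show "y 0 + y (Suc w) = l * y w" using ev[OF MV(1)[OF w]] broom_nb(5)[OF r i(1), of q] i by simp
    show "y w = l * y (Suc w)" using ev[OF MV(2)[OF w]] broom_nb(6)[OF r i(1), of q] i by simp
  qed
  have mid': "y 3 + y (Suc w) = l * y w" "y w = l * y (Suc w)" if w: "w \<in> M'" for w
  proof -
    obtain i where i: "i < q" "w = 4 + 2 * p + 2 * i" using w by (auto simp: M'_def)
    show "y 3 + y (Suc w) = l * y w" using ev[OF MV'(1)[OF w]] broom_nb(7)[OF r i(1), of p] i by simp
    show "y w = l * y (Suc w)" using ev[OF MV'(2)[OF w]] broom_nb(8)[OF r i(1), of p] i by simp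
  qed
  have leaf: "y 3 = l * y w" if w: "w \<in> L" for w
  proof -
    have rw: "r = 1" "w = ?k" using w by (auto simp: L_def split: if_splits)
    have "w \<in> pverts ?G" unfolding V using rw by simp
    from ev[OF this] show ?thesis using broom_nb(9)[OF r rw(1), of p q] rw(2) by simp
  qed
  have m: "4 \<in> M" using pq by (auto simp: M_def)
  show l1: "1 < l"
    by (rule one_less_of_pendant_path[OF y(1)[OF hubs(1)] y(1)[OF MV(1)[OF m]] y(1)[OF MV(2)[OF m]] mid[OF m]])
  define s where "s = l\<^sup>2 / (l\<^sup>2 - 1)"
  have mm: "y 0 + y 2 = l * y 1" "y 1 + y 3 = l * y 2"
    using ev[OF hubs(2)] ev[OF hubs(3)] broom_nb(2,3)[OF r, of p q] by simp_all
  have m1: "s * y 0 + s / l * y 3 = l * y 1"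
    unfolding s_def by (rule middle_eq[OF l1 mm])
  have m2: "s * y 3 + s / l * y 0 = l * y 2"
    unfolding s_def by (rule middle_eq[OF l1, of _ "y 1"]) (use mm in simp_all)
  have "(real (card ({} :: nat set)) + real (card M) * s) * y 0 = l * sum y ({} \<union> M)"
    unfolding s_def by (rule hub_sum_eq[where e = Suc]) (use l1 mid in \<open>auto simp: M_def\<close>)
  moreover have "y 1 + sum y M = l * y 0"
  proof -
    have "1 \<notin> M" by (auto simp: M_def)
    then show ?thesis using ev[OF hubs(1)] broom_nb(1)[OF r, of p q] by (simp add: M_def)
  qed
  then have "l * y 1 + l * sum y M = l\<^sup>2 * y 0" by (simp add: power2_eq_square flip: distrib_left)
  ultimately have "s * y 0 + s / l * y 3 + real p * s * y 0 = l\<^sup>2 * y 0" using m1 c by simp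
  then have A: "(l\<^sup>2 - (real p + 1) * s) * y 0 = s / l * y 3" by (simp add: algebra_simps)
  have "(real (card L) + real (card M') * s) * y 3 = l * sum y (L \<union> M')"
    unfolding s_def by (rule hub_sum_eq[where e = Suc]) (use l1 mid' leaf disj in \<open>auto simp: M'_def L_def\<close>)
  moreover have "y 2 + sum y (L \<union> M') = l * y 3"
  proof -
    have "2 \<notin> L \<union> M'" "finite (L \<union> M')" by (auto simp: M'_def L_def)
    moreover have "parcs ?G `` {3} = insert 2 (L \<union> M')" using broom_nb(4)[OF r, of p q] by (simp add: M'_def L_def)
    ultimately show ?thesis using ev[OF hubs(4)] by simp
  qed
  then have "l * y 2 + l * sum y (L \<union> M') = l\<^sup>2 * y 3" by (simp add: power2_eq_square flip: distrib_left)
  ultimately have "s * y 3 + s / l * y 0 + (real r + real q * s) * y 3 = l\<^sup>2 * y 3" using m2 c cL by simp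
  then have B: "(l\<^sup>2 - real r - (real q + 1) * s) * y 3 = s / l * y 0" by (simp add: algebra_simps)
  have s: "0 < s" using l1 by (simp add: s_def)
  have sl: "0 < s / l" using s l1 by simp
  have y03: "0 < y 0" "0 < y 3" using y(1) hubs by blast+
  have pos: "0 < l\<^sup>2 - (real p + 1) * s"
    using hub_product(1)[OF y03 sl, of "l\<^sup>2 - (real p + 1) * s" "l\<^sup>2 - real r - (real q + 1) * s"] A B by simp
  have "((l\<^sup>2 - (real p + 1) * s) * y 0) * ((l\<^sup>2 - real r - (real q + 1) * s) * y 3) = (s / l * y 3) * (s / l * y 0)"
    unfolding A B ..
  then have "((l\<^sup>2 - (real p + 1) * s) * (l\<^sup>2 - real r - (real q + 1) * s)) * (y 0 * y 3) = s\<^sup>2 / l\<^sup>2 * (y 0 * y 3)"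
    by (simp add: power2_eq_square mult_ac)
  then have "(l\<^sup>2 - (real p + 1) * s) * (l\<^sup>2 - real r - (real q + 1) * s) = s\<^sup>2 / l\<^sup>2"
    by (rule mult_right_cancel[THEN iffD1, rotated]) (use y03 in simp)
  then show "broom_equation p q r (l\<^sup>2) (l\<^sup>2 / (l\<^sup>2 - 1))"
    using pq r pos l1 unfolding s_def by unfold_locales auto
qed


section \<open>Uniqueness of H(n)\<close>

text \<open>\<open>M\<close> and \<open>M'\<close> hold the inner vertices of the branch edges at
  \<open>u\<close> and \<open>v\<close>, \<open>e\<close> leads to their ends, and \<open>L\<close>
  holds the leaf at \<open>v\<close>, if any.\<close>

lemma (in sgraph) broom_emb:
  assumes path: "(u, b) \<in> E" "(b, c) \<in> E" "(c, v) \<in> E" and dist: "distinct [u, b, c, v]"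
    and fin': "finite M" "finite M'" "finite L" and cL: "card L \<le> 1"
    and nb: "\<And>w. w \<in> M \<Longrightarrow> (u, w) \<in> E" "\<And>w. w \<in> M' \<union> L \<Longrightarrow> (v, w) \<in> E"
    and e: "\<And>w. w \<in> M \<union> M' \<Longrightarrow> (w, e w) \<in> E" "inj_on e (M \<union> M')" "(M \<union> M') \<inter> e ` (M \<union> M') = {}" "M \<inter> M' = {}"
    and disj: "{u, b, c, v} \<inter> (M \<union> M' \<union> e ` (M \<union> M') \<union> L) = {}" "L \<inter> (M \<union> M' \<union> e ` (M \<union> M')) = {}"
  shows "\<exists>f. emb E (broom (card M) (card M') (card L)) f ({u, b, c, v} \<union> M \<union> M' \<union> e ` (M \<union> M') \<union> L)"
proof -
  let ?P = "path_graph 4"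
  let ?A = "(attach_branch_edge 0 ^^ card M) ?P"
  let ?B = "(attach_branch_edge 3 ^^ card M') ?A"
  have vP: "pverts ?P = {0..<4}" by (simp add: path_graph_def)
  define f0 where "f0 = (\<lambda>i. [u, b, c, v] ! i)"
  have f0: "emb E ?P f0 {u, b, c, v}"
  proof (rule embI[OF vP])
    show "bij_betw f0 {0..<4} {u, b, c, v}"
      using bij_betw_nth0[OF dist] by (simp add: f0_def numeral_eq_Suc)
    show "parcs ?P \<subseteq> {0..<4} \<times> {0..<4}" by (auto simp: path_graph_def)
    fix i j assume "(i, j) \<in> parcs ?P"
    then consider "i = 0" "j = 1" | "i = 1" "j = 0" | "i = 1" "j = 2" | "i = 2" "j = 1" | "i = 2" "j = 3" | "i = 3" "j = 2"
      unfolding path_graph_4_arcs by blast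
    then show "(f0 i, f0 j) \<in> E"
      by cases (use path symE[OF path(1)] symE[OF path(2)] symE[OF path(3)] in \<open>simp_all add: f0_def\<close>)
  qed simp
  have f00: "f0 0 = u" "f0 3 = v" by (simp_all add: f0_def)
  have "\<exists>f1. emb E ?A f1 ({u, b, c, v} \<union> M \<union> e ` M) \<and> (\<forall>i\<in>pverts ?P. f1 i = f0 i) \<and> pverts ?P \<subseteq> pverts ?A"
  proof (rule emb_attach_branch_edges[OF symE f0])
    show "inj_on e M" using e(2) by (rule inj_on_subset) simp
    show "M \<inter> e ` M = {}" using e(3) by blast
    show "(M \<union> e ` M) \<inter> {u, b, c, v} = {}" using disj(1) by blast
  qed (use fin' nb(1) e(1) f00 vP in auto)
  then obtain f1 where f1: "emb E ?A f1 ({u, b, c, v} \<union> M \<union> e ` M)" "\<forall>i\<in>pverts ?P. f1 i = f0 i" "pverts ?P \<subseteq> pverts ?A"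
    by blast
  have 3: "3 \<in> pverts ?P" using vP by simp
  have f13: "f1 3 = v" using f1(2) f00(2) 3 by simp
  have "\<exists>f2. emb E ?B f2 (({u, b, c, v} \<union> M \<union> e ` M) \<union> M' \<union> e ` M') \<and> (\<forall>i\<in>pverts ?A. f2 i = f1 i) \<and> pverts ?A \<subseteq> pverts ?B"
  proof (rule emb_attach_branch_edges[OF symE f1(1)])
    show "3 \<in> pverts ?A" using 3 f1(3) by blast
    show "inj_on e M'" using e(2) by (rule inj_on_subset) simp
    show "M' \<inter> e ` M' = {}" using e(3) by blast
    have "e ` M \<inter> e ` M' = {}" using e(2,4) by (metis Un_upper1 Un_upper2 image_empty inj_on_image_Int)
    then show "(M' \<union> e ` M') \<inter> ({u, b, c, v} \<union> M \<union> e ` M) = {}" using disj(1) e(3,4) by blast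
    show "(f1 3, w) \<in> E" if "w \<in> M'" for w using that nb(2) f13 by simp
    show "(w, e w) \<in> E" if "w \<in> M'" for w using that e(1) by simp
  qed (use fin' in auto)
  then obtain f2 where f2: "emb E ?B f2 (({u, b, c, v} \<union> M \<union> e ` M) \<union> M' \<union> e ` M')" "\<forall>i\<in>pverts ?A. f2 i = f1 i" "pverts ?A \<subseteq> pverts ?B"
    by blast
  define X where "X = ({u, b, c, v} \<union> M \<union> e ` M) \<union> M' \<union> e ` M'"
  have X: "{u, b, c, v} \<union> M \<union> M' \<union> e ` (M \<union> M') = X" by (auto simp: X_def)
  have 3: "3 \<in> pverts ?A" "3 \<in> pverts ?B" using 3 f1(3) f2(3) by blast+
  have f23: "f2 3 = v" using f2(2) f13 3 by simp
  show ?thesis unfolding X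
  proof (cases "card L = 0")
    case True
    then have "L = {}" using fin' by simp
    then show "\<exists>f. emb E (broom (card M) (card M') (card L)) f (X \<union> L)"
      using f2(1) by (auto simp: broom_def X_def)
  next
    case False
    then have c1: "card L = 1" using cL by simp
    then obtain a where a: "L = {a}" by (rule card_1_singletonE)
    have "a \<notin> X" using disj a unfolding X[symmetric] by blast
    moreover have "(f2 3, a) \<in> E" using nb(2) a f23 by simp
    ultimately have "\<exists>f. emb E (attach_leaf 3 ?B) f (insert a X)"
      using emb_attach_leaf[OF symE f2(1)[folded X_def] 3(2), of a] by blast
    then show "\<exists>f. emb E (broom (card M) (card M') (card L)) f (X \<union> L)"
      using c1 a by (simp add: broom_def)
  qed
qed

text \<open>
  \<open>u\<close> and \<open>v\<close> are the two vertices outside a maximum dissociation set \<open>W\<close>, whose components are the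
  sets \<open>{w, \<pi> w}\<close>.  The rest of the locale excludes all connections between \<open>u\<close> and \<open>v\<close> other than a path
  through two vertices of \<open>W\<close>.
\<close>

locale two_hubs = conn_graph G + super_graph "pverts G" "parcs G" y "rho (broom p q r)"
  for G :: "'a pair_pre_digraph" and y :: "'a \<Rightarrow> real" and p q r :: nat +
  fixes u v :: 'a and W :: "'a set" and \<pi> :: "'a \<Rightarrow> 'a"
  assumes pq: "q \<le> p" "p \<le> Suc q" "2 \<le> p" and r: "r \<le> 1"
    and order: "card (pverts G) = 4 + 2 * p + 2 * q + r"
    and le: "rho G \<le> rho (broom p q r)"
    and W: "W \<subseteq> pverts G" "pverts G - W = {u, v}" "u \<noteq> v"
    and \<pi>: "\<And>w. w \<in> W \<Longrightarrow> \<pi> w \<in> W" "\<And>w. w \<in> W \<Longrightarrow> \<pi> (\<pi> w) = w"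
      "\<And>w. w \<in> W \<Longrightarrow> \<pi> w \<noteq> w \<Longrightarrow> (w, \<pi> w) \<in> parcs G"
      "\<And>w z. w \<in> W \<Longrightarrow> z \<in> W \<Longrightarrow> (w, z) \<in> parcs G \<Longrightarrow> z = \<pi> w"
begin

abbreviation \<mu> :: real where "\<mu> \<equiv> rho (broom p q r)"

sublocale eqn: broom_equation p q r "\<mu>\<^sup>2" "\<mu>\<^sup>2 / (\<mu>\<^sup>2 - 1)"
  by (rule broom_equation_rho[OF pq r])

lemma uvW: "u \<in> pverts G" "v \<in> pverts G" "u \<notin> W" "v \<notin> W" "finite W"
  using W fin by (auto intro: finite_subset)

lemma card_W: "card W = 2 + 2 * p + 2 * q + r"
proof -
  have "card (pverts G - W) = card (pverts G) - card W" using W(1) uvW(5) by (simp add: card_Diff_subset)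
  moreover have "card (pverts G - W) = 2" using W by simp
  ultimately show ?thesis using order by linarith
qed

text \<open>\<open>C\<close> is the part of \<open>W\<close> reserved for the link between the hubs.
  Every other component is adjacent to \<open>u\<close> or \<open>v\<close> by connectedness and is
  assigned to one of them, to \<open>u\<close> if its representative is adjacent to both.\<close>

lemma hub_assignment:
  assumes C: "C \<subseteq> W" "\<And>w. w \<in> C \<Longrightarrow> \<pi> w \<in> C"
  shows "\<exists>R R'. R \<inter> R' = {} \<and> R \<subseteq> parcs G `` {u} \<and> R' \<subseteq> parcs G `` {v} \<and> R \<union> R' \<subseteq> W - C \<and>
    (R \<union> R') \<union> \<pi> ` (R \<union> R') = W - C \<and> (\<forall>w\<in>R \<union> R'. \<pi> w \<in> R \<union> R' \<longrightarrow> \<pi> w = w)"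
proof -
  have 1: "\<pi> w \<in> W - C" if w: "w \<in> W - C" for w
  proof -
    have wW: "w \<in> W" "w \<notin> C" using w by blast+
    then have "\<pi> w \<notin> C" using \<pi>(2)[OF wW(1)] C(2)[of "\<pi> w"] by auto
    then show ?thesis using \<pi>(1)[OF wW(1)] by blast
  qed
  have 2: "\<pi> (\<pi> w) = w" if "w \<in> W - C" for w using \<pi>(2) that by blast
  have P: "((u, w) \<in> parcs G \<or> (v, w) \<in> parcs G) \<or> ((u, \<pi> w) \<in> parcs G \<or> (v, \<pi> w) \<in> parcs G)"
    if w: "w \<in> W - C" for w
  proof -
    have "W \<noteq> pverts G" using uvW by blast
    moreover have "w \<in> W" using w by blast
    ultimately have "\<exists>x\<in>pverts G - W. (x, w) \<in> parcs G \<or> (x, \<pi> w) \<in> parcs G"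
      using partner_meets_outside[OF W(1), of w \<pi>] \<pi> by blast
    then show ?thesis unfolding W(2) by blast
  qed
  obtain R where R: "R \<subseteq> W - C" "\<forall>w\<in>R. (u, w) \<in> parcs G \<or> (v, w) \<in> parcs G" "R \<union> \<pi> ` R = W - C"
    "\<forall>w\<in>R. \<pi> w \<in> R \<longrightarrow> \<pi> w = w"
    using representatives[of "W - C" \<pi> "\<lambda>w. (u, w) \<in> parcs G \<or> (v, w) \<in> parcs G", OF 1 2 P] by blast
  define R1 R2 where "R1 = {w \<in> R. (u, w) \<in> parcs G}" and "R2 = {w \<in> R. (u, w) \<notin> parcs G}"
  have RR: "R1 \<union> R2 = R" by (auto simp: R1_def R2_def)
  have "R1 \<inter> R2 = {}" "R1 \<subseteq> parcs G `` {u}" by (auto simp: R1_def R2_def)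
  moreover have "R2 \<subseteq> parcs G `` {v}" using R(2) unfolding R2_def by blast
  ultimately have "R1 \<inter> R2 = {} \<and> R1 \<subseteq> parcs G `` {u} \<and> R2 \<subseteq> parcs G `` {v} \<and> R1 \<union> R2 \<subseteq> W - C \<and>
    (R1 \<union> R2) \<union> \<pi> ` (R1 \<union> R2) = W - C \<and> (\<forall>w\<in>R1 \<union> R2. \<pi> w \<in> R1 \<union> R2 \<longrightarrow> \<pi> w = w)"
    unfolding RR using R(1,3,4) by simp
  then show ?thesis by (intro exI)
qed

text \<open>Splits the assigned components by hub (primed for \<open>v\<close>) and by kind
  (\<open>L\<close> for leaves, \<open>M\<close> for branch edges). The last two conclusions are the
  hub inequalities, with the value at the link \<open>c\<close> still to be estimated.\<close>

lemma hub_data: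
  assumes C: "C \<subseteq> W" "\<And>w. w \<in> C \<Longrightarrow> \<pi> w \<in> C"
  obtains L L' M M' where
    "finite L" "finite L'" "finite M" "finite M'" "L \<inter> L' = {}" "M \<inter> M' = {}"
    "\<And>w. w \<in> L \<union> M \<Longrightarrow> (u, w) \<in> parcs G" "\<And>w. w \<in> L' \<union> M' \<Longrightarrow> (v, w) \<in> parcs G"
    "\<And>w. w \<in> M \<union> M' \<Longrightarrow> (w, \<pi> w) \<in> parcs G" "inj_on \<pi> (M \<union> M')" "(M \<union> M') \<inter> \<pi> ` (M \<union> M') = {}"
    "(L \<union> L') \<inter> ((M \<union> M') \<union> \<pi> ` (M \<union> M')) = {}" "W - C = (L \<union> L') \<union> (M \<union> M') \<union> \<pi> ` (M \<union> M')"
    "card W - card C = card L + card L' + 2 * (card M + card M')"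
    "\<And>c. (u, c) \<in> parcs G \<Longrightarrow> c \<notin> W - C \<Longrightarrow>
      \<mu> * y c \<le> (\<mu>\<^sup>2 - real (card L) - real (card M) * s) * y u"
    "\<And>c. (v, c) \<in> parcs G \<Longrightarrow> c \<notin> W - C \<Longrightarrow>
      \<mu> * y c \<le> (\<mu>\<^sup>2 - real (card L') - real (card M') * s) * y v"
proof -
  obtain R R' where R: "R \<inter> R' = {}" "R \<subseteq> parcs G `` {u}" "R' \<subseteq> parcs G `` {v}" "R \<union> R' \<subseteq> W - C"
    "(R \<union> R') \<union> \<pi> ` (R \<union> R') = W - C" "\<forall>w\<in>R \<union> R'. \<pi> w \<in> R \<union> R' \<longrightarrow> \<pi> w = w"
    using hub_assignment[OF C] by blast
  define L L' M M' where "L = {w \<in> R. \<pi> w = w}" and "L' = {w \<in> R'. \<pi> w = w}"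
    and "M = {w \<in> R. \<pi> w \<noteq> w}" and "M' = {w \<in> R'. \<pi> w \<noteq> w}"
  have LL: "{w \<in> R \<union> R'. \<pi> w = w} = L \<union> L'" and MM: "{w \<in> R \<union> R'. \<pi> w \<noteq> w} = M \<union> M'"
    by (auto simp: L_def L'_def M_def M'_def)
  have finWC: "finite (W - C)" using uvW(5) by simp
  have R6: "\<pi> w = w" if "w \<in> R \<union> R'" "\<pi> w \<in> R \<union> R'" for w using R(6) that by blast
  have \<pi>2: "\<pi> (\<pi> w) = w" if "w \<in> W - C" for w using \<pi>(2) that by blast
  note cnt = rep_counts[OF finWC R(4,5) R6 \<pi>2, unfolded LL MM]
  have finC: "finite C" using C(1) uvW(5) by (rule finite_subset)
  have d: "L \<inter> L' = {}" "M \<inter> M' = {}" using R(1) by (auto simp: L_def L'_def M_def M'_def)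
  have ff: "finite L" "finite L'" "finite M" "finite M'" using cnt(1,2) by auto
  have \<pi>3: "(w, \<pi> w) \<in> parcs G \<and> \<pi> w \<noteq> u \<and> \<pi> w \<noteq> v" if "w \<in> R \<union> R'" "\<pi> w \<noteq> w" for w
  proof -
    have "w \<in> W" using that(1) R(4) by blast
    then show ?thesis using \<pi>(1,3)[of w] that(2) uvW(3,4) by metis
  qed
  have hu: "\<mu> * y c \<le> (\<mu>\<^sup>2 - real (card L) - real (card M) * s) * y u"
    if "(u, c) \<in> parcs G" "c \<notin> W - C" for c
    unfolding L_def M_def using uvW(1) R(2) \<pi>3 that R(4) by (intro hub_bound) auto
  have hv: "\<mu> * y c \<le> (\<mu>\<^sup>2 - real (card L') - real (card M') * s) * y v"
    if "(v, c) \<in> parcs G" "c \<notin> W - C" for c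
    unfolding L'_def M'_def using uvW(2) R(3) \<pi>3 that R(4) by (intro hub_bound) auto
  show thesis
  proof (rule that[OF ff d _ _ _ cnt(4,5,6,3) _ hu hv])
    show "(u, w) \<in> parcs G" if "w \<in> L \<union> M" for w using that R(2) by (auto simp: L_def M_def)
    show "(v, w) \<in> parcs G" if "w \<in> L' \<union> M'" for w using that R(3) by (auto simp: L'_def M'_def)
    show "(w, \<pi> w) \<in> parcs G" if "w \<in> M \<union> M'" for w using that \<pi>3 by (auto simp: M_def M'_def)
    have "card (W - C) = card W - card C" using C(1) finC by (rule card_Diff_subset[rotated])
    then show "card W - card C = card L + card L' + 2 * (card M + card M')"
      using cnt(7) ff d by (simp add: card_Un_disjoint)
  qed
qed

lemma s_eq: "s = \<mu>\<^sup>2 / (\<mu>\<^sup>2 - 1)" by (simp add: s_def)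

lemma yuv: "0 < y u" "0 < y v" using ypos uvW by auto

text \<open>Each hub is the further neighbour of the other, so the link weight is
  \<open>\<mu>\<close>.\<close>

lemma hubs_not_adjacent: "(u, v) \<notin> parcs G"
proof
  assume uv: "(u, v) \<in> parcs G"
  show False
  proof (rule hub_data[of "{}"])
    fix L L' M M' :: "'a set"
    assume c: "card W - card ({} :: 'a set) = card L + card L' + 2 * (card M + card M')"
      and u: "\<And>c. (u, c) \<in> parcs G \<Longrightarrow> c \<notin> W - {} \<Longrightarrow> \<mu> * y c \<le> (\<mu>\<^sup>2 - real (card L) - real (card M) * s) * y u"
      and v: "\<And>c. (v, c) \<in> parcs G \<Longrightarrow> c \<notin> W - {} \<Longrightarrow> \<mu> * y c \<le> (\<mu>\<^sup>2 - real (card L') - real (card M') * s) * y v"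
    have 1: "\<mu> * y v \<le> (\<mu>\<^sup>2 - real (card L) - real (card M) * s) * y u" using u[OF uv] uvW by simp
    have 2: "\<mu> * y u \<le> (\<mu>\<^sup>2 - real (card L') - real (card M') * s) * y v" using v[OF symE[OF uv]] uvW by simp
    have "0 < \<mu>" using l by simp
    note h = hub_product[OF yuv this 1 2]
    have n: "2 + card L + card L' + 2 * (card M + card M') = 4 + r + 2 * (p + q)"
      using c card_W by simp
    show False
      by (rule eqn.adjacent_hubs_impossible[OF n, folded s_eq, OF h])
  qed auto
qed

text \<open>If \<open>w\<close> is isolated in \<open>W\<close>, then
  \<open>y u + y v \<le> \<mu> * y w\<close> and the weight is 1. Otherwise both hubs act on the
  edge from \<open>w\<close> to \<open>\<pi> w\<close> like one hub of value
  \<open>y u + y v\<close>, and the weight is \<open>s\<close>. In either case each hub's own share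
  moves into its coefficient.\<close>

lemma no_common_neighbour:
  assumes w: "w \<in> W" "(u, w) \<in> parcs G" "(v, w) \<in> parcs G"
  shows False
proof (rule hub_data[of "{w, \<pi> w}"])
  show "{w, \<pi> w} \<subseteq> W" using w \<pi>(1) by simp
  show "x \<in> {w, \<pi> w} \<Longrightarrow> \<pi> x \<in> {w, \<pi> w}" for x using \<pi>(2)[OF w(1)] by auto
  fix L L' M M' :: "'a set"
  assume c: "card W - card {w, \<pi> w} = card L + card L' + 2 * (card M + card M')"
    and u: "\<And>c. (u, c) \<in> parcs G \<Longrightarrow> c \<notin> W - {w, \<pi> w} \<Longrightarrow> \<mu> * y c \<le> (\<mu>\<^sup>2 - real (card L) - real (card M) * s) * y u"
    and v: "\<And>c. (v, c) \<in> parcs G \<Longrightarrow> c \<notin> W - {w, \<pi> w} \<Longrightarrow> \<mu> * y c \<le> (\<mu>\<^sup>2 - real (card L') - real (card M') * s) * y v"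
  have hu: "\<mu> * y w \<le> (\<mu>\<^sup>2 - real (card L) - real (card M) * s) * y u" using u[OF w(2)] by simp
  have hv: "\<mu> * y w \<le> (\<mu>\<^sup>2 - real (card L') - real (card M') * s) * y v" using v[OF w(3)] by simp
  have wV: "w \<in> pverts G" using w(1) W(1) by blast
  show False
  proof (cases "\<pi> w = w")
    case True
    have one_pos: "0 < (1::real)" by simp
    have "sum y {u, v} \<le> \<mu> * y w"
      by (rule sum_le) (use symE[OF w(2)] symE[OF w(3)] wV in auto)
    then have "y u + y v \<le> \<mu> * y w" using W(3) by simp
    then have "1 * y v \<le> (\<mu>\<^sup>2 - real (card L) - real (card M) * s - 1) * y u"
      and "1 * y u \<le> (\<mu>\<^sup>2 - real (card L') - real (card M') * s - 1) * y v"
      using hu hv by (simp_all add: left_diff_distrib)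
    note h = hub_product[OF yuv one_pos this]
    have n: "3 + card L + card L' + 2 * (card M + card M') = 4 + r + 2 * (p + q)"
      using c card_W True by simp
    show False
      using eqn.common_leaf_impossible[OF n, folded s_eq] h by simp
  next
    case False
    have e: "(w, \<pi> w) \<in> parcs G" "\<pi> w \<in> W" using \<pi>(1,3) w(1) False by blast+
    have uvp: "u \<noteq> \<pi> w" "v \<noteq> \<pi> w" using e(2) uvW by blast+
    have "sum y {u, v, \<pi> w} \<le> \<mu> * y w"
      by (rule sum_le) (use symE[OF w(2)] symE[OF w(3)] e wV in auto)
    then have 1: "(y u + y v) + y (\<pi> w) \<le> \<mu> * y w" using W(3) uvp by simp
    have "sum y {w} \<le> \<mu> * y (\<pi> w)"
      by (rule sum_le) (use symE[OF e(1)] e(2) W(1) in auto)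
    then have "s * (y u + y v) \<le> \<mu> * y w" unfolding s_eq using branch_ge[OF l 1] by simp
    then have "s * y v \<le> (\<mu>\<^sup>2 - real (card L) - (real (card M) + 1) * s) * y u"
      and "s * y u \<le> (\<mu>\<^sup>2 - real (card L') - (real (card M') + 1) * s) * y v"
      using hu hv by (simp_all add: algebra_simps)
    note h = hub_product[OF yuv s_pos this]
    have n: "4 + card L + card L' + 2 * (card M + card M') = 4 + r + 2 * (p + q)"
      using c card_W False by simp
    show False
      using eqn.common_pendant_impossible[OF n, folded s_eq] h by blast
  qed
qed

text \<open>Without such an edge, \<open>u\<close> together with the components adjacent to it would
  be closed under adjacency, and \<open>v\<close> would be missing.\<close>

lemma middle_edge:
  obtains b where "b \<in> W" "\<pi> b \<noteq> b" "(u, b) \<in> parcs G" "(v, \<pi> b) \<in> parcs G"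
proof -
  have "\<exists>b\<in>W. (u, b) \<in> parcs G \<and> (v, \<pi> b) \<in> parcs G"
  proof (rule ccontr)
    assume n: "\<not> ?thesis"
    define Z where "Z = insert u {w \<in> W. (u, w) \<in> parcs G \<or> (u, \<pi> w) \<in> parcs G}"
    have "Z = pverts G"
    proof (rule closed_eq)
      show "Z \<subseteq> pverts G" "Z \<noteq> {}" using uvW W(1) by (auto simp: Z_def)
      fix a b assume ab: "a \<in> Z" "(a, b) \<in> parcs G"
      have "b \<in> pverts G" using ab(2) sub by blast
      then have "b \<in> W \<or> b = u \<or> b = v" using W(2) by blast
      then consider "b = u" | "b = v" | "b \<in> W" by blast
      then show "b \<in> Z"
      proof cases
        case 1 then show ?thesis by (simp add: Z_def)
      next
        case 2
        have "a \<noteq> u" using hubs_not_adjacent ab 2 by blast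
        then have a: "a \<in> W" "(u, a) \<in> parcs G \<or> (u, \<pi> a) \<in> parcs G" using ab(1) by (auto simp: Z_def)
        have va: "(v, a) \<in> parcs G" using symE[OF ab(2)] 2 by simp
        show ?thesis
        proof (cases "(u, a) \<in> parcs G")
          case True
          then show ?thesis using no_common_neighbour[OF a(1)] va by blast
        next
          case False
          then have "(u, \<pi> a) \<in> parcs G" "\<pi> a \<in> W" "\<pi> (\<pi> a) = a" using a \<pi>(1,2) by blast+
          then show ?thesis using n va by metis
        qed
      next
        case 3
        show ?thesis
        proof (cases "a = u")
          case True
          then show ?thesis using ab 3 by (simp add: Z_def)
        next
          case False
          then have a: "a \<in> W" "(u, a) \<in> parcs G \<or> (u, \<pi> a) \<in> parcs G" using ab(1) by (auto simp: Z_def)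
          then have "b = \<pi> a" using \<pi>(4)[OF a(1) 3 ab(2)] by simp
          moreover have "\<pi> (\<pi> a) = a" using a \<pi>(2) by blast
          ultimately show ?thesis using a(2) 3 unfolding Z_def by auto
        qed
      qed
    qed
    then have "v \<in> Z" using uvW by simp
    then show False using W(3) uvW by (simp add: Z_def)
  qed
  then obtain b where b: "b \<in> W" "(u, b) \<in> parcs G" "(v, \<pi> b) \<in> parcs G" by blast
  moreover have "\<pi> b \<noteq> b" using no_common_neighbour[OF b(1,2)] b(3) by metis
  ultimately show thesis using that by blast
qed

lemma iso_broom: "graph_iso G (broom p q r)"
proof (rule middle_edge)
  fix b assume b: "b \<in> W" "\<pi> b \<noteq> b" "(u, b) \<in> parcs G" "(v, \<pi> b) \<in> parcs G"
  have e: "(b, \<pi> b) \<in> parcs G" "\<pi> b \<in> W" "\<pi> (\<pi> b) = b" using \<pi>(1-3) b by blast+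
  have bV: "b \<in> pverts G" "\<pi> b \<in> pverts G" using b(1) e(2) W(1) by blast+
  have ne: "u \<noteq> b" "u \<noteq> \<pi> b" "v \<noteq> b" "v \<noteq> \<pi> b" using b(1) e(2) uvW(3,4) by blast+
  show ?thesis
  proof (rule hub_data[of "{b, \<pi> b}"])
    show "{b, \<pi> b} \<subseteq> W" using b e by simp
    show "x \<in> {b, \<pi> b} \<Longrightarrow> \<pi> x \<in> {b, \<pi> b}" for x using e(3) by auto
    fix L L' M M' :: "'a set"
    assume f: "finite L" "finite L'" "finite M" "finite M'" and d: "L \<inter> L' = {}" "M \<inter> M' = {}"
      and nb: "\<And>w. w \<in> L \<union> M \<Longrightarrow> (u, w) \<in> parcs G" "\<And>w. w \<in> L' \<union> M' \<Longrightarrow> (v, w) \<in> parcs G"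
      and pe: "\<And>w. w \<in> M \<union> M' \<Longrightarrow> (w, \<pi> w) \<in> parcs G" "inj_on \<pi> (M \<union> M')" "(M \<union> M') \<inter> \<pi> ` (M \<union> M') = {}"
      and LM: "(L \<union> L') \<inter> ((M \<union> M') \<union> \<pi> ` (M \<union> M')) = {}"
      and WC: "W - {b, \<pi> b} = (L \<union> L') \<union> (M \<union> M') \<union> \<pi> ` (M \<union> M')"
      and c: "card W - card {b, \<pi> b} = card L + card L' + 2 * (card M + card M')"
      and u: "\<And>c. (u, c) \<in> parcs G \<Longrightarrow> c \<notin> W - {b, \<pi> b} \<Longrightarrow> \<mu> * y c \<le> (\<mu>\<^sup>2 - real (card L) - real (card M) * s) * y u"
      and v: "\<And>c. (v, c) \<in> parcs G \<Longrightarrow> c \<notin> W - {b, \<pi> b} \<Longrightarrow> \<mu> * y c \<le> (\<mu>\<^sup>2 - real (card L') - real (card M') * s) * y v"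
    have hu: "\<mu> * y b \<le> (\<mu>\<^sup>2 - real (card L) - real (card M) * s) * y u" using u[OF b(3)] by simp
    have hv: "\<mu> * y (\<pi> b) \<le> (\<mu>\<^sup>2 - real (card L') - real (card M') * s) * y v" using v[OF b(4)] by simp
    have "sum y {u, \<pi> b} \<le> \<mu> * y b" by (rule sum_le) (use symE[OF b(3)] e(1) bV in auto)
    then have 1: "y u + y (\<pi> b) \<le> \<mu> * y b" using ne by simp
    have "sum y {b, v} \<le> \<mu> * y (\<pi> b)" by (rule sum_le) (use symE[OF b(4)] symE[OF e(1)] bV in auto)
    then have 2: "y b + y v \<le> \<mu> * y (\<pi> b)" using ne by simp
    have m1: "s * y u + s / \<mu> * y v \<le> \<mu> * y b" unfolding s_eq by (rule middle_ge[OF l 1 2])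
    have m2: "s * y v + s / \<mu> * y u \<le> \<mu> * y (\<pi> b)" unfolding s_eq
      by (rule middle_ge[OF l, of _ "y b"]) (use 1 2 in simp_all)
    have sl: "0 < s / \<mu>" using s_pos l by simp
    have "s / \<mu> * y v \<le> (\<mu>\<^sup>2 - real (card L) - (real (card M) + 1) * s) * y u"
      and "s / \<mu> * y u \<le> (\<mu>\<^sup>2 - real (card L') - (real (card M') + 1) * s) * y v"
      using hu hv m1 m2 by (simp_all add: algebra_simps)
    note h = hub_product[OF yuv sl this, unfolded power_divide]
    have n: "4 + card L + card L' + 2 * (card M + card M') = 4 + r + 2 * (p + q)"
      using c card_W b(2) by simp
    have params: "card L = 0 \<and> card M = p \<and> card L' = r \<and> card M' = q \<or>
        card L = r \<and> card M = q \<and> card L' = 0 \<and> card M' = p"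
      by (rule eqn.path_hubs_unique[OF n, folded s_eq, OF h])
    have dist: "distinct [u, b, \<pi> b, v]" using ne b(2) W(3) by auto
    have Vd: "pverts G = {u, b, \<pi> b, v} \<union> (W - {b, \<pi> b})" using W(1,2) b(1) e(2) by blast
    have off: "{u, b, \<pi> b, v} \<inter> (W - {b, \<pi> b}) = {}" using uvW(3,4) by blast
    from params show ?thesis
    proof
      assume par: "card L = 0 \<and> card M = p \<and> card L' = r \<and> card M' = q"
      then have L0: "L = {}" using f by simp
      have "\<exists>f. emb (parcs G) (broom (card M) (card M') (card L')) f ({u, b, \<pi> b, v} \<union> M \<union> M' \<union> \<pi> ` (M \<union> M') \<union> L')"
      proof (rule broom_emb[OF b(3) e(1) symE[OF b(4)] dist f(3,4,2)])
        show "card L' \<le> 1" using par r by simp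
        show "{u, b, \<pi> b, v} \<inter> (M \<union> M' \<union> \<pi> ` (M \<union> M') \<union> L') = {}" using off unfolding WC by blast
        show "L' \<inter> (M \<union> M' \<union> \<pi> ` (M \<union> M')) = {}" using LM by blast
        show "(u, w) \<in> parcs G" if "w \<in> M" for w using nb(1) that by simp
        show "(v, w) \<in> parcs G" if "w \<in> M' \<union> L'" for w using nb(2) that by blast
      qed (use pe d in auto)
      moreover have "{u, b, \<pi> b, v} \<union> M \<union> M' \<union> \<pi> ` (M \<union> M') \<union> L' = pverts G"
        unfolding Vd WC L0 by blast
      ultimately show ?thesis using spanning_emb_iso[OF _ conn_broom[OF r] le] par by auto
    next
      \<comment> \<open>The mirror image: the path is read from \<open>v\<close> to
        \<open>u\<close>, so that \<open>v\<close> takes the role of \<open>a\<close>.\<close>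
      assume par: "card L = r \<and> card M = q \<and> card L' = 0 \<and> card M' = p"
      then have L0: "L' = {}" using f by simp
      have "\<exists>f. emb (parcs G) (broom (card M') (card M) (card L)) f ({v, \<pi> b, b, u} \<union> M' \<union> M \<union> \<pi> ` (M' \<union> M) \<union> L)"
      proof (rule broom_emb[OF b(4) symE[OF e(1)] symE[OF b(3)] _ f(4,3,1)])
        show "distinct [v, \<pi> b, b, u]" using dist by auto
        show "card L \<le> 1" using par r by simp
        show "{v, \<pi> b, b, u} \<inter> (M' \<union> M \<union> \<pi> ` (M' \<union> M) \<union> L) = {}" using off unfolding WC by blast
        show "L \<inter> (M' \<union> M \<union> \<pi> ` (M' \<union> M)) = {}" using LM by blast
        show "(v, w) \<in> parcs G" if "w \<in> M'" for w using nb(2) that by simp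
        show "(u, w) \<in> parcs G" if "w \<in> M \<union> L" for w using nb(1) that by blast
        show "inj_on \<pi> (M' \<union> M)" using pe(2) by (simp add: Un_commute)
        show "(w, \<pi> w) \<in> parcs G" if "w \<in> M' \<union> M" for w using that pe(1) by blast
        show "(M' \<union> M) \<inter> \<pi> ` (M' \<union> M) = {}" using pe(3) by (simp add: Un_commute)
        show "M' \<inter> M = {}" using d(2) by blast
      qed
      moreover have "{v, \<pi> b, b, u} \<union> M' \<union> M \<union> \<pi> ` (M' \<union> M) \<union> L = pverts G"
        unfolding Vd WC L0 by blast
      ultimately show ?thesis using spanning_emb_iso[OF _ conn_broom[OF r] le] par by auto
    qed
  qed
qed

end

lemma (in conn_graph) broom_unique:
  assumes pq: "q \<le> p" "p \<le> Suc q" "2 \<le> p" and r: "r \<le> 1"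
    and n: "card (pverts G) = 4 + 2 * p + 2 * q + r"
    and k: "dissociation_number G = 2 + 2 * p + 2 * q + r"
    and le: "rho G \<le> rho (broom p q r)"
  shows "graph_iso G (broom p q r)"
proof -
  obtain y where y: "\<And>v. v \<in> pverts G \<Longrightarrow> 0 < y v" "\<And>v. v \<in> pverts G \<Longrightarrow> nsum (parcs G) y v = rho G * y v"
    by (rule perron_rho) blast
  obtain W where W: "W \<subseteq> pverts G" "\<And>v. v \<in> W \<Longrightarrow> card (parcs G `` {v} \<inter> W) \<le> 1"
    "card W = dissociation_number G"
    by (rule dissociation_number_attained) blast
  have "card (pverts G - W) = 2" using W n k fin by (simp add: card_Diff_subset finite_subset)
  then obtain u v where uv: "pverts G - W = {u, v}" "u \<noteq> v" by (auto simp: card_2_iff)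
  have "dissoc (parcs G) W" using W(2) by (simp add: dissoc_def)
  from partner[OF W(1) this] obtain \<pi> where
    Q: "\<forall>w\<in>W. \<pi> w \<in> W \<and> \<pi> (\<pi> w) = w \<and> (\<pi> w \<noteq> w \<longrightarrow> (w, \<pi> w) \<in> parcs G) \<and>
      (\<forall>z\<in>W. (w, z) \<in> parcs G \<longrightarrow> z = \<pi> w)" ..
  have super: "nsum (parcs G) y v \<le> rho (broom p q r) * y v" if "v \<in> pverts G" for v
    using y[OF that] le by (simp add: mult_right_mono)
  have "super_graph_axioms (pverts G) (parcs G) y (rho (broom p q r))"
    using broom_equation_rho(1)[OF pq r] y(1) super by (simp add: super_graph_axioms_def)
  then have sg: "super_graph (pverts G) (parcs G) y (rho (broom p q r))"
    by (simp add: super_graph_def sgraph_axioms)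
  have "two_hubs_axioms G p q r u v W \<pi>"
    unfolding two_hubs_axioms_def using pq r n le W(1) uv Q by blast
  then have "two_hubs G y p q r u v W \<pi>"
    using sg conn_graph_axioms by (simp add: two_hubs_def)
  then show ?thesis by (rule two_hubs.iso_broom)
qed


section \<open>The extremal graphs\<close>

lemma nat_floor_half: "1 \<le> n \<Longrightarrow> nat \<lfloor>(real n - 1) / 2\<rfloor> = (n - 1) div 2"
proof -
  assume "1 \<le> n"
  then have "(real n - 1) / 2 = real (n - 1) / real 2" by (simp add: of_nat_diff)
  then have "\<lfloor>(real n - 1) / 2\<rfloor> = int ((n - 1) div 2)" by (simp only: floor_divide_of_nat_eq)
  then show ?thesis by simp
qed

lemma floor_quarter: "nat \<lfloor>(real (2 * m + 4) - 4) / 4\<rfloor> = m div 2"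
proof -
  have "(real (2 * m + 4) - 4) / 4 = real m / real 2" by simp
  then have "\<lfloor>(real (2 * m + 4) - 4) / 4\<rfloor> = int (m div 2)" by (simp only: floor_divide_of_nat_eq)
  then show ?thesis by simp
qed

lemma ceiling_quarter: "nat \<lceil>(real (2 * m + 4) - 4) / 4\<rceil> = Suc m div 2"
proof (cases "even m")
  case True
  then obtain a where "m = 2 * a" by (elim evenE)
  then show ?thesis by simp
next
  case False
  then obtain a where a: "m = 2 * a + 1" by (elim oddE)
  have "\<lceil>(real (2 * m + 4) - 4) / 4\<rceil> = int a + 1"
    by (rule ceiling_unique) (simp_all add: a)
  then show ?thesis using a by simp
qed

lemma ceiling_two_thirds: "int k = \<lceil>2 * real n / 3\<rceil> \<longleftrightarrow> k = (2 * n + 2) div 3"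
proof -
  have "\<lceil>2 * real n / 3\<rceil> = int ((2 * n + 2) div 3)"
  proof (rule ceiling_unique)
    have "3 * ((2 * n + 2) div 3) \<le> 2 * n + 2" "2 * n \<le> 3 * ((2 * n + 2) div 3)" by presburger+
    then have "real (3 * ((2 * n + 2) div 3)) \<le> real (2 * n + 2)" "real (2 * n) \<le> real (3 * ((2 * n + 2) div 3))"
      by (simp_all only: of_nat_le_iff)
    then show "real_of_int (int ((2 * n + 2) div 3)) - 1 < 2 * real n / 3"
      "2 * real n / 3 \<le> real_of_int (int ((2 * n + 2) div 3))" by simp_all
  qed
  then show ?thesis by simp
qed

lemma floor_two_thirds: "int k = \<lfloor>2 * real n / 3\<rfloor> \<longleftrightarrow> k = 2 * n div 3"
proof -
  have "\<lfloor>real (2 * n) / real 3\<rfloor> = int (2 * n div 3)" by (rule floor_divide_of_nat_eq)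
  then have "\<lfloor>2 * real n / 3\<rfloor> = int (2 * n div 3)" by simp
  then show ?thesis by (simp only: int_int_eq)
qed

text \<open>Apart from the path and the possible leaf, \<open>H(n)\<close> consists of
  \<open>m\<close> branch edges, divided as evenly as possible between the hubs.\<close>

lemma H_tree_eq_broom:
  assumes n: "n = 2 * m + 4 + r" and r: "r \<le> 1"
  shows "H_tree n = broom (Suc m div 2) (m div 2) r"
proof -
  have H: "H_tree_even (2 * m + 4) = broom (Suc m div 2) (m div 2) 0"
    by (simp only: H_tree_even_def floor_quarter ceiling_quarter broom_def funpow_0)
  consider "r = 0" | "r = 1" using r by linarith
  then show ?thesis
  proof cases
    case 1
    then have "H_tree n = H_tree_even (2 * m + 4)" using n by (simp add: H_tree_def)
    then show ?thesis using H 1 by simp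
  next
    case 2
    then have "H_tree n = attach_leaf 3 (H_tree_even (2 * m + 4))" using n by (simp add: H_tree_def add.commute)
    then show ?thesis using 2 unfolding H by (simp add: broom_def)
  qed
qed

lemma S_tree_0_1: "S_tree 0 1 = path_graph 3"
proof -
  have "pverts (S_tree 0 1) = pverts (path_graph 3)" by (simp add: S_tree_eq path_graph_def numeral_3_eq_3)
  moreover have "parcs (S_tree 0 1) = parcs (path_graph 3)"
    by (simp add: S_tree_eq path_graph_def branch_arcs_def) auto
  ultimately show ?thesis by (rule pair_pre_digraph.equality) simp
qed

section \<open>Comparison with the extremal graph in each case\<close>

context conn_graph
begin

lemma minimal_S_tree:
  assumes n: "card (pverts G) = n" "3 \<le> n" and k: "dissociation_number G = n - 1"
    and min: "\<And>H :: nat pair_pre_digraph. H \<in> connected_graphs_with_dissociation_number n (n - 1) \<Longrightarrow> rho G \<le> rho H"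
  shows "graph_iso G (S_tree (if odd n then 0 else 1) ((n - 1) div 2))"
proof -
  define r t where "r = (if odd n then 0 else 1 :: nat)" and "t = (n - 1) div 2"
  have r: "r \<le> 1" by (simp add: r_def)
  have nrt: "n = 1 + r + 2 * t" using n(2) by (auto simp: r_def t_def elim!: oddE evenE)
  have t: "0 < t" using n(2) nrt r by linarith
  have "S_tree r t \<in> connected_graphs_with_dissociation_number n (n - 1)"
    using conn_S_tree[OF r] dissociation_number_S_tree[OF r t] S_tree_eq(1)[OF r, of t] nrt
    by (simp add: mem_class_iff)
  then have le: "rho G \<le> rho (S_tree r t)" by (rule min)
  have "graph_iso G (S_tree r t)"
  proof (cases "2 \<le> r + t")
    case True
    show ?thesis by (rule S_tree_unique[OF r True _ _ le]) (use n k nrt in simp_all)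
  next
    \<comment> \<open>Here \<open>n = 3\<close>, where \<open>\<sigma> = 2\<close> makes a branch
      edge weigh as much as two leaves; the tree is a path and is treated as one.\<close>
    case False
    then have rt: "r = 0" "t = 1" using t by linarith+
    then have "n = 3" using nrt by simp
    then show ?thesis using path_if_rho_le[OF n(1)] le unfolding rt S_tree_0_1 by simp
  qed
  then show ?thesis by (simp add: r_def t_def)
qed

lemma minimal_H_tree:
  assumes n: "card (pverts G) = n" "10 \<le> n" and k: "dissociation_number G = n - 2"
    and min: "\<And>H :: nat pair_pre_digraph. H \<in> connected_graphs_with_dissociation_number n (n - 2) \<Longrightarrow> rho G \<le> rho H"
  shows "graph_iso G (H_tree n)"
proof -
  define r m where "r = n mod 2" and "m = (n - 4) div 2"
  have r: "r \<le> 1" by (simp add: r_def)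
  have nm: "n = 2 * m + 4 + r" using n(2) unfolding r_def m_def by presburger
  define p q where "p = Suc m div 2" and "q = m div 2"
  \<comment> \<open>This is where \<open>n \<ge> 10\<close> enters: \<open>m \<ge> 3\<close> gives
    \<open>p \<ge> 2\<close> and \<open>q \<ge> 1\<close>.\<close>
  have m3: "3 \<le> m" using nm n(2) r by linarith
  have pq: "q \<le> p" "p \<le> Suc q" "2 \<le> p" "0 < q" using m3 unfolding p_def q_def by presburger+
  have mpq: "m = p + q" unfolding p_def q_def by presburger
  have H: "H_tree n = broom p q r" unfolding p_def q_def by (rule H_tree_eq_broom[OF nm r])
  have p0: "0 < p" using pq by simp
  have "broom p q r \<in> connected_graphs_with_dissociation_number n (n - 2)"
    using conn_broom[OF r] dissociation_number_broom[OF r p0 pq(4)] broom_eq(1)[OF r, of p q] nm mpq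
    by (simp add: mem_class_iff)
  then have "rho G \<le> rho (broom p q r)" by (rule min)
  then show ?thesis unfolding H using n k nm mpq by (intro broom_unique pq r) simp_all
qed

lemma minimal_path:
  assumes n: "card (pverts G) = n" "2 \<le> n"
    and min: "\<And>H :: nat pair_pre_digraph. H \<in> connected_graphs_with_dissociation_number n ((2 * n + 2) div 3) \<Longrightarrow> rho G \<le> rho H"
  shows "is_path_graph G"
proof -
  have "path_graph n \<in> connected_graphs_with_dissociation_number n ((2 * n + 2) div 3)"
    using conn_path_graph[of n] dissociation_number_path_graph[of n] n by (simp add: mem_class_iff path_graph_def)
  then have "graph_iso G (path_graph n)" using path_if_rho_le[OF n] min by blast
  then show ?thesis using n unfolding is_path_graph_def by (intro exI[of _ n]) simp
qed

lemma minimal_cycle: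
  assumes n: "card (pverts G) = n" "3 \<le> n" "n mod 3 \<noteq> 0" and k: "dissociation_number G = 2 * n div 3"
    and min: "\<And>H :: nat pair_pre_digraph. H \<in> connected_graphs_with_dissociation_number n (2 * n div 3) \<Longrightarrow> rho G \<le> rho H"
  shows "is_cycle_graph G"
proof -
  \<comment> \<open>Otherwise a dissociation set with at least \<open>2 * n / 3\<close> elements
    exists, more than \<open>2 * n div 3\<close> as 3 does not divide \<open>n\<close>.\<close>
  have "\<not> one_degenerate (parcs G) (pverts G)"
  proof
    assume "one_degenerate (parcs G) (pverts G)"
    then obtain S where S: "S \<subseteq> pverts G" "dissoc (parcs G) S" "2 * n \<le> 3 * card S"
      using dissoc_of_one_degenerate[of "pverts G"] n(1) by blast
    have "card S \<le> dissociation_number G"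
      by (rule dissociation_number_ge) (use S in \<open>auto simp: dissoc_def\<close>)
    then have "2 * n \<le> 3 * (2 * n div 3)" using S(3) k by simp
    then show False using n(3) by presburger
  qed
  moreover have "cycle_graph n \<in> connected_graphs_with_dissociation_number n (2 * n div 3)"
    using conn_cycle_graph[OF n(2)] dissociation_number_cycle_graph[OF n(2)] by (simp add: mem_class_iff cycle_graph_def)
  then have "rho G \<le> 2" using min rho_cycle_graph[OF n(2)] by metis
  ultimately show ?thesis by (rule iso_cycle_if_not_one_degenerate(2))
qed

lemma minimal_balanced:
  assumes n: "card (pverts G) = n" "3 \<le> n" and k: "dissociation_number G = 2"
    and min: "\<And>H :: nat pair_pre_digraph. H \<in> connected_graphs_with_dissociation_number n 2 \<Longrightarrow> rho G \<le> rho H"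
  shows "balanced_complete_multipartite (nat \<lceil>real n / 2\<rceil>) G"
proof -
  have "co_matching_graph n \<in> connected_graphs_with_dissociation_number n 2"
    using conn_co_matching_graph[OF n(2)] dissociation_number_co_matching_graph[OF n(2)]
    by (simp add: mem_class_iff co_matching_graph_def)
  then have "rho G \<le> co_matching_rho n" using min rho_co_matching_graph[OF n(2)] by metis
  then show ?thesis by (rule balanced_if_minimal[OF k n])
qed

end

theorem theorem1p2:
  fixes G :: "'a pair_pre_digraph" and n k :: nat
  assumes "0 < n" and "0 < k" and "2 \<le> k" and "k \<le> n - 1"
    and "G \<in> connected_graphs_with_dissociation_number n k"
    and "\<forall>H \<in> (connected_graphs_with_dissociation_number n k :: nat pair_pre_digraph set).
           rho G \<le> rho H"
  shows
    "(k = n - 1 \<longrightarrow>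
        graph_iso G (S_tree (if odd n then 0 else 1) (nat \<lfloor>(real n - 1) / 2\<rfloor>))) \<and>
     (k = n - 2 \<and> n \<ge> 10 \<longrightarrow> graph_iso G (H_tree n)) \<and>
     (int k = \<lceil>2 * real n / 3\<rceil> \<longrightarrow> is_path_graph G) \<and>
     (int k = \<lfloor>2 * real n / 3\<rfloor> \<and> n mod 3 \<noteq> 0 \<longrightarrow> is_cycle_graph G) \<and>
     (k = 2 \<longrightarrow> balanced_complete_multipartite (nat \<lceil>real n / 2\<rceil>) G)"
proof -
  interpret conn_graph G using assms(5) by (simp add: mem_class_iff)
  have n: "card (pverts G) = n" and k: "dissociation_number G = k"
    using assms(5) by (simp_all add: mem_class_iff)
  have n3: "3 \<le> n" using assms(3,4) by linarith
  have min: "rho G \<le> rho H" if "H \<in> connected_graphs_with_dissociation_number n k"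
    for H :: "nat pair_pre_digraph" using assms(6) that by blast
  show ?thesis unfolding ceiling_two_thirds floor_two_thirds
  proof (intro conjI impI)
    assume "k = n - 1"
    then show "graph_iso G (S_tree (if odd n then 0 else 1) (nat \<lfloor>(real n - 1) / 2\<rfloor>))"
      using minimal_S_tree[OF n n3] k min nat_floor_half[of n] n3 by simp
  next
    assume "k = n - 2 \<and> 10 \<le> n"
    then show "graph_iso G (H_tree n)" using minimal_H_tree[OF n] k min by simp
  next
    assume "k = (2 * n + 2) div 3"
    then show "is_path_graph G" using minimal_path[OF n] n3 min by simp
  next
    assume "k = 2 * n div 3 \<and> n mod 3 \<noteq> 0"
    then show "is_cycle_graph G" using minimal_cycle[OF n n3] k min by simp
  next
    assume "k = 2"
    then show "balanced_complete_multipartite (nat \<lceil>real n / 2\<rceil>) G" using minimal_balanced[OF n n3] k min by simp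
  qed
qed


end
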